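(* Let $H$ be a closed subspace of $L^2(G\times Y)$ that is invariant under the translation representation $\rho_{G\times Y}$ of $G$, and let $\mathcal{V}$ be the W*-algebra of translation-invariant bounded linear operators acting in $H$. Then $\mathcal{V}$ is commutative if and only if $d_\xi=1$ for $\widehat{\nu}$-almost every point $\xi$ of $\Omega$.
   Context: $G$ is a locally compact abelian group (written additively) with a Haar measure $\nu$, and $Y$ is a measure space with a measure $\lambda$. It is assumed that $G$ is $\sigma$-compact and metrizable, $\lambda$ is $\sigma$-finite, and $L^2(G,\nu)$ and $L^2(Y,\lambda)$ are separable. $G\times Y$ carries the product measure. $\widehat{G}$ is the dual group; $\widehat{\nu}$ is the dual Haar measure, so that the Fourier transform $(F_1f)(\xi)=\int_G\overline{\xi(x)}f(x)\,\mathrm{d}\nu(x)$ extends from $L^1(G)\cap L^2(G)$ to a unitary operator $F\colon L^2(G)\to L^2(\widehat{G},\widehat{\nu})$. $F\otimes I=F\otimes I_{L^2(Y)}\colon L^2(G\times Y)\to L^2(\widehat{G}\times Y)$. $(\rho_{G\times Y}(a)f)(u,v)=f(u-a,v)$; $P$ is the orthogonal projection of $L^2(G\times Y)$ onto $H$ (invariance of $H$ means $P$ commutes with all $\rho_{G\times Y}(a)$). $\rho_H(a)$ is the compression of $\rho_{G\times Y}(a)$ to $H$ and $\mathcal{V}=\rho_H'=\{S\in\mathcal{B}(H)\colon \rho_H(a)S=S\rho_H(a)\ \forall a\in G\}$. The projection $\widehat{P}=(F\otimes I)P(F\otimes I)^\ast$ decomposes as $\widehat{P}=\int^\oplus_{\widehat{G}}\widehat{P}_\xi\,\mathrm{d}\widehat{\nu}(\xi)$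 with respect to $L^2(\widehat{G}\times Y)=\int^\oplus_{\widehat{G}}L^2(Y)\,\mathrm{d}\widehat{\nu}(\xi)$, for a (measurable) family $(\widehat{P}_\xi)_{\xi\in\widehat{G}}$ of orthogonal projections in $L^2(Y)$; such a family is fixed. $\widehat{H}_\xi=\widehat{P}_\xi(L^2(Y))$, $d_\xi=\dim(\widehat{H}_\xi)$, $\Omega=\{\xi\in\widehat{G}\colon d_\xi>0\}$. *)

theory Defs
  imports "HOL-Analysis.Analysis" "HOL-Library.Extended_Nat"
begin

section \<open>Hilbert spaces of square-integrable functions\<close>

text \<open>
  Elements of \<open>L\<^sup>2(M)\<close> are represented by square-integrable functions, and equality
  in \<open>L\<^sup>2(M)\<close> is \<open>ae_eq M\<close>. Operators act on representatives and are
  compatible with \<open>ae_eq\<close>; an equation between operators is read modulo \<open>ae_eq\<close>.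
  The inner product is linear in the first argument.
\<close>

definition ae_eq :: "'a measure \<Rightarrow> ('a \<Rightarrow> complex) \<Rightarrow> ('a \<Rightarrow> complex) \<Rightarrow> bool" where
  "ae_eq M f g \<longleftrightarrow> (AE x in M. f x = g x)"

definition L2 :: "'a measure \<Rightarrow> ('a \<Rightarrow> complex) set" where
  "L2 M = {f \<in> borel_measurable M. integrable M (\<lambda>x. (cmod (f x))\<^sup>2)}"

definition L2_inner :: "'a measure \<Rightarrow> ('a \<Rightarrow> complex) \<Rightarrow> ('a \<Rightarrow> complex) \<Rightarrow> complex" where
  "L2_inner M f g = (\<integral>x. f x * cnj (g x) \<partial>M)"

definition L2_norm :: "'a measure \<Rightarrow> ('a \<Rightarrow> complex) \<Rightarrow> real" where
  "L2_norm M f = sqrt (\<integral>x. (cmod (f x))\<^sup>2 \<partial>M)"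

definition separable_L2 :: "'a measure \<Rightarrow> bool" where
  "separable_L2 M \<longleftrightarrow>
     (\<exists>D. countable D \<and> D \<subseteq> L2 M \<and>
        (\<forall>f\<in>L2 M. \<forall>e>0. \<exists>d\<in>D. L2_norm M (\<lambda>x. f x - d x) < e))"

text \<open>Closedness (applied to constant sequences) makes \<open>H\<close> a union of \<open>ae_eq\<close>-classes.\<close>

definition closed_subspace :: "'a measure \<Rightarrow> ('a \<Rightarrow> complex) set \<Rightarrow> bool" where
  "closed_subspace M H \<longleftrightarrow>
     H \<subseteq> L2 M \<and> (\<lambda>x. 0) \<in> H \<and>
     (\<forall>f\<in>H. \<forall>g\<in>H. (\<lambda>x. f x + g x) \<in> H) \<and>
     (\<forall>c. \<forall>f\<in>H. (\<lambda>x. c * f x) \<in> H) \<and>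
     (\<forall>s. \<forall>f\<in>L2 M. (\<forall>n. s n \<in> H) \<longrightarrow>
        (\<lambda>n::nat. L2_norm M (\<lambda>x. s n x - f x)) \<longlonglongrightarrow> 0 \<longrightarrow> f \<in> H)"

text \<open>Bounded linear operators from \<open>H \<subseteq> L\<^sup>2(M)\<close> to \<open>K \<subseteq> L\<^sup>2(N)\<close>.\<close>

definition bounded_op ::
  "'a measure \<Rightarrow> ('a \<Rightarrow> complex) set \<Rightarrow> 'b measure \<Rightarrow> ('b \<Rightarrow> complex) set \<Rightarrow>
   (('a \<Rightarrow> complex) \<Rightarrow> ('b \<Rightarrow> complex)) \<Rightarrow> bool" where
  "bounded_op M H N K T \<longleftrightarrow>
     (\<forall>f\<in>H. T f \<in> K) \<and>
     (\<forall>f\<in>H. \<forall>g\<in>H. ae_eq M f g \<longrightarrow> ae_eq N (T f) (T g)) \<and>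
     (\<forall>f\<in>H. \<forall>g\<in>H. ae_eq N (T (\<lambda>x. f x + g x)) (\<lambda>y. T f y + T g y)) \<and>
     (\<forall>c. \<forall>f\<in>H. ae_eq N (T (\<lambda>x. c * f x)) (\<lambda>y. c * T f y)) \<and>
     (\<exists>C. \<forall>f\<in>H. L2_norm N (T f) \<le> C * L2_norm M f)"

definition unitary_op ::
  "'a measure \<Rightarrow> 'b measure \<Rightarrow> (('a \<Rightarrow> complex) \<Rightarrow> ('b \<Rightarrow> complex)) \<Rightarrow> bool" where
  "unitary_op M N U \<longleftrightarrow>
     bounded_op M (L2 M) N (L2 N) U \<and>
     (\<forall>f\<in>L2 M. \<forall>g\<in>L2 M. L2_inner N (U f) (U g) = L2_inner M f g) \<and>
     (\<forall>g\<in>L2 N. \<exists>f\<in>L2 M. ae_eq N (U f) g)"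

definition adjoint_op ::
  "'a measure \<Rightarrow> 'b measure \<Rightarrow> (('a \<Rightarrow> complex) \<Rightarrow> ('b \<Rightarrow> complex)) \<Rightarrow>
   ('b \<Rightarrow> complex) \<Rightarrow> ('a \<Rightarrow> complex)" where
  "adjoint_op M N T g =
     (SOME f. f \<in> L2 M \<and> (\<forall>h\<in>L2 M. L2_inner N (T h) g = L2_inner M h f))"

definition orth_projection ::
  "'a measure \<Rightarrow> (('a \<Rightarrow> complex) \<Rightarrow> ('a \<Rightarrow> complex)) \<Rightarrow> bool" where
  "orth_projection M Q \<longleftrightarrow>
     bounded_op M (L2 M) M (L2 M) Q \<and>
     (\<forall>f\<in>L2 M. ae_eq M (Q (Q f)) (Q f)) \<and>
     (\<forall>f\<in>L2 M. \<forall>g\<in>L2 M. L2_inner M (Q f) g = L2_inner M f (Q g))"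

definition proj_onto ::
  "'a measure \<Rightarrow> ('a \<Rightarrow> complex) set \<Rightarrow> ('a \<Rightarrow> complex) \<Rightarrow> ('a \<Rightarrow> complex)" where
  "proj_onto M H f =
     (SOME p. p \<in> H \<and> (\<forall>h\<in>H. L2_inner M (\<lambda>x. f x - p x) h = 0))"

definition op_range ::
  "'a measure \<Rightarrow> (('a \<Rightarrow> complex) \<Rightarrow> ('a \<Rightarrow> complex)) \<Rightarrow> ('a \<Rightarrow> complex) set" where
  "op_range M Q = {g \<in> L2 M. \<exists>f\<in>L2 M. ae_eq M (Q f) g}"

text \<open>Orthonormality forces distinct members of \<open>B\<close> to lie in distinct \<open>ae_eq\<close>-classes.\<close>

definition orthonormal_basis ::
  "'a measure \<Rightarrow> ('a \<Rightarrow> complex) set \<Rightarrow> ('a \<Rightarrow> complex) set \<Rightarrow> bool" where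
  "orthonormal_basis M H B \<longleftrightarrow>
     B \<subseteq> H \<and>
     (\<forall>f\<in>B. \<forall>g\<in>B. L2_inner M f g = (if f = g then 1 else 0)) \<and>
     (\<forall>h\<in>H. (\<forall>b\<in>B. L2_inner M h b = 0) \<longrightarrow> ae_eq M h (\<lambda>x. 0))"

text \<open>Hilbert dimension, with a single value \<open>\<infinity>\<close> for all infinite-dimensional spaces.\<close>

definition hilbert_dim :: "'a measure \<Rightarrow> ('a \<Rightarrow> complex) set \<Rightarrow> enat" where
  "hilbert_dim M H =
     (THE d. \<exists>B. orthonormal_basis M H B \<and> d = (if finite B then enat (card B) else \<infinity>))"


section \<open>Haar measures and the dual group\<close>

definition haar_measure :: "'g::{topological_space, ab_group_add} measure \<Rightarrow> bool" where
  "haar_measure \<mu> \<longleftrightarrow>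
     sets \<mu> = sets borel \<and>
     emeasure \<mu> UNIV \<noteq> 0 \<and>
     (\<forall>a. \<forall>A\<in>sets borel. emeasure \<mu> ((\<lambda>x. a + x) ` A) = emeasure \<mu> A) \<and>
     (\<forall>K. compact K \<longrightarrow> emeasure \<mu> K < \<infinity>) \<and>
     (\<forall>A\<in>sets borel. emeasure \<mu> A = (INF U\<in>{U. open U \<and> A \<subseteq> U}. emeasure \<mu> U)) \<and>
     (\<forall>U. open U \<longrightarrow> emeasure \<mu> U = (SUP K\<in>{K. compact K \<and> K \<subseteq> U}. emeasure \<mu> K))"

typedef (overloaded) ('g::topological_ab_group_add) dual =
  "{\<gamma> :: 'g \<Rightarrow> complex. continuous_on UNIV \<gamma> \<and> (\<forall>x. cmod (\<gamma> x) = 1) \<and>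
     (\<forall>x y. \<gamma> (x + y) = \<gamma> x * \<gamma> y)}"
  morphisms char_fun Abs_dual
  by (rule exI[of _ "\<lambda>_. 1"]) auto

setup_lifting type_definition_dual

instantiation dual :: (topological_ab_group_add) ab_group_add
begin

lift_definition zero_dual :: "'a dual" is "\<lambda>_. 1"
  by auto

lift_definition plus_dual :: "'a dual \<Rightarrow> 'a dual \<Rightarrow> 'a dual" is "\<lambda>\<gamma> \<psi> x. \<gamma> x * \<psi> x"
  by (auto intro!: continuous_intros simp: norm_mult)

lift_definition uminus_dual :: "'a dual \<Rightarrow> 'a dual" is "\<lambda>\<gamma> x. cnj (\<gamma> x)"
  by (auto intro!: continuous_intros)

definition minus_dual :: "'a dual \<Rightarrow> 'a dual \<Rightarrow> 'a dual" where
  "minus_dual \<gamma> \<psi> = \<gamma> + - \<psi>"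

instance
proof
  fix a b c :: "'a dual"
  show "a + b + c = a + (b + c)"
    by transfer (simp add: mult.assoc)
  show "a + b = b + a"
    by transfer (simp add: mult.commute)
  show "0 + a = a"
    by transfer simp
  show "- a + a = 0"
  proof (transfer, rule ext)
    fix \<gamma> :: "'a \<Rightarrow> complex" and x
    assume "continuous_on UNIV \<gamma> \<and> (\<forall>x. cmod (\<gamma> x) = 1) \<and> (\<forall>x y. \<gamma> (x + y) = \<gamma> x * \<gamma> y)"
    then have "cmod (\<gamma> x) = 1"
      by blast
    then show "cnj (\<gamma> x) * \<gamma> x = 1"
      using complex_norm_square[of "\<gamma> x"] by (simp add: mult.commute)
  qed
  show "a - b = a + - b"
    by (rule minus_dual_def)
qed

end

text \<open>The topology of the dual group is the compact-open one.\<close>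

instantiation dual :: (topological_ab_group_add) topological_space
begin

definition open_dual :: "'a dual set \<Rightarrow> bool" where
  "open_dual =
     generate_topology {{\<gamma>. char_fun \<gamma> ` K \<subseteq> U} | K U. compact K \<and> open U}"

instance
  by standard (auto simp: open_dual_def intro: generate_topology.intros)

end


section \<open>Fourier transform\<close>

definition fourier1 ::
  "'g::topological_ab_group_add measure \<Rightarrow> ('g \<Rightarrow> complex) \<Rightarrow> ('g dual \<Rightarrow> complex)" where
  "fourier1 \<nu> f \<xi> = (\<integral>x. cnj (char_fun \<xi> x) * f x \<partial>\<nu>)"

definition unitary_fourier_extension ::
  "'g::topological_ab_group_add measure \<Rightarrow> 'g dual measure \<Rightarrow>
   (('g \<Rightarrow> complex) \<Rightarrow> ('g dual \<Rightarrow> complex)) \<Rightarrow> bool" where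
  "unitary_fourier_extension \<nu> \<nu>' F \<longleftrightarrow>
     unitary_op \<nu> \<nu>' F \<and>
     (\<forall>f\<in>L2 \<nu>. integrable \<nu> f \<longrightarrow> ae_eq \<nu>' (F f) (fourier1 \<nu> f))"

text \<open>
  The dual Haar measure is the Haar measure of the dual group normalised so that
  the Plancherel theorem holds; this fixes the scalar factor.
\<close>

definition dual_haar_measure ::
  "'g::topological_ab_group_add measure \<Rightarrow> 'g dual measure \<Rightarrow> bool" where
  "dual_haar_measure \<nu> \<nu>' \<longleftrightarrow>
     haar_measure \<nu>' \<and> (\<exists>F. unitary_fourier_extension \<nu> \<nu>' F)"

definition fourier_L2 ::
  "'g::topological_ab_group_add measure \<Rightarrow> 'g dual measure \<Rightarrow>
   ('g \<Rightarrow> complex) \<Rightarrow> ('g dual \<Rightarrow> complex)" where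
  "fourier_L2 \<nu> \<nu>' = (SOME F. unitary_fourier_extension \<nu> \<nu>' F)"

text \<open>
  \<open>T \<otimes> I\<close> on \<open>L\<^sup>2(M \<times> Y) = L\<^sup>2(M) \<otimes> L\<^sup>2(Y)\<close>: the bounded operator determined
  by its values on elementary tensors.
\<close>

definition tensor_id ::
  "'a measure \<Rightarrow> 'b measure \<Rightarrow> 'y measure \<Rightarrow> (('a \<Rightarrow> complex) \<Rightarrow> ('b \<Rightarrow> complex)) \<Rightarrow>
   ('a \<times> 'y \<Rightarrow> complex) \<Rightarrow> ('b \<times> 'y \<Rightarrow> complex)" where
  "tensor_id M N Y T =
     (SOME S. bounded_op (M \<Otimes>\<^sub>M Y) (L2 (M \<Otimes>\<^sub>M Y)) (N \<Otimes>\<^sub>M Y) (L2 (N \<Otimes>\<^sub>M Y)) S \<and>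
        (\<forall>f\<in>L2 M. \<forall>g\<in>L2 Y.
           ae_eq (N \<Otimes>\<^sub>M Y) (S (\<lambda>(u, v). f u * g v)) (\<lambda>(\<xi>, v). T f \<xi> * g v)))"

text \<open>
  \<open>A = \<integral>\<^sup>\<oplus> A\<^sub>\<xi> d\<mu>(\<xi>)\<close> with respect to the identification
  of \<open>f \<in> L\<^sup>2(\<mu> \<times> Y)\<close> with the field \<open>\<xi> \<mapsto> f(\<xi>, \<cdot>) \<in> L\<^sup>2(Y)\<close>; by Fubini the
  section lies in \<open>L\<^sup>2(Y)\<close> for almost every \<open>\<xi>\<close>.
\<close>

definition direct_integral_op ::
  "'x measure \<Rightarrow> 'y measure \<Rightarrow> (('x \<times> 'y \<Rightarrow> complex) \<Rightarrow> ('x \<times> 'y \<Rightarrow> complex)) \<Rightarrow>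
   ('x \<Rightarrow> ('y \<Rightarrow> complex) \<Rightarrow> ('y \<Rightarrow> complex)) \<Rightarrow> bool" where
  "direct_integral_op \<mu> Y A Ax \<longleftrightarrow>
     (\<forall>g\<in>L2 Y. \<forall>h\<in>L2 Y. (\<lambda>\<xi>. L2_inner Y (Ax \<xi> g) h) \<in> borel_measurable \<mu>) \<and>
     (\<forall>f\<in>L2 (\<mu> \<Otimes>\<^sub>M Y).
        AE \<xi> in \<mu>. ae_eq Y (\<lambda>v. A f (\<xi>, v)) (Ax \<xi> (\<lambda>v. f (\<xi>, v))))"


section \<open>Translation-invariant operators\<close>

definition translation ::
  "'g::ab_group_add \<Rightarrow> ('g \<times> 'y \<Rightarrow> complex) \<Rightarrow> ('g \<times> 'y \<Rightarrow> complex)" where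
  "translation a f = (\<lambda>(u, v). f (u - a, v))"

definition compressed_translation ::
  "'g::ab_group_add measure \<Rightarrow> 'y measure \<Rightarrow> ('g \<times> 'y \<Rightarrow> complex) set \<Rightarrow> 'g \<Rightarrow>
   ('g \<times> 'y \<Rightarrow> complex) \<Rightarrow> ('g \<times> 'y \<Rightarrow> complex)" where
  "compressed_translation \<nu> Y H a f = proj_onto (\<nu> \<Otimes>\<^sub>M Y) H (translation a f)"

definition invariant_ops ::
  "'g::ab_group_add measure \<Rightarrow> 'y measure \<Rightarrow> ('g \<times> 'y \<Rightarrow> complex) set \<Rightarrow>
   (('g \<times> 'y \<Rightarrow> complex) \<Rightarrow> ('g \<times> 'y \<Rightarrow> complex)) set" where
  "invariant_ops \<nu> Y H =
     {S. bounded_op (\<nu> \<Otimes>\<^sub>M Y) H (\<nu> \<Otimes>\<^sub>M Y) H S \<and>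
         (\<forall>a. \<forall>f\<in>H. ae_eq (\<nu> \<Otimes>\<^sub>M Y)
            (compressed_translation \<nu> Y H a (S f)) (S (compressed_translation \<nu> Y H a f)))}"

definition commutative_ops ::
  "'a measure \<Rightarrow> ('a \<Rightarrow> complex) set \<Rightarrow> (('a \<Rightarrow> complex) \<Rightarrow> ('a \<Rightarrow> complex)) set \<Rightarrow> bool" where
  "commutative_ops M H V \<longleftrightarrow> (\<forall>S\<in>V. \<forall>T\<in>V. \<forall>f\<in>H. ae_eq M (S (T f)) (T (S f)))"

definition fourier_projection ::
  "'g::topological_ab_group_add measure \<Rightarrow> 'g dual measure \<Rightarrow> 'y measure \<Rightarrow>
   ('g \<times> 'y \<Rightarrow> complex) set \<Rightarrow> ('g dual \<times> 'y \<Rightarrow> complex) \<Rightarrow> ('g dual \<times> 'y \<Rightarrow> complex)" where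
  "fourier_projection \<nu> \<nu>' Y H f =
     (let FI = tensor_id \<nu> \<nu>' Y (fourier_L2 \<nu> \<nu>')
      in FI (proj_onto (\<nu> \<Otimes>\<^sub>M Y) H (adjoint_op (\<nu> \<Otimes>\<^sub>M Y) (\<nu>' \<Otimes>\<^sub>M Y) FI f)))"

end

(*
  The Fourier transform turns translation by a into multiplication by the characters xi |-> xi(a)
  and H into the space of those u with u_xi in the range of P_xi for almost every xi. An operator
  that commutes with these multiplications commutes with all bounded functions of xi: the obstruction
  <A(m u) - m A u, w> is the integral of m against a function on the dual group whose Fourier
  transform vanishes. If almost all fibres have dimension at most 1, two such operators act fibrewise
  by scalars and hence commute. Conversely, for c, d in L^2(Y) the field of rank one operators
  <., c> P_xi d commutes with the characters; if all these operators commute, then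
      <P_xi d, d>^2 <P_xi c, c> = <P_xi d, c> <P_xi d, d> <P_xi c, d>
  almost everywhere, simultaneously for all c, d in a countable dense set. This fails for c, d
  close to an orthonormal pair in the range of P_xi, so no measurable choice of such pairs is needed.
*)

theory Submission
  imports Defs
begin

section \<open>Closure properties of \<open>L2\<close> and calculus of equality almost
  everywhere\<close>

section \<open>Hilbert space geometry of square-integrable functions\<close>

text \<open>Fourier uniqueness is applied to a difference of fibre inner products. Such a function
  is a priori only integrable on the dual group, while the transform is given as a unitary between
  L2 spaces. Vectors with bounded fibre norms put it into L2 as well, and they are dense because the
  truncation is itself multiplication by a function of xi. Uniqueness then comes from unitarity,
  Fubini and the density of L1 \<inter> L2. Fubini asks for a \<sigma>-finite dual measure and for
  joint measurability of (xi, x) |-> xi(x); both are extracted from the assumptions on the group.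
  The displayed identity arises by applying <., c> P_xi d and <., d> P_xi c in both orders to the
  vector P_xi d. The results are multiples of P_xi d and of P_xi c, and pairing them with d leaves
  scalars that depend continuously on c and d. This continuity is what lets a dense set stand in for
  the range. Operators act on representatives, so all their laws hold up to null sets, and only
  countably many exceptional sets may be united.\<close>

lemma borel_measurable_cnj[measurable (raw)]:
  "f \<in> borel_measurable M \<Longrightarrow> (\<lambda>x. cnj (f x)) \<in> borel_measurable M"
  by (rule borel_measurable_continuous_on[where f=cnj]) (auto intro: continuous_intros)

lemma L2_measurable[measurable_dest]: "f \<in> L2 M \<Longrightarrow> f \<in> borel_measurable M"
  by (simp add: L2_def)

lemma L2_integrable_square: "f \<in> L2 M \<Longrightarrow> integrable M (\<lambda>x. (cmod (f x))\<^sup>2)"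
  by (simp add: L2_def)

lemma L2I_nn_integral:
  assumes "f \<in> borel_measurable M" "(\<integral>\<^sup>+x. ennreal ((cmod (f x))\<^sup>2) \<partial>M) < \<infinity>"
  shows "f \<in> L2 M"
  using assms unfolding L2_def by (auto intro!: integrableI_bounded)

lemma L2I_dominated:
  assumes "integrable M g" "f \<in> borel_measurable M" "\<And>x. x \<in> space M \<Longrightarrow> (cmod (f x))\<^sup>2 \<le> g x"
  shows "f \<in> L2 M"
proof -
  have "integrable M (\<lambda>x. (cmod (f x))\<^sup>2)"
  proof (rule Bochner_Integration.integrable_bound[OF assms(1)])
    show "AE x in M. norm ((cmod (f x))\<^sup>2) \<le> norm (g x)"
      using assms(3) by (intro AE_I2) (auto intro: order_trans[OF _ abs_ge_self])
  qed (use assms(2) in measurable)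
  then show ?thesis using assms(2) by (simp add: L2_def)
qed

lemma L2_zero[simp]: "(\<lambda>x. 0) \<in> L2 M"
  by (simp add: L2_def)

lemma L2_scale: "f \<in> L2 M \<Longrightarrow> (\<lambda>x. c * f x) \<in> L2 M"
  by (auto simp: L2_def norm_mult power_mult_distrib)

lemma cmod_add_square_le: "(cmod (a + b))\<^sup>2 \<le> 2 * (cmod a)\<^sup>2 + 2 * (cmod b)\<^sup>2"
proof -
  have "(cmod (a + b))\<^sup>2 \<le> (cmod a + cmod b)\<^sup>2"
    by (intro power_mono norm_triangle_ineq) auto
  also have "\<dots> \<le> 2 * (cmod a)\<^sup>2 + 2 * (cmod b)\<^sup>2"
    using sum_squares_bound[of "cmod a" "cmod b"] by (simp add: power2_sum)
  finally show ?thesis .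
qed

lemma L2_add:
  assumes "f \<in> L2 M" "g \<in> L2 M"
  shows "(\<lambda>x. f x + g x) \<in> L2 M"
  by (rule L2I_dominated[where g="\<lambda>x. 2 * (cmod (f x))\<^sup>2 + 2 * (cmod (g x))\<^sup>2"])
     (use assms in \<open>auto simp: L2_def cmod_add_square_le\<close>)

lemma L2_diff:
  assumes "f \<in> L2 M" "g \<in> L2 M"
  shows "(\<lambda>x. f x - g x) \<in> L2 M"
  using L2_add[OF assms(1) L2_scale[OF assms(2), of "-1"]] by simp

lemma L2_mult_bounded:
  assumes "f \<in> L2 M" "m \<in> borel_measurable M" "\<And>x. x \<in> space M \<Longrightarrow> cmod (m x) \<le> C"
  shows "(\<lambda>x. m x * f x) \<in> L2 M"
proof (rule L2I_dominated[where g="\<lambda>x. C\<^sup>2 * (cmod (f x))\<^sup>2"])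
  fix x assume "x \<in> space M"
  then have "(cmod (m x))\<^sup>2 \<le> C\<^sup>2" using assms(3) by (intro power_mono) auto
  then show "(cmod (m x * f x))\<^sup>2 \<le> C\<^sup>2 * (cmod (f x))\<^sup>2"
    by (simp add: norm_mult power_mult_distrib mult_right_mono)
qed (use assms in \<open>auto simp: L2_def\<close>)

lemma L2_cnj: "f \<in> L2 M \<Longrightarrow> (\<lambda>x. cnj (f x)) \<in> L2 M"
  by (auto simp: L2_def)

lemma L2_indicator:
  assumes "A \<in> sets M" "emeasure M A < \<infinity>"
  shows "(\<lambda>x. indicator A x) \<in> L2 M"
proof -
  have "(\<lambda>x. (cmod (indicator A x))\<^sup>2) = (indicator A :: 'a \<Rightarrow> real)"
    by (auto simp: indicator_def)
  then show ?thesis using assms by (auto simp: L2_def)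
qed

lemma ae_eq_refl[simp]: "ae_eq M f f"
  by (simp add: ae_eq_def)

lemma ae_eq_sym: "ae_eq M f g \<Longrightarrow> ae_eq M g f"
  by (auto simp: ae_eq_def)

lemma ae_eq_trans[trans]: "ae_eq M f g \<Longrightarrow> ae_eq M g h \<Longrightarrow> ae_eq M f h"
  by (auto simp: ae_eq_def elim: eventually_elim2)

lemma ae_eq_add: "ae_eq M f f' \<Longrightarrow> ae_eq M g g' \<Longrightarrow> ae_eq M (\<lambda>x. f x + g x) (\<lambda>x. f' x + g' x)"
  unfolding ae_eq_def by (auto elim: eventually_elim2)

lemma ae_eq_diff: "ae_eq M f f' \<Longrightarrow> ae_eq M g g' \<Longrightarrow> ae_eq M (\<lambda>x. f x - g x) (\<lambda>x. f' x - g' x)"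
  unfolding ae_eq_def by (auto elim: eventually_elim2)

lemma ae_eq_mult: "ae_eq M f f' \<Longrightarrow> ae_eq M (\<lambda>x. m x * f x) (\<lambda>x. m x * f' x)"
  unfolding ae_eq_def by (auto elim: eventually_mono)

section \<open>Cauchy-Schwarz inequality and continuity of the inner product under norm
  limits\<close>

subsection \<open>Inner product and norm\<close>

lemma L2_inner_integrable:
  assumes "f \<in> L2 M" "g \<in> L2 M"
  shows "integrable M (\<lambda>x. f x * cnj (g x))"
proof (rule Bochner_Integration.integrable_bound[where f="\<lambda>x. (cmod (f x))\<^sup>2 + (cmod (g x))\<^sup>2"])
  show "AE x in M. norm (f x * cnj (g x)) \<le> norm ((cmod (f x))\<^sup>2 + (cmod (g x))\<^sup>2)"
  proof (rule AE_I2)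
    fix x
    have "2 * (cmod (f x) * cmod (g x)) \<le> (cmod (f x))\<^sup>2 + (cmod (g x))\<^sup>2"
      using sum_squares_bound[of "cmod (f x)" "cmod (g x)"] by (simp add: mult.assoc)
    moreover have "0 \<le> cmod (f x) * cmod (g x)" by simp
    ultimately have "cmod (f x) * cmod (g x) \<le> (cmod (f x))\<^sup>2 + (cmod (g x))\<^sup>2" by linarith
    then show "norm (f x * cnj (g x)) \<le> norm ((cmod (f x))\<^sup>2 + (cmod (g x))\<^sup>2)"
      by (simp add: norm_mult)
  qed
qed (use assms in \<open>auto simp: L2_def\<close>)

lemma L2_inner_cong_ae:
  assumes "f \<in> L2 M" "g \<in> L2 M" "f' \<in> L2 M" "g' \<in> L2 M" "ae_eq M f f'" "ae_eq M g g'"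
  shows "L2_inner M f g = L2_inner M f' g'"
  unfolding L2_inner_def
  by (rule integral_cong_AE)
     (use assms in \<open>auto simp: L2_def ae_eq_def elim: eventually_elim2\<close>)

lemma L2_norm_cong_ae:
  assumes "f \<in> L2 M" "g \<in> L2 M" "ae_eq M f g"
  shows "L2_norm M f = L2_norm M g"
  unfolding L2_norm_def
  by (rule arg_cong[where f=sqrt], rule integral_cong_AE)
     (use assms in \<open>auto simp: L2_def ae_eq_def elim: eventually_mono\<close>)

lemma L2_inner_add_left:
  assumes "f \<in> L2 M" "g \<in> L2 M" "h \<in> L2 M"
  shows "L2_inner M (\<lambda>x. f x + g x) h = L2_inner M f h + L2_inner M g h"
  unfolding L2_inner_def
  using L2_inner_integrable[OF assms(1,3)] L2_inner_integrable[OF assms(2,3)]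
  by (simp add: distrib_right)

lemma L2_inner_diff_left:
  assumes "f \<in> L2 M" "g \<in> L2 M" "h \<in> L2 M"
  shows "L2_inner M (\<lambda>x. f x - g x) h = L2_inner M f h - L2_inner M g h"
  unfolding L2_inner_def
  using L2_inner_integrable[OF assms(1,3)] L2_inner_integrable[OF assms(2,3)]
  by (simp add: left_diff_distrib)

lemma L2_inner_scale_left: "L2_inner M (\<lambda>x. c * f x) h = c * L2_inner M f h"
  unfolding L2_inner_def by (simp add: mult.assoc)

lemma L2_inner_zero_left[simp]: "L2_inner M (\<lambda>x. 0) h = 0"
  unfolding L2_inner_def by simp

lemma L2_inner_commute: "L2_inner M g f = cnj (L2_inner M f g)"
proof -
  have "cnj (L2_inner M f g) = (\<integral>x. cnj (f x * cnj (g x)) \<partial>M)"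
    unfolding L2_inner_def by (simp del: complex_cnj_mult)
  then show ?thesis unfolding L2_inner_def by (simp add: mult.commute)
qed

lemma L2_inner_zero_right[simp]: "L2_inner M h (\<lambda>x. 0) = 0"
  unfolding L2_inner_def by simp

lemma L2_inner_add_right:
  assumes "f \<in> L2 M" "g \<in> L2 M" "h \<in> L2 M"
  shows "L2_inner M h (\<lambda>x. f x + g x) = L2_inner M h f + L2_inner M h g"
  using L2_inner_add_left[OF assms] L2_inner_commute[of M h] by (metis complex_cnj_add)

lemma L2_inner_diff_right:
  assumes "f \<in> L2 M" "g \<in> L2 M" "h \<in> L2 M"
  shows "L2_inner M h (\<lambda>x. f x - g x) = L2_inner M h f - L2_inner M h g"
  using L2_inner_diff_left[OF assms] L2_inner_commute[of M h] by (metis complex_cnj_diff)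

lemma L2_inner_scale_right: "L2_inner M h (\<lambda>x. c * f x) = cnj c * L2_inner M h f"
  using L2_inner_scale_left[of M c f h] L2_inner_commute[of M h] by (metis complex_cnj_mult)

lemma L2_norm_nonneg[simp]: "0 \<le> L2_norm M f"
  by (simp add: L2_norm_def)

lemma L2_inner_self: "L2_inner M f f = of_real ((L2_norm M f)\<^sup>2)"
proof -
  have "L2_inner M f f = (\<integral>x. of_real ((cmod (f x))\<^sup>2) \<partial>M)"
    unfolding L2_inner_def complex_norm_square ..
  also have "\<dots> = of_real (\<integral>x. (cmod (f x))\<^sup>2 \<partial>M)" by (rule integral_complex_of_real)
  finally show ?thesis by (simp add: L2_norm_def)
qed

lemma L2_norm_square: "(L2_norm M f)\<^sup>2 = (\<integral>x. (cmod (f x))\<^sup>2 \<partial>M)"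
  by (simp add: L2_norm_def)

lemma L2_nn_integral:
  assumes "f \<in> L2 M"
  shows "(\<integral>\<^sup>+x. ennreal ((cmod (f x))\<^sup>2) \<partial>M) = ennreal ((L2_norm M f)\<^sup>2)"
  unfolding L2_norm_square using L2_integrable_square[OF assms]
  by (intro nn_integral_eq_integral) auto

lemma L2_norm_scale: "L2_norm M (\<lambda>x. c * f x) = cmod c * L2_norm M f"
  unfolding L2_norm_def by (simp add: norm_mult power_mult_distrib real_sqrt_mult)

lemma L2_norm_minus_commute: "L2_norm M (\<lambda>x. f x - g x) = L2_norm M (\<lambda>x. g x - f x)"
  unfolding L2_norm_def by (simp add: norm_minus_commute)

lemma L2_norm_zero[simp]: "L2_norm M (\<lambda>x. 0) = 0"
  by (simp add: L2_norm_def)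

lemma L2_norm_eq_0_iff:
  assumes "f \<in> L2 M"
  shows "L2_norm M f = 0 \<longleftrightarrow> ae_eq M f (\<lambda>x. 0)"
  unfolding L2_norm_def ae_eq_def
  using integral_nonneg_eq_0_iff_AE[OF L2_integrable_square[OF assms]] by simp


lemma ae_eq_iff_L2_norm:
  assumes "f \<in> L2 M" "g \<in> L2 M"
  shows "ae_eq M f g \<longleftrightarrow> L2_norm M (\<lambda>x. f x - g x) = 0"
  unfolding L2_norm_eq_0_iff[OF L2_diff[OF assms]] by (simp add: ae_eq_def)

lemma L2_norm_add_square:
  assumes "f \<in> L2 M" "g \<in> L2 M"
  shows "(L2_norm M (\<lambda>x. f x + g x))\<^sup>2 = (L2_norm M f)\<^sup>2 + (L2_norm M g)\<^sup>2 + 2 * Re (L2_inner M f g)"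
proof -
  have "L2_inner M (\<lambda>x. f x + g x) (\<lambda>x. f x + g x)
      = L2_inner M f f + L2_inner M f g + (L2_inner M g f + L2_inner M g g)"
    using assms by (simp add: L2_inner_add_left L2_inner_add_right L2_add)
  then have "Re (of_real ((L2_norm M (\<lambda>x. f x + g x))\<^sup>2)) = Re (L2_inner M f f + L2_inner M f g + (L2_inner M g f + L2_inner M g g))"
    by (simp only: L2_inner_self)
  then show ?thesis using L2_inner_commute[of M g f] by (simp add: L2_inner_self)
qed

lemma L2_norm_diff_square:
  assumes "f \<in> L2 M" "g \<in> L2 M"
  shows "(L2_norm M (\<lambda>x. f x - g x))\<^sup>2 = (L2_norm M f)\<^sup>2 + (L2_norm M g)\<^sup>2 - 2 * Re (L2_inner M f g)"
  using L2_norm_add_square[OF assms(1) L2_scale[OF assms(2), of "-1"]] L2_norm_scale[of M "-1" g]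
    L2_inner_scale_right[of M f "-1" g]
  by simp

text \<open>Expand the nonnegative square of \<open>f - c g\<close> for the \<open>c\<close> that
  makes it minimal, the coefficient of the projection of \<open>f\<close> onto the line of
  \<open>g\<close>. A \<open>g\<close> of norm 0 is null, and both sides vanish.\<close>

lemma L2_Cauchy_Schwarz:
  assumes "f \<in> L2 M" "g \<in> L2 M"
  shows "cmod (L2_inner M f g) \<le> L2_norm M f * L2_norm M g"
proof (cases "L2_norm M g = 0")
  case True
  then have "ae_eq M g (\<lambda>x. 0)" using assms L2_norm_eq_0_iff by blast
  then have "L2_inner M f g = L2_inner M f (\<lambda>x. 0)"
    using assms by (intro L2_inner_cong_ae) auto
  then show ?thesis by simp
next
  case False
  define n where "n = (L2_norm M g)\<^sup>2"
  have n: "n > 0" using False by (simp add: n_def)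
  define c where "c = L2_inner M f g / of_real n"
  have "0 \<le> (L2_norm M (\<lambda>x. f x - c * g x))\<^sup>2" by simp
  also have "\<dots> = (L2_norm M f)\<^sup>2 + (cmod c)\<^sup>2 * n - 2 * Re (cnj c * L2_inner M f g)"
    using assms by (subst L2_norm_diff_square)
      (auto simp: L2_scale L2_norm_scale L2_inner_scale_right n_def power_mult_distrib)
  also have "Re (cnj c * L2_inner M f g) = (cmod (L2_inner M f g))\<^sup>2 / n"
  proof -
    have "cnj c * L2_inner M f g = of_real ((cmod (L2_inner M f g))\<^sup>2) / of_real n"
      unfolding c_def complex_norm_square by (simp add: mult.commute)
    also have "\<dots> = of_real ((cmod (L2_inner M f g))\<^sup>2 / n)" by simp
    finally show ?thesis by (simp only: Re_complex_of_real)
  qed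
  also have "(cmod c)\<^sup>2 * n = (cmod (L2_inner M f g))\<^sup>2 / n"
    using n by (simp add: c_def norm_divide power_divide power2_eq_square)
  finally have "(cmod (L2_inner M f g))\<^sup>2 / n \<le> (L2_norm M f)\<^sup>2" by simp
  then have "(cmod (L2_inner M f g))\<^sup>2 \<le> (L2_norm M f * L2_norm M g)\<^sup>2"
    using n by (simp add: divide_le_eq n_def power_mult_distrib)
  then show ?thesis by (rule power2_le_imp_le) simp
qed

lemma L2_norm_triangle:
  assumes "f \<in> L2 M" "g \<in> L2 M"
  shows "L2_norm M (\<lambda>x. f x + g x) \<le> L2_norm M f + L2_norm M g"
proof (rule power2_le_imp_le)
  have "Re (L2_inner M f g) \<le> L2_norm M f * L2_norm M g"
    using L2_Cauchy_Schwarz[OF assms] complex_Re_le_cmod order_trans by blast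
  then show "(L2_norm M (\<lambda>x. f x + g x))\<^sup>2 \<le> (L2_norm M f + L2_norm M g)\<^sup>2"
    using L2_norm_add_square[OF assms] by (simp add: power2_sum)
qed simp

lemma L2_norm_triangle3:
  assumes "f \<in> L2 M" "g \<in> L2 M" "h \<in> L2 M"
  shows "L2_norm M (\<lambda>x. f x - h x) \<le> L2_norm M (\<lambda>x. f x - g x) + L2_norm M (\<lambda>x. g x - h x)"
  using L2_norm_triangle[OF L2_diff[OF assms(1,2)] L2_diff[OF assms(2,3)]] by simp

text \<open>The test vector \<open>f - g\<close> decides. This weak form of equality serves limits,
  adjoints and inverses, which are known only through their inner products.\<close>

lemma ae_eq_inner_test:
  assumes "f \<in> L2 M" "g \<in> L2 M" "\<And>k. k \<in> L2 M \<Longrightarrow> L2_inner M f k = L2_inner M g k"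
  shows "ae_eq M f g"
proof -
  let ?d = "\<lambda>x. f x - g x"
  have "L2_inner M ?d ?d = 0"
    using assms by (simp add: L2_inner_diff_left L2_diff)
  then show ?thesis using assms by (simp add: L2_inner_self ae_eq_iff_L2_norm)
qed

abbreviation L2_lim :: "'a measure \<Rightarrow> (nat \<Rightarrow> 'a \<Rightarrow> complex) \<Rightarrow> ('a \<Rightarrow> complex) \<Rightarrow> bool" where
  "L2_lim M s f \<equiv> (\<lambda>n. L2_norm M (\<lambda>x. s n x - f x)) \<longlonglongrightarrow> 0"

lemma L2_inner_tendsto_left:
  assumes "\<And>n. s n \<in> L2 M" "f \<in> L2 M" "h \<in> L2 M"
    "L2_lim M s f"
  shows "(\<lambda>n. L2_inner M (s n) h) \<longlonglongrightarrow> L2_inner M f h"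
proof (rule Lim_null[THEN iffD2], rule Lim_null_comparison)
  show "\<forall>\<^sub>F n in sequentially. norm (L2_inner M (s n) h - L2_inner M f h)
      \<le> L2_norm M (\<lambda>x. s n x - f x) * L2_norm M h"
    using assms by (auto simp: L2_inner_diff_left[symmetric] intro!: always_eventually L2_Cauchy_Schwarz L2_diff)
  show "(\<lambda>n. L2_norm M (\<lambda>x. s n x - f x) * L2_norm M h) \<longlonglongrightarrow> 0"
    using tendsto_mult_left_zero[OF assms(4)] by simp
qed

lemma L2_norm_le_norm_add:
  assumes "f \<in> L2 M" "g \<in> L2 M"
  shows "L2_norm M f \<le> L2_norm M g + L2_norm M (\<lambda>x. f x - g x)"
  using L2_norm_triangle[OF assms(2) L2_diff[OF assms]] by simp

lemma L2_norm_tendsto: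
  assumes "\<And>n. s n \<in> L2 M" "f \<in> L2 M"
    "L2_lim M s f"
  shows "(\<lambda>n. L2_norm M (s n)) \<longlonglongrightarrow> L2_norm M f"
proof (rule Lim_null[THEN iffD2], rule Lim_null_comparison[OF _ assms(3)])
  show "\<forall>\<^sub>F n in sequentially. norm (L2_norm M (s n) - L2_norm M f) \<le> L2_norm M (\<lambda>x. s n x - f x)"
    using L2_norm_le_norm_add[OF assms(1,2)] L2_norm_le_norm_add[OF assms(2,1)]
      L2_norm_minus_commute[of M f]
    by (intro always_eventually allI) (simp add: abs_le_iff algebra_simps)
qed

text \<open>Split \<open>\<langle>s n, t n\<rangle> = \<langle>s n - f, t n\<rangle> + \<langle>f, t
  n\<rangle>\<close>. The first term is small because the norms of \<open>t n\<close> converge and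
  thus stay bounded.\<close>

lemma L2_inner_tendsto:
  assumes s: "\<And>n::nat. s n \<in> L2 M" "f \<in> L2 M" "L2_lim M s f"
    and t: "\<And>n::nat. t n \<in> L2 M" "g \<in> L2 M" "L2_lim M t g"
  shows "(\<lambda>n. L2_inner M (s n) (t n)) \<longlonglongrightarrow> L2_inner M f g"
proof -
  have "(\<lambda>n. L2_norm M (\<lambda>x. s n x - f x) * L2_norm M (t n)) \<longlonglongrightarrow> 0 * L2_norm M g"
    by (intro tendsto_mult s(3) L2_norm_tendsto t)
  then have lim0: "(\<lambda>n. L2_norm M (\<lambda>x. s n x - f x) * L2_norm M (t n)) \<longlonglongrightarrow> 0" by simp
  have "\<forall>\<^sub>F n in sequentially. cmod (L2_inner M (\<lambda>x. s n x - f x) (t n)) \<le> L2_norm M (\<lambda>x. s n x - f x) * L2_norm M (t n)"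
    by (intro always_eventually allI L2_Cauchy_Schwarz L2_diff s t)
  then have "(\<lambda>n. L2_inner M (\<lambda>x. s n x - f x) (t n)) \<longlonglongrightarrow> 0"
    using lim0 by (rule Lim_null_comparison)
  moreover have "(\<lambda>n. cnj (L2_inner M (t n) f)) \<longlonglongrightarrow> cnj (L2_inner M g f)"
    by (intro tendsto_cnj L2_inner_tendsto_left t s)
  ultimately have "(\<lambda>n. L2_inner M (\<lambda>x. s n x - f x) (t n) + cnj (L2_inner M (t n) f)) \<longlonglongrightarrow> 0 + cnj (L2_inner M g f)"
    by (rule tendsto_add)
  moreover have "L2_inner M (\<lambda>x. s n x - f x) (t n) + cnj (L2_inner M (t n) f) = L2_inner M (s n) (t n)" for n
    using L2_inner_diff_left[OF s(1)[of n] s(2) t(1)[of n]] L2_inner_commute[of M f "t n"] by simp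
  moreover have "cnj (L2_inner M g f) = L2_inner M f g" using L2_inner_commute[of M f g] by simp
  ultimately show ?thesis by simp
qed

lemma L2_lim_add:
  assumes "\<And>n. s n \<in> L2 M" "f \<in> L2 M" "L2_lim M s f" "\<And>n. t n \<in> L2 M" "g \<in> L2 M" "L2_lim M t g"
  shows "L2_lim M (\<lambda>n x. s n x + t n x) (\<lambda>x. f x + g x)"
proof (rule Lim_null_comparison[OF always_eventually])
  show "\<forall>n. norm (L2_norm M (\<lambda>x. (s n x + t n x) - (f x + g x)))
      \<le> L2_norm M (\<lambda>x. s n x - f x) + L2_norm M (\<lambda>x. t n x - g x)"
    using L2_norm_triangle[OF L2_diff[OF assms(1,2)] L2_diff[OF assms(4,5)]] by (simp add: algebra_simps)
  show "(\<lambda>n. L2_norm M (\<lambda>x. s n x - f x) + L2_norm M (\<lambda>x. t n x - g x)) \<longlonglongrightarrow> 0"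
    using tendsto_add[OF assms(3,6)] by simp
qed

lemma L2_lim_scale:
  assumes "L2_lim M s f"
  shows "L2_lim M (\<lambda>n x. c * s n x) (\<lambda>x. c * f x)"
  using tendsto_mult_right_zero[OF assms, of "cmod c"] by (simp add: L2_norm_scale flip: right_diff_distrib)

lemma L2_lim_unique:
  assumes s: "\<And>n. s n \<in> L2 M" "f \<in> L2 M" "L2_lim M s f" and t: "\<And>n. t n \<in> L2 M" "g \<in> L2 M" "L2_lim M t g"
    and eq: "\<And>n. ae_eq M (s n) (t n)"
  shows "ae_eq M f g"
proof (rule ae_eq_inner_test[OF s(2) t(2)])
  fix k assume k: "k \<in> L2 M"
  have "L2_inner M (s n) k = L2_inner M (t n) k" for n
    by (rule L2_inner_cong_ae[OF s(1) k t(1) k eq ae_eq_refl])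
  then show "L2_inner M f k = L2_inner M g k"
    using L2_inner_tendsto_left[OF s(1,2) k s(3)] L2_inner_tendsto_left[OF t(1,2) k t(3)]
    by (simp add: LIMSEQ_unique)
qed

text \<open>Links the epsilon form in which \<open>separable_L2\<close> states density to the
  sequences along which bounded operators are compared and extended. Tolerances
  \<open>1 / (n + 1)\<close> yield the sequence.\<close>

lemma L2_lim_iff_dense:
  "(\<exists>s. (\<forall>n. s n \<in> K) \<and> L2_lim M s f) \<longleftrightarrow> (\<forall>e>0. \<exists>k\<in>K. L2_norm M (\<lambda>x. f x - k x) < e)"
proof (intro iffI allI impI)
  fix e :: real assume "\<exists>s. (\<forall>n. s n \<in> K) \<and> L2_lim M s f" and e: "e > 0"
  then obtain s where s: "\<And>n. s n \<in> K" "L2_lim M s f" by blast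
  obtain n where "L2_norm M (\<lambda>x. s n x - f x) < e" using LIMSEQ_D[OF s(2) e] by auto
  then show "\<exists>k\<in>K. L2_norm M (\<lambda>x. f x - k x) < e"
    using s(1)[of n] L2_norm_minus_commute[of M f] by auto
next
  assume dense: "\<forall>e>0. \<exists>k\<in>K. L2_norm M (\<lambda>x. f x - k x) < e"
  have "\<exists>k\<in>K. L2_norm M (\<lambda>x. f x - k x) < 1 / real (Suc n)" for n using dense by simp
  then obtain s where s: "\<And>n. s n \<in> K" "\<And>n. L2_norm M (\<lambda>x. f x - s n x) < 1 / real (Suc n)" by metis
  have "\<forall>n. norm (L2_norm M (\<lambda>x. s n x - f x)) \<le> 1 / real (Suc n)"
    using s(2) L2_norm_minus_commute[of M f] by (simp add: less_imp_le)
  then have "L2_lim M s f"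
    by (rule Lim_null_comparison[OF always_eventually LIMSEQ_Suc[OF lim_1_over_n]])
  with s(1) show "\<exists>s. (\<forall>n. s n \<in> K) \<and> L2_lim M s f" by blast
qed

section \<open>Completeness of \<open>L2\<close> (Riesz-Fischer)\<close>

subsection \<open>Completeness\<close>

text \<open>Fatou's lemma for the squared moduli. Square integrability of the limit belongs to the
  conclusion, since in the proof of completeness it is not known beforehand.\<close>

lemma L2_Fatou:
  assumes "\<And>k::nat. g k \<in> L2 M" "h \<in> borel_measurable M" "AE x in M. (\<lambda>k. g k x) \<longlonglongrightarrow> h x"
    "\<And>k. k \<ge> K \<Longrightarrow> L2_norm M (g k) \<le> e" "0 \<le> e"
  shows "h \<in> L2 M" "L2_norm M h \<le> e"
proof -
  have [measurable]: "g k \<in> borel_measurable M" for k using assms(1) by (rule L2_measurable)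
  note [measurable] = assms(2)
  have "(\<integral>\<^sup>+x. ennreal ((cmod (h x))\<^sup>2) \<partial>M) = (\<integral>\<^sup>+x. liminf (\<lambda>k. ennreal ((cmod (g k x))\<^sup>2)) \<partial>M)"
  proof (rule nn_integral_cong_AE, use assms(3) in eventually_elim)
    fix x assume "(\<lambda>k. g k x) \<longlonglongrightarrow> h x"
    then have "(\<lambda>k. ennreal ((cmod (g k x))\<^sup>2)) \<longlonglongrightarrow> ennreal ((cmod (h x))\<^sup>2)"
      by (intro tendsto_intros) auto
    then show "ennreal ((cmod (h x))\<^sup>2) = liminf (\<lambda>k. ennreal ((cmod (g k x))\<^sup>2))"
      by (intro lim_imp_Liminf[symmetric]) auto
  qed
  also have "\<dots> \<le> liminf (\<lambda>k. \<integral>\<^sup>+x. ennreal ((cmod (g k x))\<^sup>2) \<partial>M)"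
    by (intro nn_integral_liminf) auto
  also have "\<dots> = liminf (\<lambda>k. ennreal ((L2_norm M (g k))\<^sup>2))"
    by (simp add: L2_nn_integral assms(1))
  also have "\<dots> \<le> ennreal (e\<^sup>2)"
  proof -
    have "\<forall>\<^sub>F k in sequentially. ennreal ((L2_norm M (g k))\<^sup>2) \<le> ennreal (e\<^sup>2)"
      using assms(4) by (intro eventually_sequentiallyI[of K] ennreal_leI power_mono) auto
    then show ?thesis by (rule Liminf_le[rotated]) simp
  qed
  finally have le: "(\<integral>\<^sup>+x. ennreal ((cmod (h x))\<^sup>2) \<partial>M) \<le> ennreal (e\<^sup>2)" .
  show h: "h \<in> L2 M"
    by (rule L2I_nn_integral) (use le in \<open>auto intro: le_less_trans\<close>)
  have "(L2_norm M h)\<^sup>2 \<le> e\<^sup>2"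
    using le unfolding L2_nn_integral[OF h] by simp
  then show "L2_norm M h \<le> e"
    using \<open>0 \<le> e\<close> by (rule power2_le_imp_le)
qed

text \<open>
  Along a subsequence with increments \<open>\<Delta>\<^sub>k\<close> of norm at most \<open>4\<^sup>-\<^sup>k\<close> the series
  \<open>\<Sum> 4\<^sup>k |\<Delta>\<^sub>k|\<^sup>2\<close> is integrable, so \<open>|\<Delta>\<^sub>k| = O(2\<^sup>-\<^sup>k)\<close> almost everywhere.
\<close>

lemma L2_complete:
  assumes s: "\<And>n::nat. s n \<in> L2 M"
    and Cauchy: "\<And>e. e > 0 \<Longrightarrow> \<exists>N. \<forall>m\<ge>N. \<forall>n\<ge>N. L2_norm M (\<lambda>x. s m x - s n x) < e"
  obtains f where "f \<in> L2 M" "L2_lim M s f"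
proof -
  have [measurable]: "s k \<in> borel_measurable M" for k using s by (rule L2_measurable)
  have "\<exists>N. \<forall>m\<ge>N. \<forall>n\<ge>N. L2_norm M (\<lambda>x. s m x - s n x) < (1/4)^k" for k :: nat
    by (rule Cauchy) simp
  then obtain N where N: "\<And>k m n. m \<ge> N k \<Longrightarrow> n \<ge> N k \<Longrightarrow> L2_norm M (\<lambda>x. s m x - s n x) < (1/4)^k"
    by metis
  \<comment> \<open>The sum forces \<open>N k \<le> r k\<close> and monotonicity; the summand
    \<open>k\<close> makes \<open>r\<close> tend to infinity.\<close>
  define r where "r k = k + (\<Sum>i\<le>k. N i)" for k :: nat
  have rN: "N k \<le> r k" for k
    unfolding r_def by (rule trans_le_add2, rule member_le_sum) auto
  have rk: "k \<le> r k" for k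
    unfolding r_def by simp
  have r_mono: "r k \<le> r (Suc k)" for k
    unfolding r_def by simp
  define D where "D k x = s (r (Suc k)) x - s (r k) x" for k x
  have D: "D k \<in> L2 M" for k unfolding D_def by (intro L2_diff s)
  note [measurable] = L2_measurable[OF D]
  have Dn: "L2_norm M (D k) \<le> (1/4)^k" for k
    unfolding D_def using N[OF order_trans[OF rN r_mono] rN] by (simp add: less_imp_le)
  have "(\<integral>\<^sup>+x. (\<Sum>k. ennreal (4^k * (cmod (D k x))\<^sup>2)) \<partial>M)
      = (\<Sum>k. \<integral>\<^sup>+x. ennreal (4^k * (cmod (D k x))\<^sup>2) \<partial>M)"
    by (rule nn_integral_suminf) measurable
  also have "\<dots> = (\<Sum>k. ennreal (4^k * (L2_norm M (D k))\<^sup>2))"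
    by (simp add: ennreal_mult nn_integral_cmult L2_nn_integral[OF D] del: ennreal_power ennreal_numeral)
  also have "\<dots> \<le> (\<Sum>k. ennreal ((1/4)^k))"
  proof (intro suminf_le ennreal_leI summableI)
    fix k :: nat
    have "(L2_norm M (D k))\<^sup>2 \<le> ((1/4)^k)\<^sup>2" using Dn by (intro power_mono) auto
    then have "4^k * (L2_norm M (D k))\<^sup>2 \<le> 4^k * ((1/4)^k)\<^sup>2" by simp
    also have "\<dots> = (4 * (1/4) * (1/4))^k"
      by (simp only: power2_eq_square power_mult_distrib mult.assoc)
    also have "\<dots> = (1/4::real)^k" by simp
    finally show "4^k * (L2_norm M (D k))\<^sup>2 \<le> (1/4)^k" .
  qed
  also have "\<dots> = ennreal (\<Sum>k. (1/4)^k)"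
    by (rule suminf_ennreal2) (auto intro: summable_geometric)
  also have "\<dots> < \<infinity>" by simp
  finally have "AE x in M. (\<Sum>k. ennreal (4^k * (cmod (D k x))\<^sup>2)) \<noteq> \<infinity>"
    by (intro nn_integral_PInf_AE) auto
  then have conv: "AE x in M. convergent (\<lambda>k. s (r k) x)"
  proof eventually_elim
    case (elim x)
    have "summable (\<lambda>k. 4^k * (cmod (D k x))\<^sup>2)"
    proof (rule summable_suminf_not_top)
      show "(\<Sum>k. ennreal (4^k * (cmod (D k x))\<^sup>2)) \<noteq> top"
        using elim unfolding infinity_ennreal_def .
    qed simp
    then have "Bseq (\<lambda>k. 4^k * (cmod (D k x))\<^sup>2)"
      using summable_LIMSEQ_zero convergent_imp_Bseq convergentI by blast
    then obtain C where C: "C > 0" "\<And>k. norm (4^k * (cmod (D k x))\<^sup>2) \<le> C"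
      unfolding Bseq_def by auto
    have "cmod (D k x) \<le> sqrt C * (1/2)^k" for k
    proof (rule power2_le_imp_le)
      show "0 \<le> sqrt C * (1/2)^k" using C(1) by simp
      have "(1/4)^k * (4^k * (cmod (D k x))\<^sup>2) \<le> (1/4)^k * C"
        using order_trans[OF abs_ge_self C(2)[of k, unfolded real_norm_def]]
        by (rule mult_left_mono) simp
      moreover have "(1/4::real)^k * 4^k = 1"
        unfolding power_mult_distrib[symmetric] by simp
      ultimately have "(cmod (D k x))\<^sup>2 \<le> (1/4)^k * C"
        by (simp only: mult.assoc[symmetric] mult_1_left)
      also have "\<dots> = (sqrt C * (1/2)^k)\<^sup>2"
      proof -
        have "((1/2)^k)\<^sup>2 = (1/4::real)^k"
          unfolding power2_eq_square power_mult_distrib[symmetric] by simp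
        moreover have "(sqrt C)\<^sup>2 = C" using C(1) by simp
        ultimately show ?thesis
          by (simp only: power_mult_distrib mult.commute)
      qed
      finally show "(cmod (D k x))\<^sup>2 \<le> (sqrt C * (1/2)^k)\<^sup>2" .
    qed
    moreover have "summable (\<lambda>k. sqrt C * (1/2::real)^k)"
      by (intro summable_mult summable_geometric) simp
    ultimately have "summable (\<lambda>k. D k x)"
      by (rule summable_comparison_test'[where N=0 and g="\<lambda>k. sqrt C * (1/2)^k", rotated])
    then have "convergent (\<lambda>k. \<Sum>i<k. D i x)" by (simp add: summable_iff_convergent)
    then have "convergent (\<lambda>k. (\<Sum>i<k. D i x) + s (r 0) x)"
      by (intro convergent_add convergent_const)
    moreover have "(\<Sum>i<k. D i x) + s (r 0) x = s (r k) x" for k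
      unfolding D_def using sum_lessThan_telescope[of "\<lambda>i. s (r i) x" k] by simp
    ultimately show ?case by (simp only:)
  qed
  define f where "f x = lim (\<lambda>k. s (r k) x)" for x
  have [measurable]: "f \<in> borel_measurable M"
    unfolding f_def by (rule borel_measurable_lim_metric) measurable
  have lim: "AE x in M. (\<lambda>k. s (r k) x) \<longlonglongrightarrow> f x"
    using conv unfolding f_def by eventually_elim (simp add: convergent_LIMSEQ_iff)
  \<comment> \<open>Fix \<open>m\<close> and let the index of the subsequence grow: Fatou turns the
    Cauchy estimate into a bound for \<open>s m - f\<close>. Membership of \<open>f\<close> in
    \<open>L2\<close> is read off from this difference.\<close>
  have est: "(\<lambda>x. s m x - f x) \<in> L2 M \<and> L2_norm M (\<lambda>x. s m x - f x) \<le> e"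
    if e: "e > 0" and m: "m \<ge> N'" and N': "\<forall>m\<ge>N'. \<forall>n\<ge>N'. L2_norm M (\<lambda>x. s m x - s n x) < e"
    for e m N'
  proof -
    have "L2_norm M (\<lambda>x. s m x - s (r k) x) \<le> e" if "k \<ge> N'" for k
      using N'[rule_format, OF m order_trans[OF that rk]] by (rule less_imp_le)
    moreover have "AE x in M. (\<lambda>k. s m x - s (r k) x) \<longlonglongrightarrow> s m x - f x"
      using lim by eventually_elim (intro tendsto_intros)
    moreover have "(\<lambda>x. s m x - s (r k) x) \<in> L2 M" for k by (intro L2_diff s)
    moreover have "(\<lambda>x. s m x - f x) \<in> borel_measurable M" by measurable
    moreover have "0 \<le> e" using e by simp
    ultimately show ?thesis
      using L2_Fatou[of "\<lambda>k x. s m x - s (r k) x" M "\<lambda>x. s m x - f x" N' e]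
      by (intro conjI) metis+
  qed
  obtain N1 where N1: "\<forall>m\<ge>N1. \<forall>n\<ge>N1. L2_norm M (\<lambda>x. s m x - s n x) < 1"
    using Cauchy[of 1] by auto
  have "(\<lambda>x. s N1 x - f x) \<in> L2 M"
    using est[OF _ _ N1] by auto
  from L2_diff[OF s[of N1] this] have f: "f \<in> L2 M" by simp
  have "L2_lim M s f"
  proof (rule LIMSEQ_I)
    fix e :: real assume e: "e > 0"
    then obtain N' where N': "\<forall>m\<ge>N'. \<forall>n\<ge>N'. L2_norm M (\<lambda>x. s m x - s n x) < e/2"
      using Cauchy[of "e/2"] by auto
    have "L2_norm M (\<lambda>x. s n x - f x) < e" if "n \<ge> N'" for n
      using est[OF _ that N'] e by auto
    then show "\<exists>no. \<forall>n\<ge>no. norm (L2_norm M (\<lambda>x. s n x - f x) - 0) < e"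
      by auto
  qed
  with f that show ?thesis by blast
qed

section \<open>Projection theorem, Riesz representation and density criteria\<close>

subsection \<open>Subspaces and orthogonal projections\<close>

text \<open>Spans of elementary tensors are in general dense but not closed, so the algebraic lemmas
  are stated for this weaker notion.\<close>

definition linear_subspace :: "'a measure \<Rightarrow> ('a \<Rightarrow> complex) set \<Rightarrow> bool" where
  "linear_subspace M K \<longleftrightarrow> K \<subseteq> L2 M \<and> (\<lambda>x. 0) \<in> K \<and>
     (\<forall>f\<in>K. \<forall>g\<in>K. (\<lambda>x. f x + g x) \<in> K) \<and> (\<forall>c. \<forall>f\<in>K. (\<lambda>x. c * f x) \<in> K)"

lemma linear_subspaceD:
  assumes "linear_subspace M K"
  shows "f \<in> K \<Longrightarrow> f \<in> L2 M" "(\<lambda>x. 0) \<in> K" "f \<in> K \<Longrightarrow> g \<in> K \<Longrightarrow> (\<lambda>x. f x + g x) \<in> K"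
    "f \<in> K \<Longrightarrow> (\<lambda>x. c * f x) \<in> K" "f \<in> K \<Longrightarrow> g \<in> K \<Longrightarrow> (\<lambda>x. f x - g x) \<in> K"
proof -
  show "f \<in> K \<Longrightarrow> f \<in> L2 M" "(\<lambda>x. 0) \<in> K"
    and add: "f \<in> K \<Longrightarrow> g \<in> K \<Longrightarrow> (\<lambda>x. f x + g x) \<in> K"
    and scale: "f \<in> K \<Longrightarrow> (\<lambda>x. c * f x) \<in> K" for f g c
    using assms unfolding linear_subspace_def by auto
  show "(\<lambda>x. f x - g x) \<in> K" if "f \<in> K" "g \<in> K"
    using add[OF that(1) scale[OF that(2), of "-1"]] by simp
qed

lemma closed_subspace_linear: "closed_subspace M H \<Longrightarrow> linear_subspace M H"
  unfolding closed_subspace_def linear_subspace_def by auto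

lemma closed_subspace_limit:
  assumes "closed_subspace M H" "f \<in> L2 M" "\<And>n::nat. s n \<in> H"
    "L2_lim M s f"
  shows "f \<in> H"
  using assms unfolding closed_subspace_def by blast

lemma closed_subspace_ae:
  assumes "closed_subspace M H" "f \<in> H" "g \<in> L2 M" "ae_eq M f g"
  shows "g \<in> H"
proof (rule closed_subspace_limit[OF assms(1,3), of "\<lambda>_. f"])
  have "f \<in> L2 M" using assms(1,2) by (auto simp: closed_subspace_def)
  then show "L2_lim M (\<lambda>n. f) g"
    using assms ae_eq_iff_L2_norm by force
qed (use assms in auto)

lemma closed_subspace_L2: "closed_subspace M (L2 M)"
  unfolding closed_subspace_def by (auto intro: L2_add L2_scale)

lemma linear_subspace_L2: "linear_subspace M (L2 M)"
  by (intro closed_subspace_linear closed_subspace_L2)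

lemma L2_parallelogram:
  assumes "a \<in> L2 M" "b \<in> L2 M"
  shows "(L2_norm M (\<lambda>x. a x - b x))\<^sup>2 + (L2_norm M (\<lambda>x. a x + b x))\<^sup>2
       = 2 * (L2_norm M a)\<^sup>2 + 2 * (L2_norm M b)\<^sup>2"
  using L2_norm_diff_square[OF assms] L2_norm_add_square[OF assms] by simp

text \<open>First variation: were the inner product nonzero, moving \<open>q\<close> a little in the
  direction of \<open>h\<close> would shorten it.\<close>

lemma L2_orthogonal_if_minimal:
  assumes q: "q \<in> L2 M" and h: "h \<in> L2 M"
    and min: "\<And>c. L2_norm M q \<le> L2_norm M (\<lambda>x. q x - c * h x)"
  shows "L2_inner M q h = 0"
proof -
  \<comment> \<open>The denominator \<open>n + 1\<close> keeps the step length defined for null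
    \<open>h\<close> and gives \<open>t * n \<le> 1\<close>, so the quadratic term uses up at most
    half of the linear gain.\<close>
  define \<alpha> n t where "\<alpha> = L2_inner M q h" and "n = (L2_norm M h)\<^sup>2" and "t = 1 / (n + 1)"
  have n: "n \<ge> 0" by (simp add: n_def)
  then have t: "t > 0" "t * n \<le> 1" by (simp_all add: t_def divide_le_eq)
  have "(L2_norm M q)\<^sup>2 \<le> (L2_norm M (\<lambda>x. q x - of_real t * \<alpha> * h x))\<^sup>2"
    using min[of "of_real t * \<alpha>"] by (intro power_mono) auto
  also have "\<dots> = (L2_norm M q)\<^sup>2 + t\<^sup>2 * (cmod \<alpha>)\<^sup>2 * n - 2 * Re (of_real t * cnj \<alpha> * \<alpha>)"
    using t by (subst L2_norm_diff_square[OF q L2_scale[OF h]])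
      (simp add: L2_norm_scale L2_inner_scale_right n_def \<alpha>_def power_mult_distrib norm_mult)
  also have "Re (of_real t * cnj \<alpha> * \<alpha>) = t * (cmod \<alpha>)\<^sup>2"
    by (simp add: mult.assoc complex_norm_square[symmetric] mult.commute[of "cnj \<alpha>"] cmod_power2 power2_eq_square)
  finally have "2 * (t * (cmod \<alpha>)\<^sup>2) \<le> (t * n) * (t * (cmod \<alpha>)\<^sup>2)"
    by (simp add: power2_eq_square algebra_simps)
  also have "\<dots> \<le> 1 * (t * (cmod \<alpha>)\<^sup>2)"
    using t by (intro mult_right_mono) auto
  finally have "t * (cmod \<alpha>)\<^sup>2 \<le> 0" by simp
  then have "\<alpha> = 0" using t by (simp add: mult_le_0_iff)
  then show ?thesis by (simp add: \<alpha>_def)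
qed

text \<open>A minimizing sequence is Cauchy by the parallelogram law, because the midpoint of two of
  its members lies in \<open>H\<close> and is no closer to \<open>f\<close> than the infimum
  \<open>\<delta>\<close>. The limit is a nearest point, and minimality makes the difference
  orthogonal to \<open>H\<close>.\<close>

theorem projection_exists:
  assumes H: "closed_subspace M H" and f: "f \<in> L2 M"
  shows "\<exists>p. p \<in> H \<and> (\<forall>h\<in>H. L2_inner M (\<lambda>x. f x - p x) h = 0)"
proof -
  note lin = linear_subspaceD[OF closed_subspace_linear[OF H]]
  define dst where "dst h = L2_norm M (\<lambda>x. f x - h x)" for h
  define \<delta> where "\<delta> = Inf (dst ` H)"
  have bdd: "bdd_below (dst ` H)" by (rule bdd_belowI[of _ 0]) (auto simp: dst_def)
  have \<delta>_le: "\<delta> \<le> dst h" if "h \<in> H" for h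
    unfolding \<delta>_def using that bdd by (intro cInf_lower) auto
  have \<delta>0: "\<delta> \<ge> 0"
    unfolding \<delta>_def using lin(2) by (intro cInf_greatest) (auto simp: dst_def)
  have "\<exists>h\<in>H. dst h < \<delta> + 1 / real (Suc n)" for n
    using cInf_lessD[of "dst ` H" "\<delta> + 1 / real (Suc n)"] lin(2) by (auto simp: \<delta>_def)
  then obtain h where h: "\<And>n. h n \<in> H" "\<And>n. dst (h n) < \<delta> + 1 / real (Suc n)" by metis
  have hL: "h n \<in> L2 M" for n using h lin by auto
  \<comment> \<open>The bound is
    \<open>4 * (\<delta> + \<epsilon>)\<^sup>2 - 4 * \<delta>\<^sup>2\<close> with
    \<open>\<epsilon> = 1 / (N + 1)\<close>, estimated by means of
    \<open>\<epsilon> \<le> 1\<close>.\<close>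
  have key: "(L2_norm M (\<lambda>x. h m x - h n x))\<^sup>2 \<le> (8 * \<delta> + 4) / real (Suc N)"
    if mn: "m \<ge> N" "n \<ge> N" for m n N
  proof -
    define \<epsilon> where "\<epsilon> = 1 / real (Suc N)"
    have \<epsilon>: "\<epsilon> > 0" "\<epsilon> \<le> 1" by (auto simp: \<epsilon>_def)
    have d: "(dst (h k))\<^sup>2 \<le> (\<delta> + \<epsilon>)\<^sup>2" if "k \<ge> N" for k
    proof (rule power_mono)
      have "1 / real (Suc k) \<le> \<epsilon>" unfolding \<epsilon>_def using that by (simp add: frac_le)
      then show "dst (h k) \<le> \<delta> + \<epsilon>" using h(2)[of k] by simp
    qed (simp add: dst_def)
    let ?a = "\<lambda>x. f x - h m x" and ?b = "\<lambda>x. f x - h n x"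
    let ?c = "\<lambda>x. (1/2) * (h m x + h n x)"
    have "?c \<in> H" using lin(3,4) h(1) by blast
    then have "\<delta>\<^sup>2 \<le> (dst ?c)\<^sup>2" using \<delta>_le \<delta>0 by (intro power_mono) auto
    moreover have "L2_norm M (\<lambda>x. ?a x + ?b x) = 2 * dst ?c"
      using L2_norm_scale[of M 2 "\<lambda>x. f x - ?c x"] unfolding dst_def
      by (simp add: algebra_simps)
    ultimately have "4 * \<delta>\<^sup>2 \<le> (L2_norm M (\<lambda>x. ?a x + ?b x))\<^sup>2" by (simp add: power_mult_distrib)
    moreover have "(L2_norm M (\<lambda>x. ?a x - ?b x))\<^sup>2 + (L2_norm M (\<lambda>x. ?a x + ?b x))\<^sup>2
         = 2 * (dst (h m))\<^sup>2 + 2 * (dst (h n))\<^sup>2"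
      unfolding dst_def by (rule L2_parallelogram) (use f hL in \<open>auto intro: L2_diff\<close>)
    ultimately have "(L2_norm M (\<lambda>x. ?a x - ?b x))\<^sup>2 \<le> 4 * (\<delta> + \<epsilon>)\<^sup>2 - 4 * \<delta>\<^sup>2"
      using d[OF mn(1)] d[OF mn(2)] by linarith
    also have "\<dots> = (8 * \<delta> + 4 * \<epsilon>) * \<epsilon>" by (simp add: power2_eq_square algebra_simps)
    also have "\<dots> \<le> (8 * \<delta> + 4) * \<epsilon>" using \<epsilon> by (intro mult_right_mono) auto
    finally show ?thesis
      using L2_norm_minus_commute[of M "h m"] by (simp add: \<epsilon>_def)
  qed
  obtain p where p: "p \<in> L2 M" "L2_lim M h p"
  proof (rule L2_complete[OF hL])
    fix e :: real assume e: "e > 0"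
    obtain N :: nat where N: "(8 * \<delta> + 4) / e\<^sup>2 < real N" using reals_Archimedean2 by blast
    have "(8 * \<delta> + 4) / real (Suc N) < e\<^sup>2"
    proof -
      have "8 * \<delta> + 4 < real N * e\<^sup>2" using N e by (simp add: divide_less_eq)
      also have "\<dots> \<le> real (Suc N) * e\<^sup>2" by (intro mult_right_mono) auto
      finally show ?thesis by (simp add: divide_less_eq mult.commute)
    qed
    then have "L2_norm M (\<lambda>x. h m x - h n x) < e" if "m \<ge> N" "n \<ge> N" for m n
      using key[OF that] e by (intro power_less_imp_less_base[of _ 2 e]) auto
    then show "\<exists>N. \<forall>m\<ge>N. \<forall>n\<ge>N. L2_norm M (\<lambda>x. h m x - h n x) < e" by blast
  qed
  have pH: "p \<in> H" by (rule closed_subspace_limit[OF H p(1) h(1) p(2)])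
  have "(\<lambda>n. dst (h n)) \<longlonglongrightarrow> dst p"
    unfolding dst_def
  proof (rule L2_norm_tendsto)
    show "(\<lambda>n. L2_norm M (\<lambda>x. f x - h n x - (f x - p x))) \<longlonglongrightarrow> 0"
      using p(2) L2_norm_minus_commute[of M p] by (simp add: algebra_simps)
  qed (use f p hL in \<open>auto intro: L2_diff\<close>)
  moreover have "(\<lambda>n. \<delta> + 1 / real (Suc n)) \<longlonglongrightarrow> \<delta> + 0"
    by (intro tendsto_intros LIMSEQ_Suc[OF lim_1_over_n])
  ultimately have p_min: "dst p \<le> \<delta>"
    using h(2) by (intro LIMSEQ_le[of "\<lambda>n. dst (h n)" "dst p" "\<lambda>n. \<delta> + 1 / real (Suc n)" \<delta>]) (auto intro: less_imp_le)
  have "L2_inner M (\<lambda>x. f x - p x) k = 0" if k: "k \<in> H" for k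
  proof (rule L2_orthogonal_if_minimal)
    fix c
    have "(\<lambda>x. p x + c * k x) \<in> H" using lin pH k by blast
    from \<delta>_le[OF this] p_min show "L2_norm M (\<lambda>x. f x - p x) \<le> L2_norm M (\<lambda>x. f x - p x - c * k x)"
      by (simp add: dst_def algebra_simps)
  qed (use f p k lin in \<open>auto intro: L2_diff\<close>)
  with pH show ?thesis by blast
qed

lemma proj_onto_props:
  assumes "closed_subspace M H" "f \<in> L2 M"
  shows "proj_onto M H f \<in> H" "h \<in> H \<Longrightarrow> L2_inner M (\<lambda>x. f x - proj_onto M H f x) h = 0"
  using someI_ex[OF projection_exists[OF assms]] unfolding proj_onto_def by auto

text \<open>Two candidates differ by an element of \<open>H\<close> that is orthogonal to
  \<open>H\<close>. Since \<open>proj_onto\<close> picks a representative by choice, its algebraic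
  laws are all derived from this uniqueness.\<close>

lemma proj_onto_unique:
  assumes H: "closed_subspace M H" and f: "f \<in> L2 M" and p: "p \<in> H"
    "\<And>h. h \<in> H \<Longrightarrow> L2_inner M (\<lambda>x. f x - p x) h = 0"
  shows "ae_eq M (proj_onto M H f) p"
proof -
  note lin = linear_subspaceD[OF closed_subspace_linear[OF H]]
  let ?q = "proj_onto M H f" and ?d = "\<lambda>x. proj_onto M H f x - p x"
  note q = proj_onto_props[OF H f]
  have d: "?d \<in> H" using lin(5) q p by blast
  have "L2_inner M ?d ?d = L2_inner M (\<lambda>x. (f x - p x) - (f x - ?q x)) ?d"
    by simp
  also have "\<dots> = L2_inner M (\<lambda>x. f x - p x) ?d - L2_inner M (\<lambda>x. f x - ?q x) ?d"
    using f p q d lin by (intro L2_inner_diff_left L2_diff) auto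
  also have "\<dots> = 0" using p(2)[OF d] q(2)[OF d] by simp
  finally show ?thesis using p q lin by (simp add: L2_inner_self ae_eq_iff_L2_norm)
qed

lemma proj_onto_id:
  assumes H: "closed_subspace M H" and f: "f \<in> H"
  shows "ae_eq M (proj_onto M H f) f"
  by (rule proj_onto_unique[OF H _ f]) (use f linear_subspaceD[OF closed_subspace_linear[OF H]] in auto)

text \<open>Every \<open>f\<close> is a multiple of a single vector \<open>q\<close> modulo the
  kernel of \<open>\<phi>\<close>, where \<open>q\<close> is the component of some \<open>y\<close>
  orthogonal to the kernel. The representing vector is \<open>q\<close>, scaled so that the value at
  \<open>q\<close> comes out right.\<close>

theorem Riesz_representation:
  assumes H: "closed_subspace M H"
    and add: "\<And>f g. f \<in> H \<Longrightarrow> g \<in> H \<Longrightarrow> \<phi> (\<lambda>x. f x + g x) = \<phi> f + \<phi> g"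
    and scale: "\<And>c f. f \<in> H \<Longrightarrow> \<phi> (\<lambda>x. c * f x) = c * \<phi> f"
    and bound: "\<And>f. f \<in> H \<Longrightarrow> cmod (\<phi> f) \<le> C * L2_norm M f"
  shows "\<exists>z\<in>H. \<forall>f\<in>H. \<phi> f = L2_inner M f z"
proof (cases "\<forall>f\<in>H. \<phi> f = 0")
  case True
  then show ?thesis
    using linear_subspaceD(2)[OF closed_subspace_linear[OF H]] by (intro bexI[of _ "\<lambda>x. 0"]) auto
next
  case False
  note lin = linear_subspaceD[OF closed_subspace_linear[OF H]]
  have diff: "\<phi> (\<lambda>x. f x - g x) = \<phi> f - \<phi> g" if "f \<in> H" "g \<in> H" for f g
    using add[OF that(1) lin(4)[OF that(2), of "-1"]] scale[OF that(2), of "-1"] by simp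
  from False obtain y where y: "y \<in> H" "\<phi> y \<noteq> 0" by blast
  define N where "N = {f \<in> H. \<phi> f = 0}"
  have N: "closed_subspace M N"
    unfolding closed_subspace_def
  proof (intro conjI allI ballI impI)
    fix s f assume f: "f \<in> L2 M" and s: "\<forall>n::nat. s n \<in> N"
      and lim: "L2_lim M s f"
    have fH: "f \<in> H" using s by (intro closed_subspace_limit[OF H f _ lim]) (auto simp: N_def)
    have "cmod (\<phi> f) \<le> C * L2_norm M (\<lambda>x. s n x - f x)" for n
    proof -
      have sn: "s n \<in> H" "\<phi> (s n) = 0" using s by (auto simp: N_def)
      show ?thesis using bound[OF lin(5)[OF sn(1) fH]] diff[OF sn(1) fH] sn(2) by simp
    qed
    moreover have "(\<lambda>n. C * L2_norm M (\<lambda>x. s n x - f x)) \<longlonglongrightarrow> 0"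
      using tendsto_mult_right_zero[OF lim] by simp
    ultimately have "cmod (\<phi> f) \<le> 0" by (intro LIMSEQ_le_const) auto
    then show "f \<in> N" using fH by (simp add: N_def)
  next
    show "(\<lambda>x. 0) \<in> N" using scale[OF lin(2), of 0] lin(2) by (simp add: N_def)
  qed (auto simp: N_def lin add scale)
  have yL: "y \<in> L2 M" using y lin by auto
  define p q where "p = proj_onto M N y" and "q = (\<lambda>x. y x - p x)"
  have p: "p \<in> N" "\<And>h. h \<in> N \<Longrightarrow> L2_inner M q h = 0"
    using proj_onto_props[OF N yL] by (auto simp: p_def q_def)
  have q: "q \<in> H" "\<phi> q = \<phi> y" using y p(1) lin(5) diff unfolding N_def q_def by auto
  have nq: "L2_norm M q \<noteq> 0" using bound[OF q(1)] q(2) y(2) by auto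
  define c where "c = \<phi> q / of_real ((L2_norm M q)\<^sup>2)"
  have "\<phi> f = L2_inner M f (\<lambda>x. cnj c * q x)" if f: "f \<in> H" for f
  proof -
    let ?n = "\<lambda>x. f x - (\<phi> f / \<phi> q) * q x"
    have "?n \<in> H" by (rule lin(5)[OF f lin(4)[OF q(1)]])
    moreover have "\<phi> ?n = 0"
      unfolding diff[OF f lin(4)[OF q(1)]] scale[OF q(1)] using q(2) y(2) by simp
    ultimately have "?n \<in> N" unfolding N_def by (intro CollectI conjI)
    then have "L2_inner M q ?n = 0" using p(2) by blast
    then have "L2_inner M ?n q = 0" using L2_inner_commute[of M ?n q] by simp
    then have "L2_inner M f q = (\<phi> f / \<phi> q) * L2_inner M q q"
      using L2_inner_diff_left[OF lin(1)[OF f] L2_scale[OF lin(1)[OF q(1)], of "\<phi> f / \<phi> q"] lin(1)[OF q(1)]]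
      by (simp only: L2_inner_scale_left) simp
    then show ?thesis using nq q(2) y(2)
      unfolding L2_inner_scale_right by (simp add: c_def L2_inner_self)
  qed
  then show ?thesis by (intro bexI[OF _ lin(4)[OF q(1)]] ballI)
qed

text \<open>The limits of sequences from \<open>K\<close> form a closed subspace, and
  \<open>f\<close> minus its projection onto it is orthogonal to \<open>K\<close>, hence null by
  totality.\<close>

lemma dense_if_total:
  assumes K: "linear_subspace M K"
    and total: "\<And>h. h \<in> L2 M \<Longrightarrow> (\<And>k. k \<in> K \<Longrightarrow> L2_inner M k h = 0) \<Longrightarrow> ae_eq M h (\<lambda>x. 0)"
    and f: "f \<in> L2 M"
  shows "\<exists>s. (\<forall>n. s n \<in> K) \<and> L2_lim M s f"
proof -
  note lin = linear_subspaceD[OF K]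
  define C where "C = {f \<in> L2 M. \<exists>s. (\<forall>n. s n \<in> K) \<and> L2_lim M s f}"
  have KC: "K \<subseteq> C"
    unfolding C_def using lin(1) by (auto intro!: exI[of _ "\<lambda>_. _"])
  have C: "closed_subspace M C"
    unfolding closed_subspace_def
  proof (intro conjI allI ballI impI)
    show "C \<subseteq> L2 M" by (auto simp: C_def)
    show "(\<lambda>x. 0) \<in> C" using KC lin(2) by blast
  next
    fix f g assume "f \<in> C" "g \<in> C"
    then obtain s t where s: "f \<in> L2 M" "\<And>n. s n \<in> K" "L2_lim M s f"
      and t: "g \<in> L2 M" "\<And>n. t n \<in> K" "L2_lim M t g" unfolding C_def by blast
    show "(\<lambda>x. f x + g x) \<in> C"
      unfolding C_def
      by (intro CollectI conjI exI[of _ "\<lambda>n x. s n x + t n x"] allI L2_add[OF s(1) t(1)] lin(3)[OF s(2) t(2)]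
            L2_lim_add[OF lin(1)[OF s(2)] s(1,3) lin(1)[OF t(2)] t(1,3)])
  next
    fix c f assume "f \<in> C"
    then obtain s where s: "f \<in> L2 M" "\<And>n. s n \<in> K" "L2_lim M s f" unfolding C_def by blast
    show "(\<lambda>x. c * f x) \<in> C"
      unfolding C_def
      by (intro CollectI conjI exI[of _ "\<lambda>n x. c * s n x"] allI L2_scale[OF s(1)] lin(4)[OF s(2)] L2_lim_scale[OF s(3)])
  next
    fix s f assume f: "f \<in> L2 M" and s: "\<forall>n. s n \<in> C" and lim: "L2_lim M s f"
    have "\<exists>k\<in>K. L2_norm M (\<lambda>x. f x - k x) < e" if "e > 0" for e
    proof -
      from that have e2: "e/2 > 0" by simp
      obtain n where n: "L2_norm M (\<lambda>x. s n x - f x) < e/2"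
        using LIMSEQ_D[OF lim e2] by auto
      have sn: "s n \<in> L2 M" using s by (auto simp: C_def)
      obtain k where k: "k \<in> K" "L2_norm M (\<lambda>x. s n x - k x) < e/2"
        using s e2 unfolding C_def L2_lim_iff_dense by blast
      have "L2_norm M (\<lambda>x. f x - k x) < e"
        using L2_norm_triangle3[OF f sn lin(1)[OF k(1)]] n k(2) L2_norm_minus_commute[of M f]
        by simp
      with k(1) show ?thesis by blast
    qed
    then show "f \<in> C" using f by (simp add: C_def L2_lim_iff_dense)
  qed
  define p where "p = proj_onto M C f"
  note p = proj_onto_props[OF C f, folded p_def]
  have pL: "p \<in> L2 M" using p(1) by (auto simp: C_def)
  have "ae_eq M (\<lambda>x. f x - p x) (\<lambda>x. 0)"
  proof (rule total)
    fix k assume "k \<in> K"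
    with KC p(2) have "L2_inner M (\<lambda>x. f x - p x) k = 0" by blast
    then show "L2_inner M k (\<lambda>x. f x - p x) = 0" using L2_inner_commute[of M k] by simp
  qed (use f pL L2_diff in auto)
  then have "ae_eq M p f" by (auto simp: ae_eq_def)
  then have "f \<in> C" using closed_subspace_ae[OF C p(1) f] by simp
  then show ?thesis by (simp add: C_def)
qed

text \<open>Restrictions to sets of finite measure are integrable, being products of two
  square-integrable functions, and they converge by domination. Formulas for the Fourier integral
  reach all of \<open>L2\<close> in this way.\<close>

lemma (in sigma_finite_measure) integrable_dense_in_L2:
  assumes f: "f \<in> L2 M"
  shows "\<exists>s. (\<forall>n::nat. s n \<in> L2 M \<and> integrable M (s n)) \<and> L2_lim M s f"
proof -
  obtain A :: "nat \<Rightarrow> 'a set" where A: "range A \<subseteq> sets M" "(\<Union>i. A i) = space M"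
    "\<And>i. emeasure M (A i) \<noteq> \<infinity>" "incseq A"
    by (rule sigma_finite_incseq) blast
  have [measurable]: "A i \<in> sets M" for i using A(1) by auto
  note [measurable] = L2_measurable[OF f]
  define s where "s n x = indicator (A n) x * f x" for n x
  have ind: "(\<lambda>x. indicator (A n) x) \<in> L2 M" for n
    using A(3) by (intro L2_indicator) (auto simp: top.not_eq_extremum)
  have s: "s n \<in> L2 M" for n
    unfolding s_def by (rule L2_mult_bounded[OF f, of _ 1]) (auto simp: indicator_def)
  have int: "integrable M (s n)" for n
  proof -
    have "(\<lambda>x. f x * cnj (indicator (A n) x)) = s n"
      by (auto simp: s_def indicator_def)
    then show ?thesis using L2_inner_integrable[OF f ind[of n]] by simp
  qed
  have "(\<lambda>n. (\<integral>x. (cmod (s n x - f x))\<^sup>2 \<partial>M)) \<longlonglongrightarrow> (\<integral>x. 0 \<partial>M)"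
  proof (rule integral_dominated_convergence)
    show "integrable M (\<lambda>x. (cmod (f x))\<^sup>2)" by (rule L2_integrable_square[OF f])
    show "(\<lambda>x. (cmod (s n x - f x))\<^sup>2) \<in> borel_measurable M" for n
      unfolding s_def by measurable
    show "AE x in M. norm ((cmod (s n x - f x))\<^sup>2) \<le> (cmod (f x))\<^sup>2" for n
      by (intro AE_I2) (auto simp: s_def indicator_def)
    show "AE x in M. (\<lambda>n. (cmod (s n x - f x))\<^sup>2) \<longlonglongrightarrow> 0"
    proof (rule AE_I2)
      fix x assume "x \<in> space M"
      then obtain i where "x \<in> A i" using A(2) by blast
      then have "s n x = f x" if "n \<ge> i" for n
        using A(4) that by (auto simp: s_def indicator_def incseq_def)
      then show "(\<lambda>n. (cmod (s n x - f x))\<^sup>2) \<longlonglongrightarrow> 0"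
        by (intro tendsto_eventually eventually_sequentiallyI[of i]) simp
    qed
  qed simp
  then have "L2_lim M s f"
    unfolding L2_norm_def using tendsto_real_sqrt by fastforce
  then show ?thesis using s int by blast
qed

text \<open>By Markov's inequality the sets where \<open>m |g n|\<^sup>2 \<ge> 1\<close> have finite
  measure; they exhaust the space up to the common zero set, which is null. The use is for
  \<open>\<nu>'\<close>, with Fourier transforms as the functions \<open>g n\<close>.\<close>

lemma sigma_finite_if_L2_cover:
  assumes g: "\<And>n::nat. g n \<in> L2 M" and cover: "AE x in M. \<exists>n. g n x \<noteq> 0"
  shows "sigma_finite_measure M"
proof
  note [measurable] = L2_measurable[OF g]
  define A where "A n m = {x \<in> space M. 1 \<le> ennreal (real m) * ennreal ((cmod (g n x))\<^sup>2)}" for n m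
  define Z where "Z = {x \<in> space M. \<forall>n. g n x = 0}"
  have A: "A n m \<in> sets M" for n m unfolding A_def by measurable
  have Z: "Z \<in> sets M" unfolding Z_def by measurable
  have "emeasure M Z = 0"
    using cover Z unfolding Z_def by (subst (asm) AE_iff_measurable[where N=Z]) (auto simp: Z_def)
  have fin: "emeasure M (A n m) < \<infinity>" for n m
  proof -
    have "emeasure M ({x \<in> space M. 1 \<le> ennreal (real m) * ennreal ((cmod (g n x))\<^sup>2)} \<inter> space M)
        \<le> ennreal (real m) * (\<integral>\<^sup>+x. ennreal ((cmod (g n x))\<^sup>2) * indicator (space M) x \<partial>M)"
      using nn_integral_Markov_inequality[of "\<lambda>x. ennreal ((cmod (g n x))\<^sup>2)" "space M" M "ennreal (real m)"]
      by (simp add: Int_def conj_commute)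
    also have "(\<integral>\<^sup>+x. ennreal ((cmod (g n x))\<^sup>2) * indicator (space M) x \<partial>M) = (\<integral>\<^sup>+x. ennreal ((cmod (g n x))\<^sup>2) \<partial>M)"
      by (intro nn_integral_cong) auto
    also have "\<dots> = ennreal ((L2_norm M (g n))\<^sup>2)" by (rule L2_nn_integral[OF g])
    also have "ennreal (real m) * ennreal ((L2_norm M (g n))\<^sup>2) < \<infinity>"
      by (simp flip: ennreal_mult)
    finally show ?thesis by (simp add: A_def Int_def conj_commute)
  qed
  have "x \<in> Z \<or> (\<exists>n m. x \<in> A n m)" if x: "x \<in> space M" for x
  proof (cases "x \<in> Z")
    case False
    then obtain n where n: "g n x \<noteq> 0" using x unfolding Z_def by blast
    obtain m :: nat where "1 / (cmod (g n x))\<^sup>2 < real m" using reals_Archimedean2 by blast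
    then have "1 \<le> real m * (cmod (g n x))\<^sup>2" using n by (simp add: divide_less_eq)
    then have "ennreal 1 \<le> ennreal (real m * (cmod (g n x))\<^sup>2)" by (rule ennreal_leI)
    then have "x \<in> A n m" using x by (simp add: A_def ennreal_mult)
    then show ?thesis by blast
  qed simp
  then have "space M \<subseteq> \<Union>(insert Z (range (case_prod A)))"
    by fastforce
  moreover have "\<Union>(insert Z (range (case_prod A))) \<subseteq> space M"
    by (auto simp: A_def Z_def)
  ultimately have "\<Union>(insert Z (range (case_prod A))) = space M"
    by (rule subset_antisym[rotated])
  then show "\<exists>A. countable A \<and> A \<subseteq> sets M \<and> \<Union>A = space M \<and> (\<forall>a\<in>A. emeasure M a \<noteq> \<infinity>)"
    using A Z fin \<open>emeasure M Z = 0\<close>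
    by (intro exI[of _ "insert Z (range (case_prod A))"]) (auto simp: less_top[symmetric])
qed

section \<open>Bounded operators on spaces of representatives; agreement and extension by
  density\<close>

subsection \<open>Bounded operators\<close>

lemma bounded_opD:
  assumes "bounded_op M H N K T"
  shows "f \<in> H \<Longrightarrow> T f \<in> K" "f \<in> H \<Longrightarrow> g \<in> H \<Longrightarrow> ae_eq M f g \<Longrightarrow> ae_eq N (T f) (T g)"
    "f \<in> H \<Longrightarrow> g \<in> H \<Longrightarrow> ae_eq N (T (\<lambda>x. f x + g x)) (\<lambda>y. T f y + T g y)"
    "f \<in> H \<Longrightarrow> ae_eq N (T (\<lambda>x. c * f x)) (\<lambda>y. c * T f y)"
  using assms unfolding bounded_op_def by auto

lemma bounded_op_bound:
  assumes "bounded_op M H N K T"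
  obtains C where "C \<ge> 0" "\<And>f. f \<in> H \<Longrightarrow> L2_norm N (T f) \<le> C * L2_norm M f"
proof -
  obtain C where C: "\<forall>f\<in>H. L2_norm N (T f) \<le> C * L2_norm M f"
    using assms unfolding bounded_op_def by blast
  have "L2_norm N (T f) \<le> max C 0 * L2_norm M f" if "f \<in> H" for f
  proof -
    have "C * L2_norm M f \<le> max C 0 * L2_norm M f" by (intro mult_right_mono) auto
    then show ?thesis using C that by fastforce
  qed
  then show ?thesis using that[of "max C 0"] by simp
qed

lemma bounded_op_diff:
  assumes T: "bounded_op M H N K T" and H: "linear_subspace M H" and fg: "f \<in> H" "g \<in> H"
  shows "ae_eq N (T (\<lambda>x. f x - g x)) (\<lambda>y. T f y - T g y)"
proof -
  have "ae_eq N (T (\<lambda>x. f x + -1 * g x)) (\<lambda>y. T f y + T (\<lambda>x. -1 * g x) y)"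
    using fg linear_subspaceD[OF H] by (intro bounded_opD(3)[OF T]) blast+
  also have "ae_eq N \<dots> (\<lambda>y. T f y + -1 * T g y)"
    using fg by (intro ae_eq_add ae_eq_refl bounded_opD(4)[OF T])
  finally show ?thesis by simp
qed

text \<open>Riesz applied to \<open>f \<mapsto> \<langle>T f, w\<rangle>\<close>. The vector
  \<open>z\<close> stands for the adjoint of \<open>T\<close> at \<open>w\<close>; \<open>H\<close>
  may be a proper subspace, where \<open>adjoint_op\<close>, which tests against all of
  \<open>L2\<close>, does not apply.\<close>

lemma bounded_op_adjoint_vector:
  assumes H: "closed_subspace M H" and T: "bounded_op M H N K T" and K: "K \<subseteq> L2 N" and w: "w \<in> L2 N"
  shows "\<exists>z\<in>H. \<forall>f\<in>H. L2_inner N (T f) w = L2_inner M f z"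
proof -
  note lin = linear_subspaceD[OF closed_subspace_linear[OF H]]
  have TL: "T f \<in> L2 N" if "f \<in> H" for f using bounded_opD(1)[OF T that] K by blast
  obtain C where C: "C \<ge> 0" "\<And>f. f \<in> H \<Longrightarrow> L2_norm N (T f) \<le> C * L2_norm M f"
    using bounded_op_bound[OF T] by blast
  show ?thesis
  proof (rule Riesz_representation[OF H])
    fix f g assume fg: "f \<in> H" "g \<in> H"
    have "L2_inner N (T (\<lambda>x. f x + g x)) w = L2_inner N (\<lambda>y. T f y + T g y) w"
      by (rule L2_inner_cong_ae[OF TL[OF lin(3)[OF fg]] w L2_add[OF TL[OF fg(1)] TL[OF fg(2)]] w
            bounded_opD(3)[OF T fg] ae_eq_refl])
    then show "L2_inner N (T (\<lambda>x. f x + g x)) w = L2_inner N (T f) w + L2_inner N (T g) w"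
      using L2_inner_add_left[OF TL[OF fg(1)] TL[OF fg(2)] w] by simp
  next
    fix c f assume f: "f \<in> H"
    have "L2_inner N (T (\<lambda>x. c * f x)) w = L2_inner N (\<lambda>y. c * T f y) w"
      by (rule L2_inner_cong_ae[OF TL[OF lin(4)[OF f]] w L2_scale[OF TL[OF f]] w
            bounded_opD(4)[OF T f] ae_eq_refl])
    then show "L2_inner N (T (\<lambda>x. c * f x)) w = c * L2_inner N (T f) w"
      by (simp add: L2_inner_scale_left)
  next
    fix f assume f: "f \<in> H"
    have "cmod (L2_inner N (T f) w) \<le> L2_norm N (T f) * L2_norm N w"
      by (rule L2_Cauchy_Schwarz[OF TL[OF f] w])
    also have "\<dots> \<le> (C * L2_norm M f) * L2_norm N w"
      by (rule mult_right_mono[OF C(2)[OF f]]) simp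
    finally show "cmod (L2_inner N (T f) w) \<le> (C * L2_norm N w) * L2_norm M f" by (simp add: mult_ac)
  qed
qed

lemma bounded_op_restrict:
  assumes T: "bounded_op M H N K T" and H': "H' \<subseteq> H" "\<And>f. f \<in> H' \<Longrightarrow> T f \<in> K'"
  shows "bounded_op M H' N K' T"
  unfolding bounded_op_def
proof (intro conjI ballI allI impI)
  note Td = bounded_opD[OF T] and H'H = subsetD[OF H'(1)]
  show "ae_eq N (T f) (T g)" if "f \<in> H'" "g \<in> H'" "ae_eq M f g" for f g
    by (rule Td(2)[OF H'H[OF that(1)] H'H[OF that(2)] that(3)])
  show "ae_eq N (T (\<lambda>x. f x + g x)) (\<lambda>y. T f y + T g y)" if "f \<in> H'" "g \<in> H'" for f g
    by (rule Td(3)[OF H'H[OF that(1)] H'H[OF that(2)]])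
  show "ae_eq N (T (\<lambda>x. c * f x)) (\<lambda>y. c * T f y)" if "f \<in> H'" for c f
    by (rule Td(4)[OF H'H[OF that]])
  obtain C where "\<And>f. f \<in> H \<Longrightarrow> L2_norm N (T f) \<le> C * L2_norm M f"
    using bounded_op_bound[OF T] by blast
  then show "\<exists>C. \<forall>f\<in>H'. L2_norm N (T f) \<le> C * L2_norm M f" using H'H by blast
qed (rule H'(2))

lemma bounded_op_comp:
  assumes S: "bounded_op M H N K S" and T: "bounded_op N K P L T"
    and H: "linear_subspace M H" and K: "linear_subspace N K"
  shows "bounded_op M H P L (\<lambda>f. T (S f))"
  unfolding bounded_op_def
proof (intro conjI ballI allI impI)
  note Sd = bounded_opD[OF S] and Td = bounded_opD[OF T]
    and Hd = linear_subspaceD[OF H] and Kd = linear_subspaceD[OF K]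
  show "T (S f) \<in> L" if "f \<in> H" for f by (rule Td(1)[OF Sd(1)[OF that]])
  show "ae_eq P (T (S f)) (T (S g))" if "f \<in> H" "g \<in> H" "ae_eq M f g" for f g
    by (rule Td(2)[OF Sd(1)[OF that(1)] Sd(1)[OF that(2)] Sd(2)[OF that]])
  show "ae_eq P (T (S (\<lambda>x. f x + g x))) (\<lambda>y. T (S f) y + T (S g) y)" if f: "f \<in> H" and g: "g \<in> H" for f g
  proof -
    have "ae_eq P (T (S (\<lambda>x. f x + g x))) (T (\<lambda>x. S f x + S g x))"
      by (rule Td(2)[OF Sd(1)[OF Hd(3)[OF f g]] Kd(3)[OF Sd(1)[OF f] Sd(1)[OF g]] Sd(3)[OF f g]])
    also have "ae_eq P \<dots> (\<lambda>y. T (S f) y + T (S g) y)"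
      by (rule Td(3)[OF Sd(1)[OF f] Sd(1)[OF g]])
    finally show ?thesis .
  qed
  show "ae_eq P (T (S (\<lambda>x. c * f x))) (\<lambda>y. c * T (S f) y)" if f: "f \<in> H" for c f
  proof -
    have "ae_eq P (T (S (\<lambda>x. c * f x))) (T (\<lambda>x. c * S f x))"
      by (rule Td(2)[OF Sd(1)[OF Hd(4)[OF f]] Kd(4)[OF Sd(1)[OF f]] Sd(4)[OF f]])
    also have "ae_eq P \<dots> (\<lambda>y. c * T (S f) y)"
      by (rule Td(4)[OF Sd(1)[OF f]])
    finally show ?thesis .
  qed
  obtain A where A: "A \<ge> 0" "\<And>f. f \<in> H \<Longrightarrow> L2_norm N (S f) \<le> A * L2_norm M f"
    using bounded_op_bound[OF S] by blast
  obtain B where B: "B \<ge> 0" "\<And>f. f \<in> K \<Longrightarrow> L2_norm P (T f) \<le> B * L2_norm N f"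
    using bounded_op_bound[OF T] by blast
  have "L2_norm P (T (S f)) \<le> (B * A) * L2_norm M f" if "f \<in> H" for f
  proof -
    have "L2_norm P (T (S f)) \<le> B * L2_norm N (S f)" by (rule B(2)[OF Sd(1)[OF that]])
    also have "\<dots> \<le> B * (A * L2_norm M f)" by (rule mult_left_mono[OF A(2)[OF that] B(1)])
    finally show ?thesis by (simp add: mult.assoc)
  qed
  then show "\<exists>C. \<forall>f\<in>H. L2_norm P (T (S f)) \<le> C * L2_norm M f" by blast
qed

lemma L2_norm_mult_bounded:
  assumes f: "f \<in> L2 M" and m: "m \<in> borel_measurable M" "\<And>x. x \<in> space M \<Longrightarrow> cmod (m x) \<le> C" and C: "0 \<le> C"
  shows "L2_norm M (\<lambda>x. m x * f x) \<le> C * L2_norm M f"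
proof (rule power2_le_imp_le)
  have "(L2_norm M (\<lambda>x. m x * f x))\<^sup>2 \<le> (\<integral>x. C\<^sup>2 * (cmod (f x))\<^sup>2 \<partial>M)"
    unfolding L2_norm_square
  proof (rule integral_mono)
    show "integrable M (\<lambda>x. (cmod (m x * f x))\<^sup>2)"
      by (rule L2_integrable_square[OF L2_mult_bounded[OF f m]])
    show "integrable M (\<lambda>x. C\<^sup>2 * (cmod (f x))\<^sup>2)" using L2_integrable_square[OF f] by simp
    fix x assume "x \<in> space M"
    then have "(cmod (m x))\<^sup>2 \<le> C\<^sup>2" using m(2) by (intro power_mono) auto
    then show "(cmod (m x * f x))\<^sup>2 \<le> C\<^sup>2 * (cmod (f x))\<^sup>2"
      by (simp add: norm_mult power_mult_distrib mult_right_mono)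
  qed
  also have "\<dots> = (C * L2_norm M f)\<^sup>2" by (simp add: L2_norm_square power_mult_distrib)
  finally show "(L2_norm M (\<lambda>x. m x * f x))\<^sup>2 \<le> (C * L2_norm M f)\<^sup>2" .
qed (use C in simp)

lemma bounded_op_mult:
  assumes m: "m \<in> borel_measurable M" "\<And>x. x \<in> space M \<Longrightarrow> cmod (m x) \<le> C" and C: "0 \<le> C"
  shows "bounded_op M (L2 M) M (L2 M) (\<lambda>f x. m x * f x)"
  unfolding bounded_op_def
  using L2_mult_bounded[OF _ m] L2_norm_mult_bounded[OF _ m C]
  by (auto intro: ae_eq_mult simp: ae_eq_def algebra_simps)

lemma bounded_op_measure_preserving:
  assumes T: "T \<in> measurable M M" "distr M M T = M"
  shows "bounded_op M (L2 M) M (L2 M) (\<lambda>f x. f (T x))"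
  unfolding bounded_op_def
proof (intro conjI ballI allI impI)
  note [measurable] = T(1)
  fix f assume f: "f \<in> L2 M"
  have [measurable]: "f \<in> borel_measurable M" by (rule L2_measurable[OF f])
  have "integrable (distr M M T) (\<lambda>x. (cmod (f x))\<^sup>2)"
    unfolding T(2) by (rule L2_integrable_square[OF f])
  then have "integrable M (\<lambda>x. (cmod (f (T x)))\<^sup>2)"
    by (rule integrable_distr[OF T(1)])
  then show "(\<lambda>x. f (T x)) \<in> L2 M" by (simp add: L2_def)
  show "ae_eq M (\<lambda>x. f (T x)) (\<lambda>x. g (T x))" if "ae_eq M f g" for g
  proof -
    have "AE x in distr M M T. f x = g x" using that unfolding T(2) ae_eq_def .
    then show ?thesis unfolding ae_eq_def by (rule AE_distrD[OF T(1)])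
  qed
next
  have "L2_norm M (\<lambda>x. f (T x)) = L2_norm M f" if f: "f \<in> L2 M" for f
  proof -
    note [measurable] = T(1) L2_measurable[OF f]
    have "(\<integral>x. (cmod (f (T x)))\<^sup>2 \<partial>M) = (\<integral>x. (cmod (f x))\<^sup>2 \<partial>(distr M M T))"
      by (rule integral_distr[symmetric]) measurable
    then show ?thesis by (simp add: L2_norm_def T(2))
  qed
  then show "\<exists>C. \<forall>f\<in>L2 M. L2_norm M (\<lambda>x. f (T x)) \<le> C * L2_norm M f"
    by (intro exI[of _ 1]) simp
qed auto

text \<open>Each algebraic clause is an instance of uniqueness: the right-hand side is checked to
  satisfy the defining orthogonality. The bound is Pythagoras.\<close>

lemma proj_onto_bounded:
  assumes H: "closed_subspace M H"
  shows "bounded_op M (L2 M) M H (proj_onto M H)"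
  unfolding bounded_op_def
proof (intro conjI ballI allI impI)
  note p = proj_onto_props[OF H] and Hd = linear_subspaceD[OF closed_subspace_linear[OF H]]
  have pL: "proj_onto M H f \<in> L2 M" if "f \<in> L2 M" for f by (rule Hd(1)[OF p(1)[OF that]])
  fix f assume f: "f \<in> L2 M"
  show "proj_onto M H f \<in> H" by (rule p(1)[OF f])
  show "ae_eq M (proj_onto M H f) (proj_onto M H g)" if g: "g \<in> L2 M" and fg: "ae_eq M f g" for g
  proof (rule proj_onto_unique[OF H f p(1)[OF g]])
    fix h assume h: "h \<in> H"
    have "L2_inner M (\<lambda>x. f x - proj_onto M H g x) h = L2_inner M (\<lambda>x. g x - proj_onto M H g x) h"
      by (rule L2_inner_cong_ae[OF L2_diff[OF f pL[OF g]] Hd(1)[OF h] L2_diff[OF g pL[OF g]] Hd(1)[OF h]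
            ae_eq_diff[OF fg ae_eq_refl] ae_eq_refl])
    then show "L2_inner M (\<lambda>x. f x - proj_onto M H g x) h = 0" using p(2)[OF g h] by simp
  qed
  show "ae_eq M (proj_onto M H (\<lambda>x. f x + g x)) (\<lambda>y. proj_onto M H f y + proj_onto M H g y)"
    if g: "g \<in> L2 M" for g
  proof (rule proj_onto_unique[OF H L2_add[OF f g] Hd(3)[OF p(1)[OF f] p(1)[OF g]]])
    fix h assume h: "h \<in> H"
    have "L2_inner M (\<lambda>x. (f x - proj_onto M H f x) + (g x - proj_onto M H g x)) h = 0"
      using L2_inner_add_left[OF L2_diff[OF f pL[OF f]] L2_diff[OF g pL[OF g]] Hd(1)[OF h]]
        p(2)[OF f h] p(2)[OF g h] by simp
    then show "L2_inner M (\<lambda>x. f x + g x - (proj_onto M H f x + proj_onto M H g x)) h = 0"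
      by (simp add: algebra_simps)
  qed
  show "ae_eq M (proj_onto M H (\<lambda>x. c * f x)) (\<lambda>y. c * proj_onto M H f y)" for c
  proof (rule proj_onto_unique[OF H L2_scale[OF f] Hd(4)[OF p(1)[OF f]]])
    fix h assume h: "h \<in> H"
    have "L2_inner M (\<lambda>x. c * (f x - proj_onto M H f x)) h = 0"
      unfolding L2_inner_scale_left using p(2)[OF f h] by simp
    then show "L2_inner M (\<lambda>x. c * f x - c * proj_onto M H f x) h = 0"
      by (simp add: algebra_simps)
  qed
next
  note p = proj_onto_props[OF H] and Hd = linear_subspaceD[OF closed_subspace_linear[OF H]]
  have "L2_norm M (proj_onto M H f) \<le> 1 * L2_norm M f" if f: "f \<in> L2 M" for f
  proof -
    let ?p = "proj_onto M H f"
    have pL: "?p \<in> L2 M" by (rule Hd(1)[OF p(1)[OF f]])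
    have "(L2_norm M (\<lambda>x. (f x - ?p x) + ?p x))\<^sup>2 = (L2_norm M (\<lambda>x. f x - ?p x))\<^sup>2 + (L2_norm M ?p)\<^sup>2"
      using L2_norm_add_square[OF L2_diff[OF f pL] pL] p(2)[OF f p(1)[OF f]] by simp
    then have "(L2_norm M ?p)\<^sup>2 \<le> (L2_norm M f)\<^sup>2" by simp
    then show ?thesis using power2_le_imp_le L2_norm_nonneg by simp
  qed
  then show "\<exists>C. \<forall>f\<in>L2 M. L2_norm M (proj_onto M H f) \<le> C * L2_norm M f" by blast
qed

lemma bounded_op_tendsto:
  assumes Q: "bounded_op M H N K Q" and H: "linear_subspace M H" and K: "K \<subseteq> L2 N"
    and s: "\<And>n::nat. s n \<in> H" "f \<in> H" "L2_lim M s f"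
  shows "(\<lambda>n. L2_norm N (\<lambda>x. Q (s n) x - Q f x)) \<longlonglongrightarrow> 0"
proof -
  obtain C where C: "C \<ge> 0" "\<And>f. f \<in> H \<Longrightarrow> L2_norm N (Q f) \<le> C * L2_norm M f"
    using bounded_op_bound[OF Q] by blast
  have "norm (L2_norm N (\<lambda>x. Q (s n) x - Q f x)) \<le> C * L2_norm M (\<lambda>x. s n x - f x)" for n
  proof -
    have d: "(\<lambda>x. s n x - f x) \<in> H" by (rule linear_subspaceD(5)[OF H s(1,2)])
    have QL: "Q g \<in> L2 N" if "g \<in> H" for g using bounded_opD(1)[OF Q that] K by blast
    have "L2_norm N (\<lambda>x. Q (s n) x - Q f x) = L2_norm N (Q (\<lambda>x. s n x - f x))"
      by (rule L2_norm_cong_ae[OF L2_diff[OF QL[OF s(1)] QL[OF s(2)]] QL[OF d] ae_eq_sym[OF bounded_op_diff[OF Q H s(1,2)]]])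
    then show ?thesis using C(2)[OF d] by simp
  qed
  then show ?thesis
    by (rule Lim_null_comparison[OF always_eventually[OF allI] tendsto_mult_right_zero[OF s(3)]])
qed

lemma bounded_op_agree:
  assumes S: "bounded_op M H N L S" and T: "bounded_op M H N L T"
    and H: "linear_subspace M H" and L: "L \<subseteq> L2 N"
    and K: "K \<subseteq> H" "\<And>f. f \<in> H \<Longrightarrow> \<exists>s. (\<forall>n. s n \<in> K) \<and> L2_lim M s f"
    and agree: "\<And>k. k \<in> K \<Longrightarrow> ae_eq N (S k) (T k)" and f: "f \<in> H"
  shows "ae_eq N (S f) (T f)"
proof -
  obtain s where s: "\<And>n. s n \<in> K" "L2_lim M s f" using K(2)[OF f] by blast
  have sH: "s n \<in> H" for n using s(1) K(1) by blast
  have SL: "S g \<in> L2 N" and TL: "T g \<in> L2 N" if "g \<in> H" for g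
    using bounded_opD(1)[OF S that] bounded_opD(1)[OF T that] L by auto
  show ?thesis
    by (rule L2_lim_unique[OF SL[OF sH] SL[OF f] bounded_op_tendsto[OF S H L sH f s(2)]
          TL[OF sH] TL[OF f] bounded_op_tendsto[OF T H L sH f s(2)] agree[OF s(1)]])
qed

text \<open>The functions on which \<open>S\<close> and \<open>T\<close> agree form a linear
  subspace containing \<open>K\<close>. Totality of \<open>K\<close> makes it dense, and continuity
  does the rest.\<close>

lemma bounded_op_agree_if_total:
  assumes S: "bounded_op M (L2 M) N (L2 N) S" and T: "bounded_op M (L2 M) N (L2 N) T"
    and K: "K \<subseteq> L2 M" "\<And>h. h \<in> L2 M \<Longrightarrow> (\<And>k. k \<in> K \<Longrightarrow> L2_inner M k h = 0) \<Longrightarrow> ae_eq M h (\<lambda>x. 0)"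
    and agree: "\<And>k. k \<in> K \<Longrightarrow> ae_eq N (S k) (T k)" and f: "f \<in> L2 M"
  shows "ae_eq N (S f) (T f)"
proof (rule bounded_op_agree[OF S T linear_subspace_L2 subset_refl _ _ _ f])
  let ?C = "{f \<in> L2 M. ae_eq N (S f) (T f)}"
  have C: "linear_subspace M ?C"
    unfolding linear_subspace_def
  proof (intro conjI ballI allI)
    \<comment> \<open>The alternative \<open>c = 0\<close> asks nothing of \<open>g\<close>:
      homogeneity alone makes the images of the zero function null, which places it in
      \<open>?C\<close>.\<close>
    have scale: "(\<lambda>x. c * g x) \<in> ?C" if "g \<in> L2 M" "c = 0 \<or> g \<in> ?C" for c g
    proof -
      have "ae_eq N (\<lambda>x. c * S g x) (\<lambda>x. c * T g x)"
        using that(2) ae_eq_mult by auto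
      then show ?thesis
        using L2_scale[OF that(1)] ae_eq_trans[OF ae_eq_trans[OF bounded_opD(4)[OF S that(1)]]
          ae_eq_sym[OF bounded_opD(4)[OF T that(1)]]] by blast
    qed
    show "(\<lambda>x. c * g x) \<in> ?C" if "g \<in> ?C" for c g using that by (intro scale) auto
    show "(\<lambda>x. 0) \<in> ?C" using scale[OF L2_zero, of 0] by simp
    fix g h assume "g \<in> ?C" "h \<in> ?C"
    then have g: "g \<in> L2 M" "ae_eq N (S g) (T g)" and h: "h \<in> L2 M" "ae_eq N (S h) (T h)" by auto
    show "(\<lambda>x. g x + h x) \<in> ?C"
      using L2_add[OF g(1) h(1)] ae_eq_trans[OF ae_eq_trans[OF bounded_opD(3)[OF S g(1) h(1)] ae_eq_add[OF g(2) h(2)]]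
          ae_eq_sym[OF bounded_opD(3)[OF T g(1) h(1)]]] by blast
  qed blast
  have KC: "K \<subseteq> ?C" using K(1) agree by blast
  show "\<exists>s. (\<forall>n. s n \<in> ?C) \<and> L2_lim M s g" if "g \<in> L2 M" for g
    by (rule dense_if_total[OF C _ that]) (use K(2) KC in blast)
qed auto

text \<open>A relation takes the place of a map because one function has many expressions as a sum
  of tensors, whose images might differ. Isometry shows that the images agree almost everywhere, so
  the closure of the graph is again the graph of an isometry, now defined on all of
  \<open>L2 M\<close>.\<close>

theorem isometric_relation_extends:
  fixes R :: "('a \<Rightarrow> complex) \<Rightarrow> ('b \<Rightarrow> complex) \<Rightarrow> bool"
  assumes RL: "\<And>f k. R f k \<Longrightarrow> f \<in> L2 M \<and> k \<in> L2 N"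
    and Radd: "\<And>f k f' k'. R f k \<Longrightarrow> R f' k' \<Longrightarrow> R (\<lambda>x. f x + f' x) (\<lambda>y. k y + k' y)"
    and Rscale: "\<And>c f k. R f k \<Longrightarrow> R (\<lambda>x. c * f x) (\<lambda>y. c * k y)"
    and iso: "\<And>f k f' k'. R f k \<Longrightarrow> R f' k' \<Longrightarrow> L2_inner N k k' = L2_inner M f f'"
    and dense: "\<And>f. f \<in> L2 M \<Longrightarrow> \<exists>s. (\<forall>n. \<exists>k. R (s n) k) \<and> L2_lim M s f"
  shows "\<exists>S. bounded_op M (L2 M) N (L2 N) S \<and> (\<forall>f k. R f k \<longrightarrow> ae_eq N (S f) k) \<and>
           (\<forall>f\<in>L2 M. \<forall>g\<in>L2 M. L2_inner N (S f) (S g) = L2_inner M f g)"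
proof -
  \<comment> \<open>\<open>P\<close> will be the closure of the graph \<open>R\<close>;
    \<open>Q\<close> also records the two sequences by which a pair is reached, so that sums,
    multiples and inner products pass to the limit.\<close>
  define Q where "Q s t f k \<longleftrightarrow> f \<in> L2 M \<and> k \<in> L2 N \<and> (\<forall>n. R (s n) (t n)) \<and> L2_lim M s f \<and> L2_lim N t k" for s t f k
  define P where "P f k \<longleftrightarrow> (\<exists>s t. Q s t f k)" for f k
  have Qd: "f \<in> L2 M" "k \<in> L2 N" "R (s n) (t n)" "s n \<in> L2 M" "t n \<in> L2 N" "L2_lim M s f" "L2_lim N t k"
    if "Q s t f k" for s t f k n
    using that RL[of "s n" "t n"] unfolding Q_def by auto
  have PL: "f \<in> L2 M" "k \<in> L2 N" if "P f k" for f k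
    using that Qd(1,2) unfolding P_def by blast+
  have PR: "P f k" if "R f k" for f k
    unfolding P_def Q_def using that RL[OF that] by (auto intro!: exI[of _ "\<lambda>_. f"] exI[of _ "\<lambda>_. k"])
  have Piso: "L2_inner N k k' = L2_inner M f f'" if "P f k" "P f' k'" for f k f' k'
  proof -
    from that obtain s t s' t' where q: "Q s t f k" "Q s' t' f' k'" unfolding P_def by blast
    note 1 = Qd[OF q(1)] and 2 = Qd[OF q(2)]
    show ?thesis
      using L2_inner_tendsto[OF 1(4,1,6) 2(4,1,6)] L2_inner_tendsto[OF 1(5,2,7) 2(5,2,7)]
      unfolding iso[OF 1(3) 2(3)] by (rule LIMSEQ_unique[rotated])
  qed
  have Padd: "P (\<lambda>x. f x + f' x) (\<lambda>y. k y + k' y)" if "P f k" "P f' k'" for f k f' k'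
  proof -
    from that obtain s t s' t' where q: "Q s t f k" "Q s' t' f' k'" unfolding P_def by blast
    note 1 = Qd[OF q(1)] and 2 = Qd[OF q(2)]
    show ?thesis unfolding P_def Q_def
      by (intro conjI exI[of _ "\<lambda>n x. s n x + s' n x"] exI[of _ "\<lambda>n x. t n x + t' n x"] allI Radd[OF 1(3) 2(3)]
            L2_add[OF 1(1) 2(1)] L2_add[OF 1(2) 2(2)] L2_lim_add[OF 1(4,1,6) 2(4,1,6)] L2_lim_add[OF 1(5,2,7) 2(5,2,7)])
  qed
  have Pscale: "P (\<lambda>x. c * f x) (\<lambda>y. c * k y)" if "P f k" for c f k
  proof -
    from that obtain s t where q: "Q s t f k" unfolding P_def by blast
    note 1 = Qd[OF q]
    show ?thesis unfolding P_def Q_def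
      by (intro conjI exI[of _ "\<lambda>n x. c * s n x"] exI[of _ "\<lambda>n x. c * t n x"] allI Rscale[OF 1(3)]
            L2_scale[OF 1(1)] L2_scale[OF 1(2)] L2_lim_scale[OF 1(6)] L2_lim_scale[OF 1(7)])
  qed
  have Pdiff_norm: "L2_norm N (\<lambda>y. k y - k' y) = L2_norm M (\<lambda>x. f x - f' x)" if "P f k" "P f' k'" for f k f' k'
  proof -
    have "P (\<lambda>x. f x - f' x) (\<lambda>y. k y - k' y)" using Padd[OF that(1) Pscale[OF that(2), of "-1"]] by simp
    from Piso[OF this this] show ?thesis
      unfolding L2_inner_self by (simp add: power2_eq_iff_nonneg flip: of_real_power)
  qed
  have Puniq: "ae_eq N k k'" if "P f k" "P f' k'" "ae_eq M f f'" for f k f' k'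
    using Pdiff_norm[OF that(1,2)] that(3) ae_eq_iff_L2_norm[OF PL(1)[OF that(1)] PL(1)[OF that(2)]]
      ae_eq_iff_L2_norm[OF PL(2)[OF that(1)] PL(2)[OF that(2)]] by simp
  have Pex: "\<exists>k. P f k" if f: "f \<in> L2 M" for f
  proof -
    obtain s t where R: "\<And>n. R (s n) (t n)" and lim: "L2_lim M s f" using dense[OF f] by metis
    have L: "s n \<in> L2 M" "t n \<in> L2 N" for n using RL[OF R] by auto
    obtain k where k: "k \<in> L2 N" "L2_lim N t k"
    proof (rule L2_complete[OF L(2)])
      fix e :: real assume "e > 0"
      then obtain K where K: "\<And>n. n \<ge> K \<Longrightarrow> L2_norm M (\<lambda>x. s n x - f x) < e/2"
        using LIMSEQ_D[OF lim, of "e/2"] by auto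
      have "L2_norm N (\<lambda>x. t m x - t n x) < e" if "m \<ge> K" "n \<ge> K" for m n
        using L2_norm_triangle3[OF L(1)[of m] f L(1)[of n]] K[OF that(1)] K[OF that(2)]
          L2_norm_minus_commute[of M f] by (simp add: Pdiff_norm[OF PR[OF R] PR[OF R]])
      then show "\<exists>N'. \<forall>m\<ge>N'. \<forall>n\<ge>N'. L2_norm N (\<lambda>x. t m x - t n x) < e" by blast
    qed
    show ?thesis unfolding P_def Q_def using f k R lim by blast
  qed
  define S where "S f = (SOME k. P f k)" for f
  have S: "P f (S f)" if "f \<in> L2 M" for f
    unfolding S_def using someI_ex[OF Pex[OF that]] .
  have "bounded_op M (L2 M) N (L2 N) S"
    unfolding bounded_op_def
  proof (intro conjI ballI allI impI)
    have "L2_norm N (S f) = L2_norm M f" if "f \<in> L2 M" for f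
      using Piso[OF S[OF that] S[OF that]] unfolding L2_inner_self
      by (simp add: power2_eq_iff_nonneg flip: of_real_power)
    then show "\<exists>C. \<forall>f\<in>L2 M. L2_norm N (S f) \<le> C * L2_norm M f"
      by (intro exI[of _ 1]) simp
    fix f assume f: "f \<in> L2 M"
    show "S f \<in> L2 N" by (rule PL(2)[OF S[OF f]])
    show "ae_eq N (S f) (S g)" if "g \<in> L2 M" "ae_eq M f g" for g
      by (rule Puniq[OF S[OF f] S[OF that(1)] that(2)])
    show "ae_eq N (S (\<lambda>x. f x + g x)) (\<lambda>y. S f y + S g y)" if g: "g \<in> L2 M" for g
      by (rule Puniq[OF S[OF L2_add[OF f g]] Padd[OF S[OF f] S[OF g]] ae_eq_refl])
    show "ae_eq N (S (\<lambda>x. c * f x)) (\<lambda>y. c * S f y)" for c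
      by (rule Puniq[OF S[OF L2_scale[OF f]] Pscale[OF S[OF f]] ae_eq_refl])
  qed
  moreover have "ae_eq N (S f) k" if "R f k" for f k
    by (rule Puniq[OF S PR[OF that] ae_eq_refl]) (use RL[OF that] in simp)
  ultimately show ?thesis using Piso[OF S S] by blast
qed

section \<open>Orthonormal bases, well-definedness of the dimension, and the case of dimension at
  most one\<close>

section \<open>Hilbert dimension\<close>

definition orthonormal :: "'a measure \<Rightarrow> ('a \<Rightarrow> complex) set \<Rightarrow> bool" where
  "orthonormal M B \<longleftrightarrow> (\<forall>f\<in>B. \<forall>g\<in>B. L2_inner M f g = (if f = g then 1 else 0))"

lemma orthonormalD: "orthonormal M B \<Longrightarrow> f \<in> B \<Longrightarrow> g \<in> B \<Longrightarrow> L2_inner M f g = (if f = g then 1 else 0)"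
  unfolding orthonormal_def by blast

lemma orthonormal_basisD:
  assumes "orthonormal_basis M H B"
  shows "B \<subseteq> H" "orthonormal M B"
    "\<And>h. h \<in> H \<Longrightarrow> (\<And>b. b \<in> B \<Longrightarrow> L2_inner M h b = 0) \<Longrightarrow> ae_eq M h (\<lambda>x. 0)"
  using assms unfolding orthonormal_basis_def orthonormal_def by blast+

lemma L2_normalize:
  assumes "f \<in> L2 M" "L2_norm M f \<noteq> 0"
  shows "L2_inner M (\<lambda>x. of_real (1 / L2_norm M f) * f x) (\<lambda>x. of_real (1 / L2_norm M f) * f x) = 1"
  unfolding L2_inner_scale_left L2_inner_scale_right L2_inner_self
  using assms(2) by (simp add: power2_eq_square)

lemma linear_subspace_sum:
  assumes "linear_subspace M H" "finite B" "B \<subseteq> H"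
  shows "(\<lambda>x. \<Sum>b\<in>B. c b * b x) \<in> H"
  using assms(2,3)
proof (induction B)
  case empty
  then show ?case using linear_subspaceD(2)[OF assms(1)] by simp
next
  case (insert b B)
  then have "(\<lambda>x. c b * b x + (\<Sum>b\<in>B. c b * b x)) \<in> H"
    by (intro linear_subspaceD(3,4)[OF assms(1)]) auto
  then show ?case using insert by simp
qed

lemma L2_inner_sum_left:
  assumes "finite B" "B \<subseteq> L2 M" "h \<in> L2 M"
  shows "L2_inner M (\<lambda>x. \<Sum>b\<in>B. c b * b x) h = (\<Sum>b\<in>B. c b * L2_inner M b h)"
  using assms(1,2)
proof (induction B)
  case (insert b B)
  have "linear_subspace M (L2 M)" by (intro closed_subspace_linear closed_subspace_L2)
  then have "(\<lambda>x. \<Sum>b\<in>B. c b * b x) \<in> L2 M"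
    using insert by (intro linear_subspace_sum) auto
  then have "L2_inner M (\<lambda>x. c b * b x + (\<Sum>b\<in>B. c b * b x)) h
      = L2_inner M (\<lambda>x. c b * b x) h + L2_inner M (\<lambda>x. \<Sum>b\<in>B. c b * b x) h"
    using insert assms(3) by (intro L2_inner_add_left L2_scale) auto
  then show ?case using insert by (simp add: L2_inner_scale_left)
qed simp

text \<open>Pythagoras for the projection onto the span of \<open>B\<close>. The third part is
  Bessel's inequality once the remainder is dropped, and Parseval's identity when \<open>B\<close>
  is a basis.\<close>

lemma Bessel_decomposition:
  assumes H: "linear_subspace M H" and B: "finite B" "B \<subseteq> H" "orthonormal M B" and h: "h \<in> H"
  defines "q \<equiv> \<lambda>x. h x - (\<Sum>b\<in>B. L2_inner M h b * b x)"
  shows "q \<in> H" "\<And>b. b \<in> B \<Longrightarrow> L2_inner M q b = 0"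
    "(L2_norm M h)\<^sup>2 = (L2_norm M q)\<^sup>2 + (\<Sum>b\<in>B. (cmod (L2_inner M h b))\<^sup>2)"
proof -
  define p where "p = (\<lambda>x. \<Sum>b\<in>B. L2_inner M h b * b x)"
  have BL: "B \<subseteq> L2 M" and hL: "h \<in> L2 M" using B h linear_subspaceD(1)[OF H] by auto
  have p: "p \<in> H" unfolding p_def by (rule linear_subspace_sum[OF H B(1,2)])
  then have pL: "p \<in> L2 M" by (rule linear_subspaceD(1)[OF H])
  have q: "q = (\<lambda>x. h x - p x)" by (simp add: q_def p_def)
  show qH: "q \<in> H" unfolding q by (rule linear_subspaceD(5)[OF H h p])
  then have qL: "q \<in> L2 M" by (rule linear_subspaceD(1)[OF H])
  show orth: "L2_inner M q b = 0" if b: "b \<in> B" for b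
  proof -
    have "L2_inner M p b = (\<Sum>a\<in>B. L2_inner M h a * L2_inner M a b)"
      unfolding p_def using BL b by (intro L2_inner_sum_left[OF B(1)]) auto
    also have "\<dots> = (\<Sum>a\<in>B. if a = b then L2_inner M h a else 0)"
      using b by (intro sum.cong refl) (simp add: orthonormalD[OF B(3)])
    also have "\<dots> = L2_inner M h b" using b B(1) by simp
    finally show ?thesis unfolding q using BL b hL pL by (subst L2_inner_diff_left) auto
  qed
  have pf: "L2_inner M p f = (\<Sum>b\<in>B. L2_inner M h b * L2_inner M b f)" if "f \<in> L2 M" for f
    unfolding p_def by (rule L2_inner_sum_left[OF B(1) BL that])
  have "L2_inner M p q = 0"
    unfolding pf[OF qL] using orth L2_inner_commute[of M _ q] by (intro sum.neutral) auto
  then have qp: "L2_inner M q p = 0" using L2_inner_commute[of M q p] by simp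
  have "h = (\<lambda>x. q x + p x)" by (auto simp: q)
  then have hh: "(L2_norm M h)\<^sup>2 = (L2_norm M q)\<^sup>2 + (L2_norm M p)\<^sup>2"
    using L2_norm_add_square[OF qL pL] qp by simp
  have "L2_inner M p p = L2_inner M p (\<lambda>x. h x - q x)" by (simp add: q)
  also have "\<dots> = L2_inner M p h"
    using L2_inner_diff_right[OF hL qL pL] \<open>L2_inner M p q = 0\<close> by simp
  also have "\<dots> = (\<Sum>b\<in>B. of_real ((cmod (L2_inner M h b))\<^sup>2))"
    unfolding pf[OF hL] complex_norm_square using L2_inner_commute[of M _ h] by simp
  also have "\<dots> = of_real (\<Sum>b\<in>B. (cmod (L2_inner M h b))\<^sup>2)" by simp
  finally have "(L2_norm M p)\<^sup>2 = (\<Sum>b\<in>B. (cmod (L2_inner M h b))\<^sup>2)"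
    unfolding L2_inner_self of_real_eq_iff .
  with hh show "(L2_norm M h)\<^sup>2 = (L2_norm M q)\<^sup>2 + (\<Sum>b\<in>B. (cmod (L2_inner M h b))\<^sup>2)" by simp
qed

text \<open>Double counting \<open>\<Sum>\<^sub>a \<Sum>\<^sub>b |\<langle>a, b\<rangle>|\<^sup>2\<close> with Parseval in one order and Bessel in the other.\<close>

lemma orthonormal_card_le_basis:
  assumes H: "linear_subspace M H" and B: "orthonormal_basis M H B" "finite B"
    and A: "A \<subseteq> H" "orthonormal M A"
  shows "finite A \<and> card A \<le> card B"
proof -
  note Bd = orthonormal_basisD[OF B(1)]
  have L: "f \<in> H \<Longrightarrow> f \<in> L2 M" for f by (rule linear_subspaceD(1)[OF H])
  have unit: "(L2_norm M f)\<^sup>2 = 1" if "f \<in> C" "orthonormal M C" for f C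
    using orthonormalD[OF that(2,1,1)] unfolding L2_inner_self by (metis of_real_eq_1_iff)
  \<comment> \<open>Counting is done for finite subsets; this afterwards rules out an infinite
    \<open>A\<close>.\<close>
  have card: "card A' \<le> card B" if A': "A' \<subseteq> A" "finite A'" for A'
  proof -
    have on: "orthonormal M A'" using A(2) A'(1) unfolding orthonormal_def by blast
    have parseval: "(\<Sum>b\<in>B. (cmod (L2_inner M a b))\<^sup>2) = 1" if a: "a \<in> A'" for a
    proof -
      have aH: "a \<in> H" using a A' A by auto
      note bd = Bessel_decomposition[OF H B(2) Bd(1,2) aH]
      have "ae_eq M (\<lambda>x. a x - (\<Sum>b\<in>B. L2_inner M a b * b x)) (\<lambda>x. 0)"
        using bd(1,2) by (rule Bd(3))
      then have "L2_norm M (\<lambda>x. a x - (\<Sum>b\<in>B. L2_inner M a b * b x)) = 0"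
        using L2_norm_eq_0_iff[OF L[OF bd(1)]] by blast
      then show ?thesis using bd(3) unit[OF a on] by simp
    qed
    have bessel: "(\<Sum>a\<in>A'. (cmod (L2_inner M b a))\<^sup>2) \<le> 1" if b: "b \<in> B" for b
    proof -
      have "A' \<subseteq> H" "b \<in> H" using b A' A Bd(1) by auto
      from Bessel_decomposition(3)[OF H A'(2) this(1) on this(2)] show ?thesis
        unfolding unit[OF b Bd(2)] using zero_le_power2 by (smt (verit))
    qed
    have "real (card A') = (\<Sum>a\<in>A'. \<Sum>b\<in>B. (cmod (L2_inner M a b))\<^sup>2)"
      by (simp add: parseval)
    also have "\<dots> = (\<Sum>b\<in>B. \<Sum>a\<in>A'. (cmod (L2_inner M a b))\<^sup>2)" by (rule sum.swap)
    also have "\<dots> = (\<Sum>b\<in>B. \<Sum>a\<in>A'. (cmod (L2_inner M b a))\<^sup>2)"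
      by (intro sum.cong refl) (metis L2_inner_commute complex_mod_cnj)
    also have "\<dots> \<le> (\<Sum>b\<in>B. 1)" by (intro sum_mono bessel)
    finally show ?thesis by simp
  qed
  have "finite A"
  proof (rule ccontr)
    assume "infinite A"
    then obtain A' where "A' \<subseteq> A" "finite A'" "card A' = Suc (card B)"
      using infinite_arbitrarily_large by metis
    then show False using card[of A'] by simp
  qed
  then show ?thesis using card by blast
qed

text \<open>Zorn's lemma gives a maximal orthonormal set. A nonzero vector orthogonal to all its
  members could be normalised and added.\<close>

lemma orthonormal_basis_exists:
  assumes H: "linear_subspace M H"
  shows "\<exists>B. orthonormal_basis M H B"
proof -
  let ?A = "{B. B \<subseteq> H \<and> orthonormal M B}"
  have "\<exists>B\<in>?A. \<forall>X\<in>?A. B \<subseteq> X \<longrightarrow> X = B"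
  proof (rule subset_Zorn')
    fix C assume C: "subset.chain ?A C"
    have "L2_inner M f g = (if f = g then 1 else 0)" if "f \<in> \<Union>C" "g \<in> \<Union>C" for f g
    proof -
      obtain X Z where XZ: "X \<in> C" "f \<in> X" "Z \<in> C" "g \<in> Z" using \<open>f \<in> \<Union>C\<close> \<open>g \<in> \<Union>C\<close> by blast
      have "X \<subseteq> Z \<or> Z \<subseteq> X" using C XZ unfolding subset_chain_def by blast
      moreover have "orthonormal M X" "orthonormal M Z" using C XZ unfolding subset_chain_def by auto
      ultimately show ?thesis using XZ orthonormalD by (metis subsetD)
    qed
    then have "orthonormal M (\<Union>C)" unfolding orthonormal_def by blast
    moreover have "\<Union>C \<subseteq> H" using C unfolding subset_chain_def by blast
    ultimately show "\<Union>C \<in> ?A" by blast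
  qed
  then obtain B where "B \<in> ?A" and B_max: "\<forall>X\<in>?A. B \<subseteq> X \<longrightarrow> X = B"
    by (rule bexE)
  then have B: "B \<subseteq> H" "orthonormal M B" by auto
  have max: "X = B" if "X \<subseteq> H" "orthonormal M X" "B \<subseteq> X" for X
    using B_max that by simp
  have "ae_eq M h (\<lambda>x. 0)" if h: "h \<in> H" and orth: "\<forall>b\<in>B. L2_inner M h b = 0" for h
  proof (rule ccontr)
    assume "\<not> ae_eq M h (\<lambda>x. 0)"
    then have n: "L2_norm M h \<noteq> 0" using L2_norm_eq_0_iff linear_subspaceD(1)[OF H h] by blast
    define u where "u = (\<lambda>x. of_real (1 / L2_norm M h) * h x)"
    have uH: "u \<in> H" unfolding u_def by (rule linear_subspaceD(4)[OF H h])
    have uu: "L2_inner M u u = 1"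
      unfolding u_def using linear_subspaceD(1)[OF H h] n by (rule L2_normalize)
    have ub: "L2_inner M u b = 0" if "b \<in> B" for b
      using orth that unfolding u_def L2_inner_scale_left by simp
    have bu: "L2_inner M b u = 0" if "b \<in> B" for b
      using ub[OF that] L2_inner_commute[of M b u] by simp
    have "u \<notin> B" using ub[of u] uu by auto
    have "orthonormal M (insert u B)"
      unfolding orthonormal_def
    proof (intro ballI)
      fix f g assume "f \<in> insert u B" "g \<in> insert u B"
      then show "L2_inner M f g = (if f = g then 1 else 0)"
        using ub bu uu orthonormalD[OF B(2), of f g] \<open>u \<notin> B\<close>
        by (cases "f = u"; cases "g = u") auto
    qed
    then have "insert u B = B" using uH B(1) by (intro max) auto
    then show False using \<open>u \<notin> B\<close> by blast
  qed
  then show ?thesis using B unfolding orthonormal_basis_def orthonormal_def by blast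
qed

text \<open>Gives meaning to the \<open>THE\<close> in \<open>hilbert_dim\<close>: two bases are
  either both infinite, with common value \<open>\<infinity>\<close>, or both finite and of equal
  size, by the counting lemma used in both directions.\<close>

lemma hilbert_dim_eq:
  assumes H: "linear_subspace M H" and B: "orthonormal_basis M H B"
  shows "hilbert_dim M H = (if finite B then enat (card B) else \<infinity>)"
  unfolding hilbert_dim_def
proof (rule the_equality)
  fix d assume "\<exists>B. orthonormal_basis M H B \<and> d = (if finite B then enat (card B) else \<infinity>)"
  then obtain A where A: "orthonormal_basis M H A" "d = (if finite A then enat (card A) else \<infinity>)" by blast
  note Ad = orthonormal_basisD[OF A(1)] and Bd = orthonormal_basisD[OF B]
  have "finite A \<longleftrightarrow> finite B"
    using orthonormal_card_le_basis[OF H A(1) _ Bd(1,2)] orthonormal_card_le_basis[OF H B _ Ad(1,2)] by blast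
  moreover have "card A = card B" if "finite A" "finite B"
    using orthonormal_card_le_basis[OF H A(1) that(1) Bd(1,2)]
      orthonormal_card_le_basis[OF H B that(2) Ad(1,2)] by simp
  ultimately show "d = (if finite B then enat (card B) else \<infinity>)" using A(2) by simp
qed (use B in blast)

text \<open>Absence of an orthonormal pair is a condition on inner products of single vectors. It
  can be verified by approximation, without choosing a basis in each fibre.\<close>

lemma hilbert_dim_le_one_iff:
  assumes H: "linear_subspace M H"
  shows "(0 < hilbert_dim M H \<longrightarrow> hilbert_dim M H = 1) \<longleftrightarrow>
    (\<forall>x\<in>H. \<forall>y\<in>H. L2_inner M x x = 1 \<longrightarrow> L2_inner M y y = 1 \<longrightarrow> L2_inner M x y \<noteq> 0)"
proof -
  obtain B where B: "orthonormal_basis M H B" using orthonormal_basis_exists[OF H] by blast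
  note Bd = orthonormal_basisD[OF B] and dim = hilbert_dim_eq[OF H B]
  have dim1: "(0 < hilbert_dim M H \<longrightarrow> hilbert_dim M H = 1) \<longleftrightarrow> finite B \<and> card B \<le> 1"
    by (auto simp: dim one_enat_def zero_enat_def le_Suc_eq)
  show ?thesis unfolding dim1
  proof (intro iffI ballI impI notI)
    fix x y assume fin: "finite B \<and> card B \<le> 1" and xy: "x \<in> H" "y \<in> H" "L2_inner M x x = 1"
      "L2_inner M y y = 1" "L2_inner M x y = 0"
    have yx: "L2_inner M y x = 0" using xy(5) L2_inner_commute[of M y x] by simp
    have "x \<noteq> y" using xy by auto
    have "orthonormal M {x, y}" unfolding orthonormal_def using xy yx by auto
    then have "card {x, y} \<le> card B" using orthonormal_card_le_basis[OF H B, of "{x, y}"] fin xy by auto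
    then show False using fin \<open>x \<noteq> y\<close> by simp
  next
    assume *: "\<forall>x\<in>H. \<forall>y\<in>H. L2_inner M x x = 1 \<longrightarrow> L2_inner M y y = 1 \<longrightarrow> L2_inner M x y \<noteq> 0"
    have eq: "x = y" if "x \<in> B" "y \<in> B" for x y
      using * that Bd(1) orthonormalD[OF Bd(2)] by (metis subsetD)
    then have "B \<subseteq> {b}" if "b \<in> B" for b using that by blast
    then have "B = {} \<or> (\<exists>b. B = {b})" by blast
    then show "finite B \<and> card B \<le> 1" by auto
  qed
qed

text \<open>The vector \<open>q\<close> is the Gram-Schmidt remainder of \<open>y\<close> against
  \<open>x\<close> with denominators cleared, hence orthogonal to \<open>x\<close>. Were it not
  null, \<open>x\<close> and \<open>q\<close> could be normalised to an orthonormal pair.\<close>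

lemma no_orthonormal_pair_collinear:
  assumes H: "linear_subspace M H"
    and no_pair: "\<And>x y. x \<in> H \<Longrightarrow> y \<in> H \<Longrightarrow> L2_inner M x x = 1 \<Longrightarrow> L2_inner M y y = 1 \<Longrightarrow> L2_inner M x y \<noteq> 0"
    and xy: "x \<in> H" "y \<in> H"
  shows "ae_eq M (\<lambda>v. L2_inner M x x * y v) (\<lambda>v. L2_inner M y x * x v)"
proof (rule ccontr)
  assume ne: "\<not> ?thesis"
  note lin = linear_subspaceD[OF H]
  define q where "q = (\<lambda>v. L2_inner M x x * y v - L2_inner M y x * x v)"
  have q: "q \<in> H" unfolding q_def by (intro lin(4,5) xy)
  have "L2_inner M q x = L2_inner M x x * L2_inner M y x - L2_inner M y x * L2_inner M x x"
    unfolding q_def using lin(1) xy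
    by (subst L2_inner_diff_left) (auto simp: L2_scale L2_inner_scale_left)
  then have qx: "L2_inner M q x = 0" by simp
  then have xq: "L2_inner M x q = 0" using L2_inner_commute[of M x q] by simp
  have nq: "L2_norm M q \<noteq> 0"
    using ne ae_eq_iff_L2_norm[OF L2_scale[OF lin(1)[OF xy(2)]] L2_scale[OF lin(1)[OF xy(1)]]]
    unfolding q_def by blast
  \<comment> \<open>For a null \<open>x\<close> both coefficients vanish, so the assumed failure of
    the claim excludes it.\<close>
  have nx: "L2_norm M x \<noteq> 0"
  proof
    assume 0: "L2_norm M x = 0"
    then have "L2_inner M x x = 0" by (simp add: L2_inner_self)
    moreover have "L2_inner M y x = 0"
      using L2_Cauchy_Schwarz[OF lin(1)[OF xy(2)] lin(1)[OF xy(1)]] 0 by simp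
    ultimately show False using ne by simp
  qed
  let ?x = "\<lambda>v. of_real (1 / L2_norm M x) * x v" and ?q = "\<lambda>v. of_real (1 / L2_norm M q) * q v"
  have "L2_inner M ?x ?q = 0"
    unfolding L2_inner_scale_left L2_inner_scale_right xq by simp
  moreover have "L2_inner M ?x ?x = 1" using nx lin(1)[OF xy(1)] by (intro L2_normalize)
  moreover have "L2_inner M ?q ?q = 1" using nq lin(1)[OF q] by (intro L2_normalize)
  ultimately show False using no_pair[OF lin(4)[OF xy(1)] lin(4)[OF q]] by blast
qed

section \<open>Unitary operators and their inverses up to null sets\<close>

section \<open>Unitary operators\<close>

lemma unitary_opD:
  assumes "unitary_op M N U"
  shows "bounded_op M (L2 M) N (L2 N) U" "f \<in> L2 M \<Longrightarrow> U f \<in> L2 N"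
    "f \<in> L2 M \<Longrightarrow> g \<in> L2 M \<Longrightarrow> L2_inner N (U f) (U g) = L2_inner M f g"
    "k \<in> L2 N \<Longrightarrow> \<exists>f\<in>L2 M. ae_eq N (U f) k"
proof -
  show b: "bounded_op M (L2 M) N (L2 N) U" using assms by (simp add: unitary_op_def)
  show "f \<in> L2 M \<Longrightarrow> U f \<in> L2 N" by (rule bounded_opD(1)[OF b])
qed (use assms in \<open>auto simp: unitary_op_def\<close>)

lemma isometry_norm:
  assumes "\<And>f g. f \<in> L2 M \<Longrightarrow> g \<in> L2 M \<Longrightarrow> L2_inner N (U f) (U g) = L2_inner M f g" "f \<in> L2 M"
  shows "L2_norm N (U f) = L2_norm M f"
  using assms(1)[OF assms(2,2)] unfolding L2_inner_self
  by (simp add: power2_eq_iff_nonneg flip: of_real_power)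

text \<open>For given \<open>h\<close> the Riesz representative \<open>z\<close> of
  \<open>f \<mapsto> \<langle>U f, h\<rangle>\<close> is the expected preimage: by isometry
  \<open>h - U z\<close> is orthogonal to the range, which is total.\<close>

lemma isometry_total_range_unitary:
  assumes b: "bounded_op M (L2 M) N (L2 N) U"
    and iso: "\<And>f g. f \<in> L2 M \<Longrightarrow> g \<in> L2 M \<Longrightarrow> L2_inner N (U f) (U g) = L2_inner M f g"
    and total: "\<And>h. h \<in> L2 N \<Longrightarrow> (\<And>f. f \<in> L2 M \<Longrightarrow> L2_inner N (U f) h = 0) \<Longrightarrow> ae_eq N h (\<lambda>x. 0)"
  shows "unitary_op M N U"
  unfolding unitary_op_def
proof (intro conjI ballI)
  fix h assume h: "h \<in> L2 N"
  have UL: "U f \<in> L2 N" if "f \<in> L2 M" for f by (rule bounded_opD(1)[OF b that])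
  have "\<exists>z\<in>L2 M. \<forall>f\<in>L2 M. L2_inner N (U f) h = L2_inner M f z"
    by (rule bounded_op_adjoint_vector[OF closed_subspace_L2 b subset_refl h])
  then obtain z where z: "z \<in> L2 M" "\<And>f. f \<in> L2 M \<Longrightarrow> L2_inner N (U f) h = L2_inner M f z" by blast
  have "ae_eq N (\<lambda>x. h x - U z x) (\<lambda>x. 0)"
  proof (rule total)
    fix f assume f: "f \<in> L2 M"
    show "L2_inner N (U f) (\<lambda>x. h x - U z x) = 0"
      using z f h UL iso by (simp add: L2_inner_diff_right)
  qed (use h UL[OF z(1)] L2_diff in auto)
  then have "ae_eq N (U z) h" by (auto simp: ae_eq_def)
  then show "\<exists>f\<in>L2 M. ae_eq N (U f) h" using z(1) by blast
qed (use b iso in auto)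

lemma unitary_op_inj:
  assumes U: "unitary_op M N U" and fg: "f \<in> L2 M" "g \<in> L2 M" "ae_eq N (U f) (U g)"
  shows "ae_eq M f g"
proof (rule ae_eq_inner_test[OF fg(1,2)])
  fix k assume k: "k \<in> L2 M"
  have "L2_inner N (U f) (U k) = L2_inner N (U g) (U k)"
    using fg k by (intro L2_inner_cong_ae unitary_opD(2)[OF U] ae_eq_refl) auto
  then show "L2_inner M f k = L2_inner M g k" using fg k unitary_opD(3)[OF U] by simp
qed

text \<open>For a unitary the adjoint is the inverse. Its values are chosen independently of each
  other, so linearity and compatibility with \<open>ae_eq\<close> are pulled back along
  \<open>U\<close>, which is injective up to null sets.\<close>

lemma adjoint_op_unitary:
  assumes U: "unitary_op M N U"
  defines "W \<equiv> adjoint_op M N U"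
  shows "g \<in> L2 N \<Longrightarrow> W g \<in> L2 M" "g \<in> L2 N \<Longrightarrow> ae_eq N (U (W g)) g"
    "f \<in> L2 M \<Longrightarrow> ae_eq M (W (U f)) f" "bounded_op N (L2 N) M (L2 M) W"
    "g \<in> L2 N \<Longrightarrow> L2_norm M (W g) = L2_norm N g"
proof -
  note Ud = unitary_opD[OF U]
  have W: "W g \<in> L2 M \<and> (\<forall>h\<in>L2 M. L2_inner N (U h) g = L2_inner M h (W g))" if g: "g \<in> L2 N" for g
    unfolding W_def adjoint_op_def
  proof (rule someI_ex[of "\<lambda>f. f \<in> L2 M \<and> (\<forall>h\<in>L2 M. L2_inner N (U h) g = L2_inner M h f)"])
    obtain f where f: "f \<in> L2 M" "ae_eq N (U f) g" using Ud(4)[OF g] by blast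
    have "L2_inner N (U h) g = L2_inner M h f" if h: "h \<in> L2 M" for h
    proof -
      have "L2_inner N (U h) g = L2_inner N (U h) (U f)"
        using f h g Ud(2) by (intro L2_inner_cong_ae ae_eq_refl ae_eq_sym[OF f(2)]) auto
      then show ?thesis using Ud(3)[OF h f(1)] by simp
    qed
    then show "\<exists>f. f \<in> L2 M \<and> (\<forall>h\<in>L2 M. L2_inner N (U h) g = L2_inner M h f)" using f by blast
  qed
  show WL: "W g \<in> L2 M" if "g \<in> L2 N" for g using W[OF that] by blast
  show UW: "ae_eq N (U (W g)) g" if g: "g \<in> L2 N" for g
  proof (rule ae_eq_inner_test[OF Ud(2)[OF WL[OF g]] g])
    fix k assume k: "k \<in> L2 N"
    obtain h where h: "h \<in> L2 M" "ae_eq N (U h) k" using Ud(4)[OF k] by blast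
    have "L2_inner N (U h) (U (W g)) = L2_inner N (U h) g"
      using W[OF g] h(1) Ud(3)[OF h(1) WL[OF g]] by simp
    then have "L2_inner N (U (W g)) (U h) = L2_inner N g (U h)" by (metis L2_inner_commute)
    then show "L2_inner N (U (W g)) k = L2_inner N g k"
      using L2_inner_cong_ae[OF _ Ud(2)[OF h(1)] _ k ae_eq_refl h(2)] g Ud(2)[OF WL[OF g]] by simp
  qed
  show WU: "ae_eq M (W (U f)) f" if f: "f \<in> L2 M" for f
    by (rule unitary_op_inj[OF U WL[OF Ud(2)[OF f]] f UW[OF Ud(2)[OF f]]])
  show norm: "L2_norm M (W g) = L2_norm N g" if g: "g \<in> L2 N" for g
    using isometry_norm[of M N U, OF Ud(3) WL[OF g]] L2_norm_cong_ae[OF Ud(2)[OF WL[OF g]] g UW[OF g]]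
    by simp
  show "bounded_op N (L2 N) M (L2 M) W"
    unfolding bounded_op_def
  proof (intro conjI ballI allI impI)
    fix f g assume fg: "f \<in> L2 N" "g \<in> L2 N"
    show "ae_eq M (W f) (W g)" if "ae_eq N f g"
    proof (rule unitary_op_inj[OF U WL[OF fg(1)] WL[OF fg(2)]])
      show "ae_eq N (U (W f)) (U (W g))"
        using UW[OF fg(1)] that ae_eq_sym[OF UW[OF fg(2)]] ae_eq_trans by blast
    qed
    show "ae_eq M (W (\<lambda>x. f x + g x)) (\<lambda>y. W f y + W g y)"
    proof (rule unitary_op_inj[OF U WL[OF L2_add[OF fg]] L2_add[OF WL[OF fg(1)] WL[OF fg(2)]]])
      have "ae_eq N (U (W (\<lambda>x. f x + g x))) (\<lambda>x. f x + g x)" by (rule UW[OF L2_add[OF fg]])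
      also have "ae_eq N \<dots> (\<lambda>x. U (W f) x + U (W g) x)"
        by (intro ae_eq_add ae_eq_sym[OF UW] fg)
      also have "ae_eq N \<dots> (U (\<lambda>y. W f y + W g y))"
        by (intro ae_eq_sym[OF bounded_opD(3)[OF Ud(1)]] WL fg)
      finally show "ae_eq N (U (W (\<lambda>x. f x + g x))) (U (\<lambda>y. W f y + W g y))" .
    qed
  next
    fix c f assume f: "f \<in> L2 N"
    show "ae_eq M (W (\<lambda>x. c * f x)) (\<lambda>y. c * W f y)"
    proof (rule unitary_op_inj[OF U WL[OF L2_scale[OF f]] L2_scale[OF WL[OF f]]])
      have "ae_eq N (U (W (\<lambda>x. c * f x))) (\<lambda>x. c * f x)" by (rule UW[OF L2_scale[OF f]])
      also have "ae_eq N \<dots> (\<lambda>x. c * U (W f) x)"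
        by (intro ae_eq_mult ae_eq_sym[OF UW] f)
      also have "ae_eq N \<dots> (U (\<lambda>y. c * W f y))"
        by (intro ae_eq_sym[OF bounded_opD(4)[OF Ud(1)]] WL f)
      finally show "ae_eq N (U (W (\<lambda>x. c * f x))) (U (\<lambda>y. c * W f y))" .
    qed
  next
    show "\<exists>C. \<forall>f\<in>L2 N. L2_norm M (W f) \<le> C * L2_norm N f"
      by (intro exI[of _ 1]) (simp add: norm)
  qed (rule WL)
qed

section \<open>Square-integrable functions on a product and the operator
  \<open>F \<otimes> I\<close>\<close>

section \<open>Products and tensor products\<close>

context pair_sigma_finite
begin

lemma L2_pair_section:
  assumes "f \<in> L2 (M1 \<Otimes>\<^sub>M M2)"
  shows "AE x in M1. (\<lambda>y. f (x, y)) \<in> L2 M2"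
  using AE_integrable_fst'[OF L2_integrable_square[OF assms]] AE_space
proof eventually_elim
  case (elim x)
  then show ?case
    unfolding L2_def using measurable_Pair2[OF L2_measurable[OF assms]] by simp
qed

lemma L2_inner_pair_integrable:
  assumes "f \<in> L2 (M1 \<Otimes>\<^sub>M M2)" "g \<in> L2 (M1 \<Otimes>\<^sub>M M2)"
  shows "integrable M1 (\<lambda>x. L2_inner M2 (\<lambda>y. f (x, y)) (\<lambda>y. g (x, y)))"
  unfolding L2_inner_def using integrable_fst'[OF L2_inner_integrable[OF assms]] by simp

lemma L2_inner_pair:
  assumes "f \<in> L2 (M1 \<Otimes>\<^sub>M M2)" "g \<in> L2 (M1 \<Otimes>\<^sub>M M2)"
  shows "L2_inner (M1 \<Otimes>\<^sub>M M2) f g = (\<integral>x. L2_inner M2 (\<lambda>y. f (x, y)) (\<lambda>y. g (x, y)) \<partial>M1)"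
  unfolding L2_inner_def using integral_fst'[OF L2_inner_integrable[OF assms]] by simp

lemma L2_norm_pair_integrable:
  assumes "f \<in> L2 (M1 \<Otimes>\<^sub>M M2)"
  shows "integrable M1 (\<lambda>x. (L2_norm M2 (\<lambda>y. f (x, y)))\<^sup>2)"
  unfolding L2_norm_square using integrable_fst'[OF L2_integrable_square[OF assms]] by simp

lemma L2_pairI:
  assumes [measurable]: "f \<in> borel_measurable (M1 \<Otimes>\<^sub>M M2)"
    and sec: "AE x in M1. (\<lambda>y. f (x, y)) \<in> L2 M2 \<and> (L2_norm M2 (\<lambda>y. f (x, y)))\<^sup>2 \<le> b x"
    and b: "integrable M1 b"
  shows "f \<in> L2 (M1 \<Otimes>\<^sub>M M2)"
proof (rule L2I_nn_integral)
  have "(\<integral>\<^sup>+z. ennreal ((cmod (f z))\<^sup>2) \<partial>(M1 \<Otimes>\<^sub>M M2)) = (\<integral>\<^sup>+x. \<integral>\<^sup>+y. ennreal ((cmod (f (x, y)))\<^sup>2) \<partial>M2 \<partial>M1)"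
    by (rule M2.nn_integral_fst[symmetric]) measurable
  also have "\<dots> \<le> (\<integral>\<^sup>+x. ennreal (b x) \<partial>M1)"
    using sec by (intro nn_integral_mono_AE, eventually_elim) (simp add: L2_nn_integral ennreal_leI)
  also have "\<dots> \<le> (\<integral>\<^sup>+x. ennreal (norm (b x)) \<partial>M1)"
    by (intro nn_integral_mono ennreal_leI) simp
  also have "\<dots> < \<infinity>" using b by (simp only: integrable_iff_bounded)
  finally show "(\<integral>\<^sup>+z. ennreal ((cmod (f z))\<^sup>2) \<partial>(M1 \<Otimes>\<^sub>M M2)) < \<infinity>" .
qed simp

lemma ae_eq_pair_iff:
  assumes [measurable]: "f \<in> borel_measurable (M1 \<Otimes>\<^sub>M M2)" "g \<in> borel_measurable (M1 \<Otimes>\<^sub>M M2)"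
  shows "ae_eq (M1 \<Otimes>\<^sub>M M2) f g \<longleftrightarrow> (AE x in M1. ae_eq M2 (\<lambda>y. f (x, y)) (\<lambda>y. g (x, y)))"
  unfolding ae_eq_def using AE_pair_iff[of "\<lambda>x y. f (x, y) = g (x, y)"] by simp

lemma L2_tensor:
  assumes "f \<in> L2 M1" "g \<in> L2 M2"
  shows "(\<lambda>(x, y). f x * g y) \<in> L2 (M1 \<Otimes>\<^sub>M M2)"
proof (rule L2_pairI)
  note [measurable] = L2_measurable[OF assms(1)] L2_measurable[OF assms(2)]
  show "(\<lambda>(x, y). f x * g y) \<in> borel_measurable (M1 \<Otimes>\<^sub>M M2)" by measurable
  show "AE x in M1. (\<lambda>y. case (x, y) of (x, y) \<Rightarrow> f x * g y) \<in> L2 M2 \<and>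
      (L2_norm M2 (\<lambda>y. case (x, y) of (x, y) \<Rightarrow> f x * g y))\<^sup>2 \<le> (cmod (f x))\<^sup>2 * (L2_norm M2 g)\<^sup>2"
    using assms by (intro AE_I2) (auto simp: L2_scale L2_norm_scale power_mult_distrib)
  show "integrable M1 (\<lambda>x. (cmod (f x))\<^sup>2 * (L2_norm M2 g)\<^sup>2)"
    using L2_integrable_square[OF assms(1)] by simp
qed

lemma L2_inner_tensor:
  assumes "f \<in> L2 M1" "g \<in> L2 M2" "h \<in> L2 (M1 \<Otimes>\<^sub>M M2)"
  shows "L2_inner (M1 \<Otimes>\<^sub>M M2) (\<lambda>(x, y). f x * g y) h = (\<integral>x. f x * L2_inner M2 g (\<lambda>y. h (x, y)) \<partial>M1)"
  unfolding L2_inner_pair[OF L2_tensor[OF assms(1,2)] assms(3)] by (simp add: L2_inner_scale_left)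

lemma L2_inner_tensor_tensor:
  assumes "f \<in> L2 M1" "g \<in> L2 M2" "f' \<in> L2 M1" "g' \<in> L2 M2"
  shows "L2_inner (M1 \<Otimes>\<^sub>M M2) (\<lambda>(x, y). f x * g y) (\<lambda>(x, y). f' x * g' y) = L2_inner M1 f f' * L2_inner M2 g g'"
proof -
  have "L2_inner (M1 \<Otimes>\<^sub>M M2) (\<lambda>(x, y). f x * g y) (\<lambda>(x, y). f' x * g' y)
      = (\<integral>x. (f x * cnj (f' x)) * L2_inner M2 g g' \<partial>M1)"
    unfolding L2_inner_tensor[OF assms(1,2) L2_tensor[OF assms(3,4)]]
    by (simp add: L2_inner_scale_right mult.assoc)
  also have "\<dots> = L2_inner M1 f f' * L2_inner M2 g g'"
    unfolding L2_inner_def[of M1] by (rule integral_mult_left_zero)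
  finally show ?thesis .
qed

text \<open>By Cauchy-Schwarz the partial inner product is dominated by the fibre norm of
  \<open>h\<close>. It serves as first factor of a test tensor and as coefficient of a rank one
  field.\<close>

lemma L2_inner_section_L2:
  assumes g: "g \<in> L2 M2" and h: "h \<in> L2 (M1 \<Otimes>\<^sub>M M2)"
  shows "(\<lambda>x. L2_inner M2 (\<lambda>y. h (x, y)) g) \<in> L2 M1"
proof -
  note [measurable] = L2_measurable[OF g] L2_measurable[OF h]
  have meas: "(\<lambda>x. L2_inner M2 (\<lambda>y. h (x, y)) g) \<in> borel_measurable M1"
    unfolding L2_inner_def by measurable
  have "integrable M1 (\<lambda>x. (cmod (L2_inner M2 (\<lambda>y. h (x, y)) g))\<^sup>2)"
  proof (rule Bochner_Integration.integrable_bound)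
    show "integrable M1 (\<lambda>x. (L2_norm M2 (\<lambda>y. h (x, y)))\<^sup>2 * (L2_norm M2 g)\<^sup>2)"
      using L2_norm_pair_integrable[OF h] by simp
    show "AE x in M1. norm ((cmod (L2_inner M2 (\<lambda>y. h (x, y)) g))\<^sup>2)
        \<le> norm ((L2_norm M2 (\<lambda>y. h (x, y)))\<^sup>2 * (L2_norm M2 g)\<^sup>2)"
      using L2_pair_section[OF h]
      by eventually_elim (auto simp flip: power_mult_distrib intro!: power_mono L2_Cauchy_Schwarz g)
  qed (use meas in measurable)
  then show ?thesis using meas by (simp add: L2_def)
qed

end

lemma separable_total_sequence:
  assumes "separable_L2 Y"
  obtains D where "countable D" "D \<subseteq> L2 Y"
    "\<And>f. f \<in> L2 Y \<Longrightarrow> \<exists>s. (\<forall>n. s n \<in> D) \<and> L2_lim Y s f"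
    "\<And>h. h \<in> L2 Y \<Longrightarrow> (\<And>d. d \<in> D \<Longrightarrow> L2_inner Y d h = 0) \<Longrightarrow> ae_eq Y h (\<lambda>x. 0)"
proof -
  obtain D where D: "countable D" "D \<subseteq> L2 Y"
    and seq: "\<And>f. f \<in> L2 Y \<Longrightarrow> \<exists>s. (\<forall>n. s n \<in> D) \<and> L2_lim Y s f"
    using assms unfolding separable_L2_def L2_lim_iff_dense by blast
  have "ae_eq Y h (\<lambda>x. 0)" if h: "h \<in> L2 Y" and orth: "\<And>d. d \<in> D \<Longrightarrow> L2_inner Y d h = 0" for h
  proof -
    obtain s where s: "\<And>n. s n \<in> D" "L2_lim Y s h" using seq[OF h] by blast
    have "(\<lambda>n. L2_inner Y (s n) h) \<longlonglongrightarrow> L2_inner Y h h"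
      using s D(2) h by (intro L2_inner_tendsto_left) auto
    then have "L2_inner Y h h = 0" using orth s(1) by (simp add: LIMSEQ_const_iff)
    then show ?thesis using L2_norm_eq_0_iff[OF h] by (simp add: L2_inner_self)
  qed
  then show ?thesis using that D seq by blast
qed

text \<open>For fixed \<open>d\<close>, testing with the tensor whose first factor is
  \<open>x \<mapsto> \<langle>h(x, \<cdot>), d\<rangle>\<close> turns orthogonality into the
  vanishing of the norm of that factor.\<close>

lemma (in pair_sigma_finite) tensors_total:
  assumes sep: "separable_L2 M2" and h: "h \<in> L2 (M1 \<Otimes>\<^sub>M M2)"
    and orth: "\<And>f g. f \<in> L2 M1 \<Longrightarrow> g \<in> L2 M2 \<Longrightarrow> L2_inner (M1 \<Otimes>\<^sub>M M2) (\<lambda>(x, y). f x * g y) h = 0"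
  shows "ae_eq (M1 \<Otimes>\<^sub>M M2) h (\<lambda>x. 0)"
proof -
  obtain D where D: "countable D" "D \<subseteq> L2 M2"
    and total: "\<And>h. h \<in> L2 M2 \<Longrightarrow> (\<And>d. d \<in> D \<Longrightarrow> L2_inner M2 d h = 0) \<Longrightarrow> ae_eq M2 h (\<lambda>x. 0)"
    using separable_total_sequence[OF sep] by metis
  have "AE x in M1. L2_inner M2 d (\<lambda>y. h (x, y)) = 0" if "d \<in> D" for d
  proof -
    have d: "d \<in> L2 M2" using that D by auto
    define \<phi> where "\<phi> x = L2_inner M2 (\<lambda>y. h (x, y)) d" for x
    have \<phi>: "\<phi> \<in> L2 M1" unfolding \<phi>_def by (rule L2_inner_section_L2[OF d h])
    have "0 = (\<integral>x. \<phi> x * L2_inner M2 d (\<lambda>y. h (x, y)) \<partial>M1)"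
      using orth[OF \<phi> d] unfolding L2_inner_tensor[OF \<phi> d h] by simp
    also have "\<dots> = L2_inner M1 \<phi> \<phi>"
      unfolding L2_inner_def[of M1] \<phi>_def using L2_inner_commute[of M2 d] by simp
    finally have "ae_eq M1 \<phi> (\<lambda>x. 0)" using L2_norm_eq_0_iff[OF \<phi>] by (simp add: L2_inner_self)
    then show ?thesis unfolding ae_eq_def \<phi>_def
      by eventually_elim (metis L2_inner_commute complex_cnj_zero)
  qed
  \<comment> \<open>Every \<open>d\<close> brings its own null set; the countable total set from
    separability leaves a single one.\<close>
  then have "AE x in M1. \<forall>d\<in>D. L2_inner M2 d (\<lambda>y. h (x, y)) = 0"
    using D(1) by (simp add: AE_ball_countable)
  then have "AE x in M1. ae_eq M2 (\<lambda>y. h (x, y)) (\<lambda>y. 0)"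
    using L2_pair_section[OF h] by eventually_elim (rule total, auto)
  then show ?thesis
    using ae_eq_pair_iff[OF L2_measurable[OF h], of "\<lambda>_. 0"] by simp
qed

text \<open>The graph of \<open>F \<otimes> I\<close> on finite sums of elementary tensors, before
  it is known to be single-valued. Induction on derivations replaces the handling of explicit
  sums.\<close>

inductive tensor_relation ::
  "'a measure \<Rightarrow> 'y measure \<Rightarrow> (('a \<Rightarrow> complex) \<Rightarrow> ('b \<Rightarrow> complex)) \<Rightarrow>
   ('a \<times> 'y \<Rightarrow> complex) \<Rightarrow> ('b \<times> 'y \<Rightarrow> complex) \<Rightarrow> bool" for M Y F where
  tensor: "f \<in> L2 M \<Longrightarrow> g \<in> L2 Y \<Longrightarrow> tensor_relation M Y F (\<lambda>(u, v). f u * g v) (\<lambda>(\<xi>, v). F f \<xi> * g v)"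
| add: "tensor_relation M Y F p q \<Longrightarrow> tensor_relation M Y F p' q' \<Longrightarrow>
    tensor_relation M Y F (\<lambda>x. p x + p' x) (\<lambda>x. q x + q' x)"
| scale: "tensor_relation M Y F p q \<Longrightarrow> tensor_relation M Y F (\<lambda>x. c * p x) (\<lambda>x. c * q x)"

locale tensor_setup =
  M: sigma_finite_measure M + N: sigma_finite_measure N + Y: sigma_finite_measure Y
  for M :: "'a measure" and N :: "'b measure" and Y :: "'y measure" +
  assumes sep: "separable_L2 Y"
begin

sublocale MY: pair_sigma_finite M Y ..
sublocale NY: pair_sigma_finite N Y ..

lemma span_of_tensors_dense:
  assumes f: "f \<in> L2 (M \<Otimes>\<^sub>M Y)"
  shows "\<exists>s. (\<forall>n. \<exists>q. tensor_relation M Y F (s n) q) \<and> L2_lim (M \<Otimes>\<^sub>M Y) s f"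
proof -
  let ?K = "{p. \<exists>q. tensor_relation M Y F p q}"
  have L: "p \<in> L2 (M \<Otimes>\<^sub>M Y)" if "tensor_relation M Y F p q" for p q
    using that by induction (auto intro: MY.L2_tensor L2_add L2_scale)
  have "\<exists>s. (\<forall>n. s n \<in> ?K) \<and> L2_lim (M \<Otimes>\<^sub>M Y) s f"
  proof (rule dense_if_total[OF _ _ f])
    \<comment> \<open>The relation has no rule for zero; here it arises as the tensor of two zero
      functions.\<close>
    have "tensor_relation M Y F (\<lambda>(u, v). (\<lambda>_. 0) u * (\<lambda>_. 0) v) (\<lambda>(\<xi>, v). F (\<lambda>_. 0) \<xi> * (\<lambda>_. 0) v)"
      by (rule tensor_relation.tensor) auto
    then have "(\<lambda>x. 0) \<in> ?K" by (auto simp: split_def)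
    then show "linear_subspace (M \<Otimes>\<^sub>M Y) ?K"
      unfolding linear_subspace_def using L by (auto intro: tensor_relation.add tensor_relation.scale)
  next
    fix h assume h: "h \<in> L2 (M \<Otimes>\<^sub>M Y)" and orth: "\<And>k. k \<in> ?K \<Longrightarrow> L2_inner (M \<Otimes>\<^sub>M Y) k h = 0"
    show "ae_eq (M \<Otimes>\<^sub>M Y) h (\<lambda>x. 0)"
    proof (rule MY.tensors_total[OF sep h])
      fix f g assume "f \<in> L2 M" "g \<in> L2 Y"
      then have "(\<lambda>(u, v). f u * g v) \<in> ?K" by (blast intro: tensor_relation.tensor)
      then show "L2_inner (M \<Otimes>\<^sub>M Y) (\<lambda>(x, y). f x * g y) h = 0" by (rule orth)
    qed
  qed
  then show ?thesis by simp
qed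

lemma agree_if_agree_on_tensors:
  assumes S: "bounded_op (M \<Otimes>\<^sub>M Y) (L2 (M \<Otimes>\<^sub>M Y)) P (L2 P) S"
    and T: "bounded_op (M \<Otimes>\<^sub>M Y) (L2 (M \<Otimes>\<^sub>M Y)) P (L2 P) T"
    and agree: "\<And>f g. f \<in> L2 M \<Longrightarrow> g \<in> L2 Y \<Longrightarrow> ae_eq P (S (\<lambda>(u, v). f u * g v)) (T (\<lambda>(u, v). f u * g v))"
    and h: "h \<in> L2 (M \<Otimes>\<^sub>M Y)"
  shows "ae_eq P (S h) (T h)"
proof (rule bounded_op_agree_if_total[OF S T _ _ _ h])
  let ?K = "{p. \<exists>f g. f \<in> L2 M \<and> g \<in> L2 Y \<and> p = (\<lambda>(u, v). f u * g v)}"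
  show "?K \<subseteq> L2 (M \<Otimes>\<^sub>M Y)" using MY.L2_tensor by blast
  show "ae_eq P (S k) (T k)" if "k \<in> ?K" for k using that agree by blast
  show "ae_eq (M \<Otimes>\<^sub>M Y) h (\<lambda>x. 0)"
    if "h \<in> L2 (M \<Otimes>\<^sub>M Y)" "\<And>k. k \<in> ?K \<Longrightarrow> L2_inner (M \<Otimes>\<^sub>M Y) k h = 0" for h
    by (rule MY.tensors_total[OF sep that(1)], rule that(2)) blast
qed

text \<open>The extension theorem provides one operator \<open>S\<close> with the required values,
  so the \<open>SOME\<close> in \<open>tensor_id\<close> is satisfiable. Whatever operator it
  selects agrees with \<open>S\<close> on tensors, hence everywhere, and inherits the
  isometry.\<close>

lemma tensor_id_unitary:
  assumes F: "unitary_op M N F"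
  shows "unitary_op (M \<Otimes>\<^sub>M Y) (N \<Otimes>\<^sub>M Y) (tensor_id M N Y F)"
    "f \<in> L2 M \<Longrightarrow> g \<in> L2 Y \<Longrightarrow>
      ae_eq (N \<Otimes>\<^sub>M Y) (tensor_id M N Y F (\<lambda>(u, v). f u * g v)) (\<lambda>(\<xi>, v). F f \<xi> * g v)"
proof -
  note Fd = unitary_opD[OF F]
  let ?MY = "M \<Otimes>\<^sub>M Y" and ?NY = "N \<Otimes>\<^sub>M Y"
  let ?spec = "\<lambda>S. bounded_op ?MY (L2 ?MY) ?NY (L2 ?NY) S \<and>
        (\<forall>f\<in>L2 M. \<forall>g\<in>L2 Y. ae_eq ?NY (S (\<lambda>(u, v). f u * g v)) (\<lambda>(\<xi>, v). F f \<xi> * g v))"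
  have RL: "p \<in> L2 ?MY \<and> q \<in> L2 ?NY" if "tensor_relation M Y F p q" for p q
    using that by induction (auto intro: MY.L2_tensor NY.L2_tensor Fd(2) L2_add L2_scale)
  \<comment> \<open>Induction on both derivations reduces the claim to two elementary tensors, where
    the inner product factorises and unitarity of \<open>F\<close> applies.\<close>
  have iso: "L2_inner ?NY q q' = L2_inner ?MY p p'"
    if R: "tensor_relation M Y F p q" "tensor_relation M Y F p' q'" for p q p' q'
    using R(1)
  proof induction
    case (tensor f g)
    note fg = tensor
    have L: "(\<lambda>(u, v). f u * g v) \<in> L2 ?MY" "(\<lambda>(\<xi>, v). F f \<xi> * g v) \<in> L2 ?NY"
      using fg by (auto intro: MY.L2_tensor NY.L2_tensor Fd(2))
    from R(2) show ?case
    proof induction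
      case (tensor f' g')
      then show ?case using fg
        unfolding MY.L2_inner_tensor_tensor[OF fg tensor] NY.L2_inner_tensor_tensor[OF Fd(2)[OF fg(1)] fg(2) Fd(2)[OF tensor(1)] tensor(2)]
        by (simp add: Fd(3))
    next
      case (add p q p' q')
      then show ?case using RL[OF add(1)] RL[OF add(2)] L by (simp add: L2_inner_add_right)
    next
      case (scale p q c)
      then show ?case by (simp add: L2_inner_scale_right)
    qed
  next
    case (add p q p' q')
    then show ?case using RL[OF add(1)] RL[OF add(2)] RL[OF R(2)] by (simp add: L2_inner_add_left)
  next
    case (scale p q c)
    then show ?case by (simp add: L2_inner_scale_left)
  qed
  have "\<exists>S. bounded_op ?MY (L2 ?MY) ?NY (L2 ?NY) S \<and> (\<forall>p q. tensor_relation M Y F p q \<longrightarrow> ae_eq ?NY (S p) q) \<and>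
     (\<forall>f\<in>L2 ?MY. \<forall>g\<in>L2 ?MY. L2_inner ?NY (S f) (S g) = L2_inner ?MY f g)"
    by (rule isometric_relation_extends)
       (use RL iso span_of_tensors_dense in \<open>auto intro: tensor_relation.intros\<close>)
  then obtain S where S: "bounded_op ?MY (L2 ?MY) ?NY (L2 ?NY) S"
    "\<And>p q. tensor_relation M Y F p q \<Longrightarrow> ae_eq ?NY (S p) q"
    "\<And>f g. f \<in> L2 ?MY \<Longrightarrow> g \<in> L2 ?MY \<Longrightarrow> L2_inner ?NY (S f) (S g) = L2_inner ?MY f g" by blast
  have St: "ae_eq ?NY (S (\<lambda>(u, v). f u * g v)) (\<lambda>(\<xi>, v). F f \<xi> * g v)" if "f \<in> L2 M" "g \<in> L2 Y" for f g
    by (rule S(2)[OF tensor_relation.tensor[OF that]])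
  have "?spec S" using S(1) St by blast
  then have spec: "?spec (tensor_id M N Y F)" unfolding tensor_id_def by (rule someI[of ?spec])
  then show t: "ae_eq ?NY (tensor_id M N Y F (\<lambda>(u, v). f u * g v)) (\<lambda>(\<xi>, v). F f \<xi> * g v)"
    if "f \<in> L2 M" "g \<in> L2 Y" for f g using that by blast
  from spec have b: "bounded_op ?MY (L2 ?MY) ?NY (L2 ?NY) (tensor_id M N Y F)" by blast
  have agree: "ae_eq ?NY (tensor_id M N Y F h) (S h)" if "h \<in> L2 ?MY" for h
    by (rule agree_if_agree_on_tensors[OF b S(1) _ that]) (blast intro: ae_eq_trans[OF t ae_eq_sym[OF St]])
  show "unitary_op ?MY ?NY (tensor_id M N Y F)"
  proof (rule isometry_total_range_unitary[OF b])
    fix f g assume fg: "f \<in> L2 ?MY" "g \<in> L2 ?MY"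
    have "L2_inner ?NY (tensor_id M N Y F f) (tensor_id M N Y F g) = L2_inner ?NY (S f) (S g)"
      by (intro L2_inner_cong_ae agree bounded_opD(1)[OF b] bounded_opD(1)[OF S(1)] fg)
    then show "L2_inner ?NY (tensor_id M N Y F f) (tensor_id M N Y F g) = L2_inner ?MY f g"
      using S(3)[OF fg] by simp
  next
    fix h assume h: "h \<in> L2 ?NY" and orth: "\<And>f. f \<in> L2 ?MY \<Longrightarrow> L2_inner ?NY (tensor_id M N Y F f) h = 0"
    show "ae_eq ?NY h (\<lambda>x. 0)"
    proof (rule NY.tensors_total[OF sep h])
      fix k g assume k: "k \<in> L2 N" and g: "g \<in> L2 Y"
      \<comment> \<open>As \<open>F\<close> is onto, every tensor is, up to null sets, the image of
        a tensor; so the range is total.\<close>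
      obtain f where f: "f \<in> L2 M" "ae_eq N (F f) k" using Fd(4)[OF k] by blast
      have "AE \<xi> in N. ae_eq Y (\<lambda>v. F f \<xi> * g v) (\<lambda>v. k \<xi> * g v)"
        using f(2) unfolding ae_eq_def by eventually_elim simp
      then have "ae_eq ?NY (\<lambda>(\<xi>, v). F f \<xi> * g v) (\<lambda>(\<xi>, v). k \<xi> * g v)"
        using NY.ae_eq_pair_iff[OF L2_measurable[OF NY.L2_tensor[OF Fd(2)[OF f(1)] g]]
            L2_measurable[OF NY.L2_tensor[OF k g]]] by simp
      then have "ae_eq ?NY (tensor_id M N Y F (\<lambda>(u, v). f u * g v)) (\<lambda>(\<xi>, v). k \<xi> * g v)"
        using ae_eq_trans[OF t[OF f(1) g]] by blast
      then have "L2_inner ?NY (tensor_id M N Y F (\<lambda>(u, v). f u * g v)) h = L2_inner ?NY (\<lambda>(\<xi>, v). k \<xi> * g v) h"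
        using h k g f by (intro L2_inner_cong_ae bounded_opD(1)[OF b] MY.L2_tensor NY.L2_tensor ae_eq_refl) auto
      then show "L2_inner ?NY (\<lambda>(x, y). k x * g y) h = 0"
        using orth[OF MY.L2_tensor[OF f(1) g]] by simp
    qed
  qed
qed

end

section \<open>Haar measure, measurability of the characters, and uniqueness for the Fourier
  transform\<close>

section \<open>Characters and the Fourier transform\<close>

lemma char_fun_props:
  "continuous_on UNIV (char_fun \<xi>)" "cmod (char_fun \<xi> x) = 1"
  "char_fun \<xi> (x + y) = char_fun \<xi> x * char_fun \<xi> y"
  using char_fun[of \<xi>] by auto

lemma char_fun_0: "char_fun \<xi> 0 = 1"
proof -
  have "char_fun \<xi> 0 \<noteq> 0" using char_fun_props(2)[of \<xi> 0] by auto
  then show ?thesis using char_fun_props(3)[of \<xi> 0 0] by simp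
qed

lemma char_fun_diff_norm: "cmod (char_fun \<xi> x - char_fun \<xi> y) = cmod (char_fun \<xi> (x - y) - 1)"
proof -
  have "char_fun \<xi> x - char_fun \<xi> y = char_fun \<xi> y * (char_fun \<xi> (x - y) - 1)"
    using char_fun_props(3)[of \<xi> y "x - y"] by (simp add: algebra_simps)
  then show ?thesis by (simp add: norm_mult char_fun_props(2))
qed

text \<open>A singleton is compact, so preimages of open sets under evaluation at \<open>a\<close>
  are subbasic open sets of the compact-open topology.\<close>

lemma char_fun_eval_measurable: "(\<lambda>\<xi>. char_fun \<xi> a) \<in> borel_measurable borel"
proof (rule borel_measurableI)
  fix S :: "complex set" assume S: "open S"
  have "open {\<gamma>. char_fun \<gamma> ` {a} \<subseteq> S}"
    unfolding open_dual_def
  proof (intro generate_topology.Basis CollectI exI conjI)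
    show "{\<gamma>. char_fun \<gamma> ` {a} \<subseteq> S} = {\<gamma>. char_fun \<gamma> ` {a} \<subseteq> S}" ..
  qed (use S in auto)
  then show "(\<lambda>\<xi>. char_fun \<xi> a) -` S \<inter> space borel \<in> sets borel"
    by (simp add: vimage_def)
qed

locale fourier_pair =
  fixes \<nu> :: "'g::{topological_ab_group_add, t2_space} measure" and \<nu>' :: "'g dual measure"
  assumes locally_compact_G: "locally_compact_space (euclidean :: 'g topology)"
    and sigma_compact_G: "\<exists>K :: nat \<Rightarrow> 'g set. (\<forall>n. compact (K n)) \<and> (\<Union>n. K n) = UNIV"
    and metrizable_G: "metrizable_space (euclidean :: 'g topology)"
    and haar: "haar_measure \<nu>"
    and dual_haar: "dual_haar_measure \<nu> \<nu>'"
begin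

lemma sets_\<nu>[measurable_cong]: "sets \<nu> = sets borel" and sets_\<nu>'[measurable_cong]: "sets \<nu>' = sets borel"
  using haar dual_haar by (auto simp: haar_measure_def dual_haar_measure_def)

lemma space_\<nu>[simp]: "space \<nu> = UNIV" and space_\<nu>'[simp]: "space \<nu>' = UNIV"
  using sets_eq_imp_space_eq[OF sets_\<nu>] sets_eq_imp_space_eq[OF sets_\<nu>'] by simp_all

lemma emeasure_compact: "compact K \<Longrightarrow> emeasure \<nu> K < \<infinity>"
  using haar by (auto simp: haar_measure_def)

lemma emeasure_translate: "A \<in> sets borel \<Longrightarrow> emeasure \<nu> ((\<lambda>x. a + x) ` A) = emeasure \<nu> A"
  using haar by (auto simp: haar_measure_def)

sublocale \<nu>: sigma_finite_measure \<nu>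
proof
  obtain K :: "nat \<Rightarrow> 'g set" where K: "\<And>n. compact (K n)" "(\<Union>n. K n) = UNIV"
    using sigma_compact_G by blast
  show "\<exists>A. countable A \<and> A \<subseteq> sets \<nu> \<and> \<Union>A = space \<nu> \<and> (\<forall>a\<in>A. emeasure \<nu> a \<noteq> \<infinity>)"
    using K emeasure_compact
    by (intro exI[of _ "range K"]) (auto simp: sets_\<nu> borel_closed compact_imp_closed less_top[symmetric])
qed

lemma translation_measurable: "(\<lambda>x. x - a) \<in> measurable \<nu> \<nu>"
proof -
  have "(\<lambda>x::'g. x - a) \<in> borel_measurable borel"
    by (intro borel_measurable_continuous_onI continuous_intros)
  then show ?thesis by measurable
qed

lemma distr_translation: "distr \<nu> \<nu> (\<lambda>x. x - a) = \<nu>"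
proof (rule measure_eqI)
  fix A assume "A \<in> sets (distr \<nu> \<nu> (\<lambda>x. x - a))"
  then have A: "A \<in> sets \<nu>" by simp
  have "(\<lambda>x. x - a) -` A \<inter> space \<nu> = (\<lambda>x. a + x) ` A"
    by (auto simp: image_iff) (metis add.commute diff_add_cancel)
  then show "emeasure (distr \<nu> \<nu> (\<lambda>x. x - a)) A = emeasure \<nu> A"
    using A emeasure_translate[of A a] by (simp add: emeasure_distr[OF translation_measurable] sets_\<nu>)
qed simp

lemma open_translate: "open U \<Longrightarrow> open {x::'g. x - q \<in> U}"
  using continuous_open_vimage[of U "\<lambda>x. x - q"] by (simp add: vimage_def continuous_intros continuous_at_imp_continuous_on)

text \<open>Each compact set of the exhaustion is covered by finitely many translates; together
  these are countably many.\<close>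

lemma countable_translates_cover:
  assumes U: "open U" "0 \<in> U"
  shows "\<exists>q::nat \<Rightarrow> 'g. \<forall>x. \<exists>i. x - q i \<in> U"
proof -
  obtain K :: "nat \<Rightarrow> 'g set" where K: "\<And>n. compact (K n)" "(\<Union>n. K n) = UNIV"
    using sigma_compact_G by blast
  have "\<exists>Q. finite Q \<and> K n \<subseteq> (\<Union>q\<in>Q. {x. x - q \<in> U})" for n
  proof (rule compactE_image[OF K(1)[of n], of UNIV "\<lambda>q. {x. x - q \<in> U}"])
    show "K n \<subseteq> (\<Union>q\<in>UNIV. {x. x - q \<in> U})"
    proof
      fix x
      have "x - x \<in> U" using U(2) by simp
      then show "x \<in> (\<Union>q\<in>UNIV. {x. x - q \<in> U})" by blast
    qed
  qed (use open_translate[OF U(1)] in auto)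
  then obtain Q where Q: "\<And>n. finite (Q n)" "\<And>n. K n \<subseteq> (\<Union>q\<in>Q n. {x. x - q \<in> U})" by metis
  let ?Q = "\<Union>n. Q n"
  have c: "countable ?Q" using Q(1) by (intro countable_UN) (auto intro: countable_finite)
  have cover: "\<exists>q\<in>?Q. x - q \<in> U" for x
  proof -
    obtain n where "x \<in> K n" using K(2) by blast
    then show ?thesis using Q(2)[of n] by blast
  qed
  then have "?Q \<noteq> {}" by blast
  then have r: "range (from_nat_into ?Q) = ?Q" using c by (rule range_from_nat_into)
  show ?thesis
  proof (intro exI[of _ "from_nat_into ?Q"] allI)
    fix x
    obtain q where "q \<in> ?Q" "x - q \<in> U" using cover by blast
    then show "\<exists>i. x - from_nat_into ?Q i \<in> U" using r by (metis imageE)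
  qed
qed

text \<open>If \<open>U\<close> were null, so would be countably many translates that cover the
  group, but a Haar measure is not zero.\<close>

lemma emeasure_open_pos:
  assumes U: "open U" "0 \<in> U"
  shows "emeasure \<nu> U > 0"
proof (rule ccontr)
  assume "\<not> ?thesis"
  then have 0: "emeasure \<nu> U = 0" by simp
  obtain q :: "nat \<Rightarrow> 'g" where q: "\<And>x. \<exists>i. x - q i \<in> U" using countable_translates_cover[OF U] by blast
  have "{x. x - q i \<in> U} \<in> null_sets \<nu>" for i
  proof -
    have "{x. x - q i \<in> U} = (\<lambda>x. q i + x) ` U"
      by (auto simp: image_iff) (metis add.commute diff_add_cancel)
    then have "emeasure \<nu> {x. x - q i \<in> U} = 0" using emeasure_translate[of U "q i"] U(1) 0 by simp
    then show ?thesis using open_translate[OF U(1)] by (auto simp: null_sets_def sets_\<nu>)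
  qed
  then have "(\<Union>i. {x. x - q i \<in> U}) \<in> null_sets \<nu>" by (rule null_sets_UN)
  moreover have "(\<Union>i. {x. x - q i \<in> U}) = UNIV" using q by blast
  ultimately have "emeasure \<nu> UNIV = 0" by (auto simp: null_sets_def)
  then show False using haar by (simp add: haar_measure_def)
qed

text \<open>Metrizability gives a countable base at 0, local compactness a neighbourhood of finite
  measure.\<close>

lemma neighbourhood_base:
  obtains N :: "nat \<Rightarrow> 'g set" where "\<And>n. open (N n)" "\<And>n. 0 \<in> N n"
    "\<And>n. 0 < emeasure \<nu> (N n)" "\<And>n. emeasure \<nu> (N n) < \<infinity>"
    "\<And>U. open U \<Longrightarrow> 0 \<in> U \<Longrightarrow> \<exists>n0. \<forall>n\<ge>n0. N n \<subseteq> U"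
proof -
  have "first_countable (euclidean :: 'g topology)"
    by (rule metrizable_imp_first_countable[OF metrizable_G])
  then have "\<exists>B. countable B \<and> (\<forall>V\<in>B. open V) \<and>
      (\<forall>U. open U \<and> (0::'g) \<in> U \<longrightarrow> (\<exists>V\<in>B. 0 \<in> V \<and> V \<subseteq> U))"
    unfolding first_countable_def by simp
  then obtain B where B: "countable B" "\<And>V. V \<in> B \<Longrightarrow> open V"
    "\<And>U. open U \<Longrightarrow> (0::'g) \<in> U \<Longrightarrow> \<exists>V\<in>B. 0 \<in> V \<and> V \<subseteq> U"
    by meson
  have "\<exists>W K. open W \<and> compact K \<and> (0::'g) \<in> W \<and> W \<subseteq> K"
    using locally_compact_G unfolding locally_compact_space_def by simp
  then obtain W K where W: "open W" "compact K" "(0::'g) \<in> W" "W \<subseteq> K"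
    by blast
  define C where "C = {V \<in> B. 0 \<in> V}"
  have C: "countable C" "C \<noteq> {}" using B(1) B(3)[of UNIV] by (auto simp: C_def)
  define b where "b = from_nat_into C"
  have rb: "range b = C" unfolding b_def by (rule range_from_nat_into[OF C(2,1)])
  then have bC: "b n \<in> C" for n by blast
  \<comment> \<open>Intersecting with \<open>W\<close> bounds the measure; the growing finite
    intersections make the sets decrease, so all from some index on lie in a given
    \<open>U\<close>.\<close>
  define N where "N n = W \<inter> (\<Inter>i\<le>n. b i)" for n
  have op: "open (N n)" for n
    unfolding N_def using W(1) bC B(2) by (intro open_Int open_INT) (auto simp: C_def)
  have 0: "0 \<in> N n" for n unfolding N_def using W(3) bC by (auto simp: C_def)
  have "emeasure \<nu> (N n) < \<infinity>" for n
  proof -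
    have "emeasure \<nu> (N n) \<le> emeasure \<nu> K"
      using W(2,4) by (intro emeasure_mono) (auto simp: N_def sets_\<nu> borel_closed compact_imp_closed)
    then show ?thesis using emeasure_compact[OF W(2)] by (rule le_less_trans)
  qed
  moreover have "\<exists>n0. \<forall>n\<ge>n0. N n \<subseteq> U" if U: "open U" "0 \<in> U" for U
  proof -
    obtain V where V: "V \<in> C" "V \<subseteq> U" using B(3)[OF U] by (auto simp: C_def)
    obtain n0 where "V = b n0" using V(1) rb by blast
    then have "N n \<subseteq> U" if "n \<ge> n0" for n using V(2) that by (auto simp: N_def)
    then show ?thesis by blast
  qed
  ultimately show ?thesis using that[of N] op 0 emeasure_open_pos by blast
qed

lemma fourier_unitary: "unitary_op \<nu> \<nu>' (fourier_L2 \<nu> \<nu>')"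
  and fourier_eq_fourier1: "f \<in> L2 \<nu> \<Longrightarrow> integrable \<nu> f \<Longrightarrow> ae_eq \<nu>' (fourier_L2 \<nu> \<nu>' f) (fourier1 \<nu> f)"
proof -
  have "\<exists>F. unitary_fourier_extension \<nu> \<nu>' F" using dual_haar by (auto simp: dual_haar_measure_def)
  then have "unitary_fourier_extension \<nu> \<nu>' (fourier_L2 \<nu> \<nu>')"
    unfolding fourier_L2_def by (rule someI_ex)
  then show "unitary_op \<nu> \<nu>' (fourier_L2 \<nu> \<nu>')"
    "f \<in> L2 \<nu> \<Longrightarrow> integrable \<nu> f \<Longrightarrow> ae_eq \<nu>' (fourier_L2 \<nu> \<nu>' f) (fourier1 \<nu> f)"
    by (auto simp: unitary_fourier_extension_def)
qed

text \<open>
  The transforms of the indicators of small neighbourhoods of \<open>0\<close> are square-integrable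
  and have no common zero.
\<close>

sublocale \<nu>': sigma_finite_measure \<nu>'
proof -
  obtain N :: "nat \<Rightarrow> 'g set" where N: "\<And>n. open (N n)" "\<And>n. 0 \<in> N n"
    "\<And>n. 0 < emeasure \<nu> (N n)" "\<And>n. emeasure \<nu> (N n) < \<infinity>"
    "\<And>U. open U \<Longrightarrow> 0 \<in> U \<Longrightarrow> \<exists>n0. \<forall>n\<ge>n0. N n \<subseteq> U"
    by (rule neighbourhood_base) blast
  let ?i = "\<lambda>n x. indicator (N n) x :: complex" and ?F = "fourier_L2 \<nu> \<nu>'"
  have Ns: "N n \<in> sets \<nu>" for n using N(1) by (simp add: sets_\<nu>)
  have i: "?i n \<in> L2 \<nu>" for n by (rule L2_indicator[OF Ns N(4)])
  have int: "integrable \<nu> (?i n)" for n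
    using Ns N(4) integrable_real_indicator[of "N n" \<nu>] integrable_of_real[of \<nu> "indicator (N n)", where 'a=complex]
    by (simp add: of_real_indicator)
  have nz: "\<exists>n. fourier1 \<nu> (?i n) \<xi> \<noteq> 0" for \<xi>
  proof -
    \<comment> \<open>On this set the real part of the character exceeds \<open>1/2\<close>, so the
      transform at \<open>\<xi>\<close> has real part at least half the measure of
      \<open>N n\<close>.\<close>
    let ?U = "{x. cmod (char_fun \<xi> x - 1) < 1/2}"
    have "continuous_on UNIV (\<lambda>x. cmod (char_fun \<xi> x - 1))"
      by (intro continuous_intros char_fun_props)
    then have "open ?U" by (intro open_Collect_less) (auto intro: continuous_intros)
    then obtain n where n: "N n \<subseteq> ?U" using N(5)[of ?U] by (auto simp: char_fun_0)
    let ?g = "\<lambda>x. cnj (char_fun \<xi> x) * ?i n x"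
    have [measurable]: "char_fun \<xi> \<in> borel_measurable \<nu>"
      using borel_measurable_continuous_onI[OF char_fun_props(1)] by measurable
    have gi: "integrable \<nu> ?g"
      using Ns by (intro Bochner_Integration.integrable_bound[OF int[of n]])
        (auto simp: norm_mult char_fun_props(2))
    have "measure \<nu> (N n) / 2 = (\<integral>x. indicator (N n) x / 2 \<partial>\<nu>)"
      using Ns by simp
    also have "\<dots> \<le> (\<integral>x. Re (?g x) \<partial>\<nu>)"
    proof (rule integral_mono)
      show "integrable \<nu> (\<lambda>x. indicator (N n) x / 2 :: real)"
        using Ns N(4) by (intro integrable_divide integrable_real_indicator) auto
      show "integrable \<nu> (\<lambda>x. Re (?g x))" using gi by (rule integrable_Re)
      fix x
      show "indicator (N n) x / 2 \<le> Re (?g x)"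
      proof (cases "x \<in> N n")
        case True
        then have "cmod (char_fun \<xi> x - 1) < 1/2" using n by blast
        then have "\<bar>Re (char_fun \<xi> x - 1)\<bar> < 1/2" using abs_Re_le_cmod le_less_trans by blast
        then have "1/2 \<le> Re (char_fun \<xi> x)" by (auto simp: abs_if split: if_splits)
        then show ?thesis using True by simp
      qed simp
    qed
    also have "\<dots> = Re (fourier1 \<nu> (?i n) \<xi>)"
      unfolding fourier1_def by (rule integral_Re[OF gi])
    finally have "measure \<nu> (N n) / 2 \<le> Re (fourier1 \<nu> (?i n) \<xi>)" .
    moreover have "measure \<nu> (N n) > 0"
      using N(3)[of n] N(4)[of n] by (simp add: measure_def enn2real_positive_iff less_top)
    ultimately have "fourier1 \<nu> (?i n) \<xi> \<noteq> 0" by auto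
    then show ?thesis by blast
  qed
  show "sigma_finite_measure \<nu>'"
  proof (rule sigma_finite_if_L2_cover)
    show "?F (?i n) \<in> L2 \<nu>'" for n by (rule unitary_opD(2)[OF fourier_unitary i])
    have "AE \<xi> in \<nu>'. \<forall>n. ?F (?i n) \<xi> = fourier1 \<nu> (?i n) \<xi>"
      using fourier_eq_fourier1[OF i int] by (simp add: AE_all_countable ae_eq_def)
    then show "AE \<xi> in \<nu>'. \<exists>n. ?F (?i n) \<xi> \<noteq> 0"
      by eventually_elim (use nz in metis)
  qed
qed

sublocale dual_pair: pair_sigma_finite \<nu>' \<nu> ..

lemma char_fun_measurable_\<nu>'[measurable]: "(\<lambda>\<xi>. char_fun \<xi> a) \<in> borel_measurable \<nu>'"
  using char_fun_eval_measurable by measurable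

text \<open>
  All characters are approximated simultaneously: on each of countably many translates of a small
  neighbourhood of \<open>0\<close> the character is replaced by its value at the centre.
\<close>

lemma char_fun_jointly_measurable:
  "(\<lambda>z. char_fun (fst z) (snd z)) \<in> borel_measurable (\<nu>' \<Otimes>\<^sub>M \<nu>)"
proof -
  obtain N :: "nat \<Rightarrow> 'g set" where N: "\<And>n. open (N n)" "\<And>n. 0 \<in> N n"
    "\<And>U. open U \<Longrightarrow> 0 \<in> U \<Longrightarrow> \<exists>n0. \<forall>n\<ge>n0. N n \<subseteq> U"
    by (rule neighbourhood_base) blast
  have "\<exists>q::nat \<Rightarrow> 'g. \<forall>x. \<exists>i. x - q i \<in> N n" for n
    by (rule countable_translates_cover[OF N(1,2)])
  then obtain q :: "nat \<Rightarrow> nat \<Rightarrow> 'g" where q: "\<And>n x. \<exists>i. x - q n i \<in> N n" by metis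
  \<comment> \<open>The least index is a measurable selection with countably many values, so
    evaluating the character at the selected centre stays measurable.\<close>
  define i where "i n x = (LEAST i. x - q n i \<in> N n)" for n x
  have iN: "x - q n (i n x) \<in> N n" for n x unfolding i_def by (rule LeastI_ex[OF q])
  have [measurable]: "Measurable.pred \<nu> (\<lambda>x. x - q n j \<in> N n)" for n j
    using open_translate[OF N(1)[of n], of "q n j"] by (simp add: pred_def sets_\<nu>)
  have [measurable]: "i n \<in> measurable \<nu> (count_space UNIV)" for n
    unfolding i_def by measurable
  have "(\<lambda>z. char_fun (fst z) (q n (i n (snd z)))) \<in> borel_measurable (\<nu>' \<Otimes>\<^sub>M \<nu>)" for n
  proof (rule measurable_compose_countable[where f="\<lambda>j z. char_fun (fst z) (q n j)" and g="\<lambda>z. i n (snd z)"])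
    show "(\<lambda>z. char_fun (fst z) (q n j)) \<in> borel_measurable (\<nu>' \<Otimes>\<^sub>M \<nu>)" for j
      using measurable_compose[OF measurable_fst char_fun_measurable_\<nu>'] .
    show "(\<lambda>z. i n (snd z)) \<in> \<nu>' \<Otimes>\<^sub>M \<nu> \<rightarrow>\<^sub>M count_space UNIV" by measurable
  qed
  then show ?thesis
  proof (rule borel_measurable_LIMSEQ_metric)
    fix z assume "z \<in> space (\<nu>' \<Otimes>\<^sub>M \<nu>)"
    obtain \<xi> x where z: "z = (\<xi>, x)" by (cases z)
    show "(\<lambda>n. char_fun (fst z) (q n (i n (snd z)))) \<longlonglongrightarrow> char_fun (fst z) (snd z)"
      unfolding z fst_conv snd_conv
    proof (rule LIMSEQ_I)
      fix e :: real assume e: "e > 0"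
      let ?U = "{x. cmod (char_fun \<xi> x - 1) < e}"
      have "continuous_on UNIV (\<lambda>x. cmod (char_fun \<xi> x - 1))"
        by (intro continuous_intros char_fun_props)
      then have "open ?U" by (intro open_Collect_less) (auto intro: continuous_intros)
      then obtain n0 where n0: "\<forall>n\<ge>n0. N n \<subseteq> ?U" using N(3)[of ?U] e by (auto simp: char_fun_0)
      have "cmod (char_fun \<xi> (q n (i n x)) - char_fun \<xi> x) < e" if "n \<ge> n0" for n
        using n0 that iN[of x n] char_fun_diff_norm[of \<xi> x "q n (i n x)"] by (auto simp: norm_minus_commute)
      then show "\<exists>no. \<forall>n\<ge>no. cmod (char_fun \<xi> (q n (i n x)) - char_fun \<xi> x) < e" by blast
    qed
  qed
qed

text \<open>Fubini moves the characters onto \<open>\<phi>\<close>, so the conjugate of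
  \<open>\<phi>\<close> is orthogonal to the transforms of all \<open>f\<close> in L1 \<inter> L2.
  By surjectivity it is itself a transform, and by unitarity its preimage is orthogonal to a dense
  set.\<close>

lemma fourier_inversion_unique:
  assumes \<phi>: "\<phi> \<in> L2 \<nu>'" "integrable \<nu>' \<phi>"
    and zero: "\<And>a. (\<integral>\<xi>. cnj (char_fun \<xi> a) * \<phi> \<xi> \<partial>\<nu>') = 0"
  shows "ae_eq \<nu>' \<phi> (\<lambda>_. 0)"
proof -
  let ?F = "fourier_L2 \<nu> \<nu>'"
  note Fd = unitary_opD[OF fourier_unitary]
  note [measurable] = char_fun_jointly_measurable L2_measurable[OF \<phi>(1)]
  have orth: "L2_inner \<nu>' (?F f) (\<lambda>\<xi>. cnj (\<phi> \<xi>)) = 0" if f: "f \<in> L2 \<nu>" "integrable \<nu> f" for f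
  proof -
    note [measurable] = L2_measurable[OF f(1)]
    let ?h = "\<lambda>\<xi> x. \<phi> \<xi> * (cnj (char_fun \<xi> x) * f x)"
    have "(\<lambda>z. \<phi> (fst z) * (cnj (char_fun (fst z) (snd z)) * f (snd z))) \<in> borel_measurable (\<nu>' \<Otimes>\<^sub>M \<nu>)"
      by measurable
    then have hm: "case_prod ?h \<in> borel_measurable (\<nu>' \<Otimes>\<^sub>M \<nu>)" by (simp add: split_def)
    have [measurable]: "char_fun \<xi> \<in> borel_measurable \<nu>" for \<xi>
      using borel_measurable_continuous_onI[OF char_fun_props(1)] by measurable
    have ci: "integrable \<nu> (\<lambda>x. cnj (char_fun \<xi> x) * f x)" for \<xi>
      by (rule Bochner_Integration.integrable_bound[OF f(2)]) (auto simp: norm_mult char_fun_props(2))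
    \<comment> \<open>Characters have modulus 1, so the modulus of the integrand is the product of
      \<open>|\<phi> \<xi>|\<close> and \<open>|f x|\<close>; this is where integrability of both
      functions enters.\<close>
    have hint: "integrable (\<nu>' \<Otimes>\<^sub>M \<nu>) (case_prod ?h)"
    proof (rule dual_pair.Fubini_integrable[OF hm])
      have "(\<integral>y. cmod (case_prod ?h (\<xi>, y)) \<partial>\<nu>) = cmod (\<phi> \<xi>) * (\<integral>y. cmod (f y) \<partial>\<nu>)" for \<xi>
        by (simp add: norm_mult char_fun_props(2))
      then show "integrable \<nu>' (\<lambda>\<xi>. \<integral>y. cmod (case_prod ?h (\<xi>, y)) \<partial>\<nu>)" using \<phi>(2) by simp
      show "AE \<xi> in \<nu>'. integrable \<nu> (\<lambda>y. case_prod ?h (\<xi>, y))" using ci by simp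
    qed
    have "L2_inner \<nu>' (?F f) (\<lambda>\<xi>. cnj (\<phi> \<xi>)) = (\<integral>\<xi>. fourier1 \<nu> f \<xi> * \<phi> \<xi> \<partial>\<nu>')"
      unfolding L2_inner_def complex_cnj_cnj
    proof (rule integral_cong_AE)
      note [measurable] = L2_measurable[OF Fd(2)[OF f(1)]]
      show "(\<lambda>\<xi>. ?F f \<xi> * \<phi> \<xi>) \<in> borel_measurable \<nu>'" by measurable
      have "(\<lambda>\<xi>. \<integral>x. cnj (char_fun (fst (\<xi>, x)) (snd (\<xi>, x))) * f x \<partial>\<nu>) \<in> borel_measurable \<nu>'"
        by measurable
      then show "(\<lambda>\<xi>. fourier1 \<nu> f \<xi> * \<phi> \<xi>) \<in> borel_measurable \<nu>'"
        unfolding fourier1_def by simp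
      show "AE \<xi> in \<nu>'. ?F f \<xi> * \<phi> \<xi> = fourier1 \<nu> f \<xi> * \<phi> \<xi>"
        using fourier_eq_fourier1[OF f] unfolding ae_eq_def by eventually_elim simp
    qed
    also have "\<dots> = (\<integral>\<xi>. (\<integral>x. ?h \<xi> x \<partial>\<nu>) \<partial>\<nu>')"
      unfolding fourier1_def by (simp add: mult.commute)
    also have "\<dots> = (\<integral>x. (\<integral>\<xi>. ?h \<xi> x \<partial>\<nu>') \<partial>\<nu>)"
      by (rule dual_pair.Fubini_integral[symmetric, OF hint])
    also have "\<dots> = (\<integral>x. f x * (\<integral>\<xi>. cnj (char_fun \<xi> x) * \<phi> \<xi> \<partial>\<nu>') \<partial>\<nu>)"
      by (simp add: mult_ac flip: integral_mult_right_zero)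
    also have "\<dots> = 0" by (simp add: zero)
    finally show ?thesis .
  qed
  have c\<phi>: "(\<lambda>\<xi>. cnj (\<phi> \<xi>)) \<in> L2 \<nu>'" by (rule L2_cnj[OF \<phi>(1)])
  obtain f where f: "f \<in> L2 \<nu>" "ae_eq \<nu>' (?F f) (\<lambda>\<xi>. cnj (\<phi> \<xi>))" using Fd(4)[OF c\<phi>] by blast
  obtain s where s: "\<And>n::nat. s n \<in> L2 \<nu>" "\<And>n. integrable \<nu> (s n)" "L2_lim \<nu> s f"
    using \<nu>.integrable_dense_in_L2[OF f(1)] by blast
  have "L2_inner \<nu> (s n) f = 0" for n
  proof -
    have "L2_inner \<nu> (s n) f = L2_inner \<nu>' (?F (s n)) (?F f)" using Fd(3)[OF s(1) f(1)] by simp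
    also have "\<dots> = L2_inner \<nu>' (?F (s n)) (\<lambda>\<xi>. cnj (\<phi> \<xi>))"
      using f c\<phi> s(1) by (intro L2_inner_cong_ae Fd(2) ae_eq_refl) auto
    also have "\<dots> = 0" by (rule orth[OF s(1,2)])
    finally show ?thesis .
  qed
  moreover have "(\<lambda>n. L2_inner \<nu> (s n) f) \<longlonglongrightarrow> L2_inner \<nu> f f"
    by (rule L2_inner_tendsto_left[OF s(1) f(1) f(1) s(3)])
  ultimately have "L2_inner \<nu> f f = 0" by (simp add: LIMSEQ_const_iff)
  then have "L2_inner \<nu>' (?F f) (?F f) = 0" using Fd(3)[OF f(1) f(1)] by simp
  then have "ae_eq \<nu>' (?F f) (\<lambda>_. 0)"
    using L2_norm_eq_0_iff[OF Fd(2)[OF f(1)]] by (simp add: L2_inner_self)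
  then have "ae_eq \<nu>' (\<lambda>\<xi>. cnj (\<phi> \<xi>)) (\<lambda>_. 0)" using ae_eq_trans[OF ae_eq_sym[OF f(2)]] by blast
  then show ?thesis by (simp add: ae_eq_def)
qed

lemma bounded_op_char_mult:
  "bounded_op \<nu>' (L2 \<nu>') \<nu>' (L2 \<nu>') (\<lambda>f \<xi>. cnj (char_fun \<xi> a) * f \<xi>)"
  by (rule bounded_op_mult[where C=1]) (auto simp: char_fun_props)

text \<open>Both sides are bounded in \<open>f\<close>, so the substitution is carried out for
  integrable \<open>f\<close>, where the transform is an integral. The conjugate in
  \<open>fourier1\<close> makes the character appear conjugated.\<close>

lemma fourier_translation:
  assumes f: "f \<in> L2 \<nu>"
  shows "ae_eq \<nu>' (fourier_L2 \<nu> \<nu>' (\<lambda>x. f (x - a))) (\<lambda>\<xi>. cnj (char_fun \<xi> a) * fourier_L2 \<nu> \<nu>' f \<xi>)"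
proof -
  let ?F = "fourier_L2 \<nu> \<nu>'"
  note Fb = unitary_opD(1)[OF fourier_unitary]
  have tr: "bounded_op \<nu> (L2 \<nu>) \<nu> (L2 \<nu>) (\<lambda>f x. f (x - a))"
    by (rule bounded_op_measure_preserving[OF translation_measurable distr_translation])
  show ?thesis
  proof (rule bounded_op_agree[where K="{f \<in> L2 \<nu>. integrable \<nu> f}" and f=f,
        OF bounded_op_comp[OF tr Fb linear_subspace_L2 linear_subspace_L2]
           bounded_op_comp[OF Fb bounded_op_char_mult linear_subspace_L2 linear_subspace_L2]
           linear_subspace_L2 subset_refl])
    show "\<exists>s. (\<forall>n. s n \<in> {f \<in> L2 \<nu>. integrable \<nu> f}) \<and> L2_lim \<nu> s f" if "f \<in> L2 \<nu>" for f
      using \<nu>.integrable_dense_in_L2[OF that] by simp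
  next
    fix k assume "k \<in> {f \<in> L2 \<nu>. integrable \<nu> f}"
    then have k: "k \<in> L2 \<nu>" "integrable \<nu> k" by auto
    have "integrable (distr \<nu> \<nu> (\<lambda>x. x - a)) k" unfolding distr_translation by (rule k)
    then have ki: "integrable \<nu> (\<lambda>x. k (x - a))" by (rule integrable_distr[OF translation_measurable])
    have "fourier1 \<nu> (\<lambda>x. k (x - a)) \<xi> = cnj (char_fun \<xi> a) * fourier1 \<nu> k \<xi>" for \<xi>
    proof -
      have [measurable]: "char_fun \<xi> \<in> borel_measurable \<nu>"
        using borel_measurable_continuous_onI[OF char_fun_props(1)] by measurable
      note [measurable] = L2_measurable[OF k(1)]
      have "char_fun \<xi> x = char_fun \<xi> (x - a) * char_fun \<xi> a" for x
        using char_fun_props(3)[of \<xi> "x - a" a] by simp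
      then have "fourier1 \<nu> (\<lambda>x. k (x - a)) \<xi>
          = (\<integral>x. cnj (char_fun \<xi> a) * (cnj (char_fun \<xi> (x - a)) * k (x - a)) \<partial>\<nu>)"
        unfolding fourier1_def by (metis (no_types, opaque_lifting) complex_cnj_mult mult.assoc mult.commute)
      also have "\<dots> = cnj (char_fun \<xi> a) * (\<integral>x. cnj (char_fun \<xi> (x - a)) * k (x - a) \<partial>\<nu>)"
        by simp
      also have "(\<integral>x. cnj (char_fun \<xi> (x - a)) * k (x - a) \<partial>\<nu>)
          = (\<integral>x. cnj (char_fun \<xi> x) * k x \<partial>(distr \<nu> \<nu> (\<lambda>x. x - a)))"
        by (rule integral_distr[symmetric, OF translation_measurable]) measurable
      also have "\<dots> = fourier1 \<nu> k \<xi>" unfolding distr_translation fourier1_def ..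
      finally show ?thesis .
    qed
    then have 1: "fourier1 \<nu> (\<lambda>x. k (x - a)) = (\<lambda>\<xi>. cnj (char_fun \<xi> a) * fourier1 \<nu> k \<xi>)" by blast
    have "ae_eq \<nu>' (?F (\<lambda>x. k (x - a))) (fourier1 \<nu> (\<lambda>x. k (x - a)))"
      by (rule fourier_eq_fourier1[OF bounded_opD(1)[OF tr k(1)] ki])
    also have "ae_eq \<nu>' \<dots> (\<lambda>\<xi>. cnj (char_fun \<xi> a) * ?F k \<xi>)"
      unfolding 1 by (intro ae_eq_mult ae_eq_sym[OF fourier_eq_fourier1[OF k]])
    finally show "ae_eq \<nu>' (?F (\<lambda>x. k (x - a))) (\<lambda>\<xi>. cnj (char_fun \<xi> a) * ?F k \<xi>)" .
  qed (use f in auto)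
qed

end

section \<open>Transfer of commutativity along a unitary\<close>

section \<open>Commutants\<close>

text \<open>Common form of \<open>invariant_ops\<close> on the group side and of the commutant of
  the characters on the dual side, so that one transfer lemma serves both directions.\<close>

definition commutant_ops ::
  "'a measure \<Rightarrow> ('a \<Rightarrow> complex) set \<Rightarrow> ('i \<Rightarrow> ('a \<Rightarrow> complex) \<Rightarrow> ('a \<Rightarrow> complex)) \<Rightarrow>
   (('a \<Rightarrow> complex) \<Rightarrow> ('a \<Rightarrow> complex)) set" where
  "commutant_ops M H \<Phi> =
     {S. bounded_op M H M H S \<and> (\<forall>a. \<forall>f\<in>H. ae_eq M (\<Phi> a (S f)) (S (\<Phi> a f)))}"

text \<open>Conjugation \<open>S \<mapsto> U S W\<close> carries the first commutant into the
  second. Inverse and intertwining relations hold up to null sets only, so each use inside a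
  composition invokes compatibility of the outer operator with \<open>ae_eq\<close>.\<close>

lemma commutative_commutant_transfer:
  assumes U: "bounded_op M H N K U" and W: "bounded_op N K M H W"
    and WU: "\<And>f. f \<in> H \<Longrightarrow> ae_eq M (W (U f)) f" and UW: "\<And>k. k \<in> K \<Longrightarrow> ae_eq N (U (W k)) k"
    and H: "linear_subspace M H" and K: "linear_subspace N K"
    and \<Phi>: "\<And>a f. f \<in> H \<Longrightarrow> \<Phi> a f \<in> H"
    and \<Psi>: "\<And>a k. k \<in> K \<Longrightarrow> \<Psi> a k \<in> K" "\<And>a k l. k \<in> K \<Longrightarrow> l \<in> K \<Longrightarrow> ae_eq N k l \<Longrightarrow> ae_eq N (\<Psi> a k) (\<Psi> a l)"
    and intertwine: "\<And>a f. f \<in> H \<Longrightarrow> ae_eq N (U (\<Phi> a f)) (\<Psi> a (U f))"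
    and comm: "commutative_ops N K (commutant_ops N K \<Psi>)"
  shows "commutative_ops M H (commutant_ops M H \<Phi>)"
  unfolding commutative_ops_def
proof (intro ballI)
  note Ud = bounded_opD(1,2)[OF U] and Wd = bounded_opD(1,2)[OF W]
  \<comment> \<open>The intertwining relation is assumed for \<open>U\<close>; applying
    \<open>W\<close> to it gives the relation for the inverse.\<close>
  have W_intertwine: "ae_eq M (\<Phi> a (W k)) (W (\<Psi> a k))" if k: "k \<in> K" for a k
  proof -
    have \<Phi>W: "\<Phi> a (W k) \<in> H" by (rule \<Phi>[OF Wd(1)[OF k]])
    have "ae_eq N (U (\<Phi> a (W k))) (\<Psi> a k)"
      by (rule ae_eq_trans[OF intertwine[OF Wd(1)[OF k]] \<Psi>(2)[OF Ud(1)[OF Wd(1)[OF k]] k UW[OF k]]])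
    then have "ae_eq M (W (U (\<Phi> a (W k)))) (W (\<Psi> a k))"
      by (rule Wd(2)[OF Ud(1)[OF \<Phi>W] \<Psi>(1)[OF k]])
    then show ?thesis by (rule ae_eq_trans[OF ae_eq_sym[OF WU[OF \<Phi>W]]])
  qed
  have conj: "(\<lambda>k. U (S (W k))) \<in> commutant_ops N K \<Psi>" if S: "S \<in> commutant_ops M H \<Phi>" for S
  proof -
    have Sb: "bounded_op M H M H S" and Sc: "\<And>a f. f \<in> H \<Longrightarrow> ae_eq M (\<Phi> a (S f)) (S (\<Phi> a f))"
      using S by (auto simp: commutant_ops_def)
    note Sd = bounded_opD(1,2)[OF Sb]
    have "bounded_op N K N K (\<lambda>k. U (S (W k)))"
      by (rule bounded_op_comp[OF bounded_op_comp[OF W Sb K H] U K H])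
    moreover have "ae_eq N (\<Psi> a (U (S (W k)))) (U (S (W (\<Psi> a k))))" if k: "k \<in> K" for a k
    proof -
      have Wk: "W k \<in> H" and W\<Psi>: "W (\<Psi> a k) \<in> H" by (intro Wd(1) \<Psi>(1) k)+
      have "ae_eq N (\<Psi> a (U (S (W k)))) (U (\<Phi> a (S (W k))))"
        by (rule ae_eq_sym[OF intertwine[OF Sd(1)[OF Wk]]])
      also have "ae_eq N \<dots> (U (S (\<Phi> a (W k))))"
        by (rule Ud(2)[OF \<Phi>[OF Sd(1)[OF Wk]] Sd(1)[OF \<Phi>[OF Wk]] Sc[OF Wk]])
      also have "ae_eq N \<dots> (U (S (W (\<Psi> a k))))"
        by (rule Ud(2)[OF Sd(1)[OF \<Phi>[OF Wk]] Sd(1)[OF W\<Psi>] Sd(2)[OF \<Phi>[OF Wk] W\<Psi> W_intertwine[OF k]]])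
      finally show ?thesis .
    qed
    ultimately show ?thesis by (simp add: commutant_ops_def)
  qed
  fix S T f assume S: "S \<in> commutant_ops M H \<Phi>" and T: "T \<in> commutant_ops M H \<Phi>" and f: "f \<in> H"
  \<comment> \<open>Both occurrences of \<open>W U\<close> cancel, so commutation of the conjugates
    at \<open>U f\<close> is the image under \<open>U\<close> of commutation of \<open>S\<close> and
    \<open>T\<close> at \<open>f\<close>.\<close>
  have key: "ae_eq N (U (S (W (U (T (W (U f))))))) (U (S (T f)))"
    if S: "S \<in> commutant_ops M H \<Phi>" and T: "T \<in> commutant_ops M H \<Phi>" for S T
  proof -
    have Sb: "bounded_op M H M H S" and Tb: "bounded_op M H M H T" using S T by (auto simp: commutant_ops_def)
    note Sd = bounded_opD(1,2)[OF Sb] and Td = bounded_opD(1,2)[OF Tb]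
    have WUf: "W (U f) \<in> H" by (intro Wd(1) Ud(1) f)
    have WUT: "W (U (T (W (U f)))) \<in> H" by (intro Wd(1) Ud(1) Td(1) f)
    have "ae_eq M (W (U (T (W (U f))))) (T f)"
      by (rule ae_eq_trans[OF WU[OF Td(1)[OF WUf]] Td(2)[OF WUf f WU[OF f]]])
    then have "ae_eq M (S (W (U (T (W (U f)))))) (S (T f))"
      by (rule Sd(2)[OF WUT Td(1)[OF f]])
    then show ?thesis by (rule Ud(2)[OF Sd(1)[OF WUT] Sd(1)[OF Td(1)[OF f]]])
  qed
  have Hm: "S (T f) \<in> H" "T (S f) \<in> H"
    using S T f by (auto simp: commutant_ops_def dest: bounded_opD(1))
  have "ae_eq N (U (S (W (U (T (W (U f))))))) (U (T (W (U (S (W (U f)))))))"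
    using comm[unfolded commutative_ops_def, rule_format, OF conj[OF S] conj[OF T] Ud(1)[OF f]] .
  then have "ae_eq N (U (S (T f))) (U (T (S f)))"
    using ae_eq_trans[OF ae_eq_sym[OF key[OF S T]]] ae_eq_trans[OF _ key[OF T S]] by blast
  then have "ae_eq M (W (U (S (T f)))) (W (U (T (S f))))"
    by (rule Wd(2)[OF Ud(1)[OF Hm(1)] Ud(1)[OF Hm(2)]])
  then show "ae_eq M (S (T f)) (T (S f))"
    using ae_eq_trans[OF ae_eq_sym[OF WU[OF Hm(1)]]] ae_eq_trans[OF _ WU[OF Hm(2)]] by blast
qed

section \<open>A single projection: fixed vectors and the identity that excludes orthonormal
  pairs\<close>

section \<open>Ranges of orthogonal projections\<close>

lemma orth_projectionD:
  assumes "orth_projection M Q"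
  shows "bounded_op M (L2 M) M (L2 M) Q" "f \<in> L2 M \<Longrightarrow> ae_eq M (Q (Q f)) (Q f)"
    "f \<in> L2 M \<Longrightarrow> g \<in> L2 M \<Longrightarrow> L2_inner M (Q f) g = L2_inner M f (Q g)"
    "f \<in> L2 M \<Longrightarrow> Q f \<in> L2 M"
  using assms bounded_opD(1)[of M "L2 M" M "L2 M" Q f] unfolding orth_projection_def by auto

text \<open>Idempotence makes range vectors fixed vectors, so membership becomes an equation that
  can be checked in almost every fibre.\<close>

lemma op_range_fixed:
  assumes Q: "orth_projection M Q" and g: "g \<in> op_range M Q"
  shows "g \<in> L2 M" "ae_eq M (Q g) g"
proof -
  note Qd = orth_projectionD[OF Q]
  show gL: "g \<in> L2 M" using g by (simp add: op_range_def)
  obtain f where f: "f \<in> L2 M" "ae_eq M (Q f) g" using g by (auto simp: op_range_def)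
  have "ae_eq M (Q g) (Q (Q f))" by (rule bounded_opD(2)[OF Qd(1) gL Qd(4)[OF f(1)] ae_eq_sym[OF f(2)]])
  then show "ae_eq M (Q g) g" using ae_eq_trans[OF _ ae_eq_trans[OF Qd(2)[OF f(1)] f(2)]] by blast
qed

lemma op_rangeI: "g \<in> L2 M \<Longrightarrow> ae_eq M (Q g) g \<Longrightarrow> g \<in> op_range M Q"
  unfolding op_range_def by blast

lemma op_range_subspace:
  assumes Q: "orth_projection M Q"
  shows "linear_subspace M (op_range M Q)"
  unfolding linear_subspace_def
proof (intro conjI ballI allI)
  note Qd = orth_projectionD[OF Q]
  show "op_range M Q \<subseteq> L2 M" by (auto simp: op_range_def)
  have "ae_eq M (Q (\<lambda>x. 0 * 0)) (\<lambda>x. 0 * Q (\<lambda>x. 0) x)" by (rule bounded_opD(4)[OF Qd(1) L2_zero])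
  then show "(\<lambda>x. 0) \<in> op_range M Q" by (intro op_rangeI) auto
  fix f assume f: "f \<in> op_range M Q"
  note ff = op_range_fixed[OF Q f]
  show "(\<lambda>x. f x + g x) \<in> op_range M Q" if g: "g \<in> op_range M Q" for g
  proof (rule op_rangeI)
    note gg = op_range_fixed[OF Q g]
    show "(\<lambda>x. f x + g x) \<in> L2 M" by (rule L2_add[OF ff(1) gg(1)])
    show "ae_eq M (Q (\<lambda>x. f x + g x)) (\<lambda>x. f x + g x)"
      by (rule ae_eq_trans[OF bounded_opD(3)[OF Qd(1) ff(1) gg(1)] ae_eq_add[OF ff(2) gg(2)]])
  qed
  show "(\<lambda>x. c * f x) \<in> op_range M Q" for c
  proof (rule op_rangeI)
    show "(\<lambda>x. c * f x) \<in> L2 M" by (rule L2_scale[OF ff(1)])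
    show "ae_eq M (Q (\<lambda>x. c * f x)) (\<lambda>x. c * f x)"
      by (rule ae_eq_trans[OF bounded_opD(4)[OF Qd(1) ff(1)] ae_eq_mult[OF ff(2)]])
  qed
qed

text \<open>
  For the projection \<open>Q\<close> the identity says that \<open>\<langle>\<cdot>, c\<rangle> Q d\<close> and \<open>\<langle>\<cdot>, d\<rangle> Q c\<close> commute on \<open>Q d\<close>; applied to
  \<open>d, c\<close> close to an orthonormal pair in the range it would give \<open>1 = 0\<close>.
\<close>

lemma rank_one_identity_excludes_pair:
  assumes Q: "orth_projection M Q" and D: "D \<subseteq> L2 M"
    and dense: "\<And>f. f \<in> L2 M \<Longrightarrow> \<exists>s. (\<forall>n::nat. s n \<in> D) \<and> L2_lim M s f"
    and id: "\<And>c d. c \<in> D \<Longrightarrow> d \<in> D \<Longrightarrow>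
      L2_inner M (Q d) d * L2_inner M (Q c) c * L2_inner M (Q d) d
      = L2_inner M (Q d) c * L2_inner M (Q d) d * L2_inner M (Q c) d"
    and xy: "x \<in> op_range M Q" "y \<in> op_range M Q" "L2_inner M x x = 1" "L2_inner M y y = 1"
  shows "L2_inner M x y \<noteq> 0"
proof
  assume orth: "L2_inner M x y = 0"
  note Qd = orth_projectionD[OF Q]
  note x = op_range_fixed[OF Q xy(1)] and y = op_range_fixed[OF Q xy(2)]
  obtain d where d: "\<And>n::nat. d n \<in> D" "L2_lim M d x" using dense[OF x(1)] by blast
  obtain c where c: "\<And>n::nat. c n \<in> D" "L2_lim M c y" using dense[OF y(1)] by blast
  have dL: "d n \<in> L2 M" and cL: "c n \<in> L2 M" for n using d c D by auto
  \<comment> \<open>When the limit vector is fixed by \<open>Q\<close>, the projection disappears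
    from the limit of the inner products.\<close>
  have lim: "(\<lambda>n. L2_inner M (Q (s n)) (t n)) \<longlonglongrightarrow> L2_inner M f g"
    if "\<And>n. s n \<in> L2 M" "f \<in> L2 M" "L2_lim M s f" "ae_eq M (Q f) f"
      "\<And>n. t n \<in> L2 M" "g \<in> L2 M" "L2_lim M t g"
    for s t :: "nat \<Rightarrow> 'a \<Rightarrow> complex" and f g
  proof -
    have "(\<lambda>n. L2_inner M (Q (s n)) (t n)) \<longlonglongrightarrow> L2_inner M (Q f) g"
      by (rule L2_inner_tendsto[OF Qd(4)[OF that(1)] Qd(4)[OF that(2)]
            bounded_op_tendsto[OF Qd(1) linear_subspace_L2 subset_refl that(1,2,3)] that(5,6,7)])
    moreover have "L2_inner M (Q f) g = L2_inner M f g"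
      by (rule L2_inner_cong_ae[OF Qd(4)[OF that(2)] that(6) that(2) that(6) that(4) ae_eq_refl])
    ultimately show ?thesis by simp
  qed
  note dd = lim[OF dL x(1) d(2) x(2) dL x(1) d(2)] and cc = lim[OF cL y(1) c(2) y(2) cL y(1) c(2)]
    and dc = lim[OF dL x(1) d(2) x(2) cL y(1) c(2)] and cd = lim[OF cL y(1) c(2) y(2) dL x(1) d(2)]
  have "(\<lambda>n. L2_inner M (Q (d n)) (d n) * L2_inner M (Q (c n)) (c n) * L2_inner M (Q (d n)) (d n))
      \<longlonglongrightarrow> L2_inner M x x * L2_inner M y y * L2_inner M x x"
    by (intro tendsto_mult dd cc)
  moreover have "(\<lambda>n. L2_inner M (Q (d n)) (d n) * L2_inner M (Q (c n)) (c n) * L2_inner M (Q (d n)) (d n))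
      \<longlonglongrightarrow> L2_inner M x y * L2_inner M x x * L2_inner M y x"
    unfolding id[OF c(1) d(1)] by (intro tendsto_mult dd dc cd)
  ultimately have "L2_inner M x x * L2_inner M y y * L2_inner M x x = L2_inner M x y * L2_inner M x x * L2_inner M y x"
    by (rule LIMSEQ_unique)
  then show False using xy(3,4) orth by simp
qed

section \<open>The Fourier side: the image of \<open>H\<close>, its fibres, and the commutant of the
  characters\<close>

section \<open>The Fourier image of an invariant subspace\<close>

locale invariant_subspace = fourier_pair \<nu> \<nu>'
  for \<nu> :: "'g::{topological_ab_group_add, t2_space} measure" and \<nu>' :: "'g dual measure" +
  fixes Y :: "'y measure" and H :: "('g \<times> 'y \<Rightarrow> complex) set"
    and Phat :: "'g dual \<Rightarrow> ('y \<Rightarrow> complex) \<Rightarrow> ('y \<Rightarrow> complex)"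
  assumes sigma_finite_Y: "sigma_finite_measure Y"
    and separable_Y: "separable_L2 Y"
    and closed_H: "closed_subspace (\<nu> \<Otimes>\<^sub>M Y) H"
    and invariant_H: "\<And>a f. f \<in> H \<Longrightarrow> translation a f \<in> H"
    and projections: "\<And>\<xi>. orth_projection Y (Phat \<xi>)"
    and decomposition: "direct_integral_op \<nu>' Y (fourier_projection \<nu> \<nu>' Y H) Phat"
begin

sublocale Y: sigma_finite_measure Y by (rule sigma_finite_Y)
sublocale tensor_setup \<nu> \<nu>' Y by unfold_locales (rule separable_Y)

abbreviation "GY \<equiv> \<nu> \<Otimes>\<^sub>M Y"
abbreviation "DY \<equiv> \<nu>' \<Otimes>\<^sub>M Y"
abbreviation "FI \<equiv> tensor_id \<nu> \<nu>' Y (fourier_L2 \<nu> \<nu>')"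
abbreviation "FI_adj \<equiv> adjoint_op GY DY FI"
abbreviation "PF \<equiv> fourier_projection \<nu> \<nu>' Y H"

definition "char_mult a f = (\<lambda>z::'g dual \<times> 'y. cnj (char_fun (fst z) a) * f z)"

text \<open>The image of \<open>H\<close> under \<open>FI\<close>, written as a preimage under the
  inverse. In this form it is stable under changes on null sets, and its subspace properties are
  inherited from \<open>H\<close>.\<close>

definition "Hhat = {k \<in> L2 DY. FI_adj k \<in> H}"

lemmas FI = tensor_id_unitary[OF fourier_unitary]
lemmas FId = unitary_opD[OF FI(1)]
lemmas FI_adj = adjoint_op_unitary[OF FI(1)]
lemmas Hd = linear_subspaceD[OF closed_subspace_linear[OF closed_H]]

lemma translation_preserves:
  "(\<lambda>z. (fst z - a, snd z)) \<in> measurable GY GY" "distr GY GY (\<lambda>z. (fst z - a, snd z)) = GY"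
proof -
  show "(\<lambda>z. (fst z - a, snd z)) \<in> measurable GY GY"
    using measurable_compose[OF measurable_fst translation_measurable] by measurable
  have "distr \<nu> \<nu> (\<lambda>x. x - a) \<Otimes>\<^sub>M distr Y Y (\<lambda>y. y) = distr GY GY (\<lambda>(x, y). (x - a, y))"
    by (rule pair_measure_distr[OF translation_measurable])
       (auto simp: distr_id2[OF refl] sigma_finite_Y)
  then show "distr GY GY (\<lambda>z. (fst z - a, snd z)) = GY"
    by (simp add: distr_translation distr_id2[OF refl] split_def)
qed

lemma translation_alt: "translation a f = (\<lambda>z. f (fst z - a, snd z))"
  by (auto simp: translation_def)

lemma bounded_op_translation: "bounded_op GY (L2 GY) GY (L2 GY) (translation a)"
  using bounded_op_measure_preserving[OF translation_preserves] by (simp add: translation_alt[abs_def])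

lemma char_mult_bounded: "bounded_op DY (L2 DY) DY (L2 DY) (char_mult a)"
  unfolding char_mult_def[abs_def]
  by (rule bounded_op_mult[where C=1]) (auto simp: char_fun_props)

lemma ae_eq_fibre:
  assumes "f \<in> L2 DY" "g \<in> L2 DY"
  shows "ae_eq DY f g \<longleftrightarrow> (AE \<xi> in \<nu>'. ae_eq Y (\<lambda>v. f (\<xi>, v)) (\<lambda>v. g (\<xi>, v)))"
  by (rule NY.ae_eq_pair_iff[OF L2_measurable[OF assms(1)] L2_measurable[OF assms(2)]])

text \<open>Both sides are bounded in \<open>f\<close>, and translation of a tensor affects only its
  first factor, so the claim reduces to the transform on the group.\<close>

lemma FI_translation:
  assumes f: "f \<in> L2 GY"
  shows "ae_eq DY (FI (translation a f)) (char_mult a (FI f))"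
proof (rule agree_if_agree_on_tensors[OF
      bounded_op_comp[OF bounded_op_translation FId(1) linear_subspace_L2 linear_subspace_L2]
      bounded_op_comp[OF FId(1) char_mult_bounded linear_subspace_L2 linear_subspace_L2] _ f])
  fix f g assume f: "f \<in> L2 \<nu>" and g: "g \<in> L2 Y"
  let ?F = "fourier_L2 \<nu> \<nu>'"
  have tr: "(\<lambda>x. f (x - a)) \<in> L2 \<nu>"
    by (rule bounded_opD(1)[OF bounded_op_measure_preserving[OF translation_measurable distr_translation] f])
  have Ff: "?F f \<in> L2 \<nu>'" by (rule unitary_opD(2)[OF fourier_unitary f])
  have Ftr: "?F (\<lambda>x. f (x - a)) \<in> L2 \<nu>'" by (rule unitary_opD(2)[OF fourier_unitary tr])
  have cF: "(\<lambda>\<xi>. cnj (char_fun \<xi> a) * ?F f \<xi>) \<in> L2 \<nu>'" by (rule bounded_opD(1)[OF bounded_op_char_mult Ff])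
  have "translation a (\<lambda>(u, v). f u * g v) = (\<lambda>(u, v). f (u - a) * g v)"
    by (auto simp: translation_def)
  then have "ae_eq DY (FI (translation a (\<lambda>(u, v). f u * g v))) (\<lambda>(\<xi>, v). ?F (\<lambda>x. f (x - a)) \<xi> * g v)"
    using FI(2)[OF tr g] by simp
  also have "ae_eq DY \<dots> (\<lambda>(\<xi>, v). (cnj (char_fun \<xi> a) * ?F f \<xi>) * g v)"
    unfolding ae_eq_fibre[OF NY.L2_tensor[OF Ftr g] NY.L2_tensor[OF cF g]]
    using fourier_translation[OF f, of a] unfolding ae_eq_def[of \<nu>']
    by eventually_elim simp
  also have "(\<lambda>(\<xi>, v). (cnj (char_fun \<xi> a) * ?F f \<xi>) * g v) = char_mult a (\<lambda>(\<xi>, v). ?F f \<xi> * g v)"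
    by (auto simp: char_mult_def)
  also have "ae_eq DY \<dots> (char_mult a (FI (\<lambda>(u, v). f u * g v)))"
    unfolding char_mult_def by (intro ae_eq_mult ae_eq_sym[OF FI(2)[OF f g]])
  finally show "ae_eq DY (FI (translation a (\<lambda>(u, v). f u * g v))) (char_mult a (FI (\<lambda>(u, v). f u * g v)))" .
qed

lemma FI_in_Hhat:
  assumes h: "h \<in> H"
  shows "FI h \<in> Hhat"
proof -
  have hL: "h \<in> L2 GY" by (rule Hd(1)[OF h])
  have "FI_adj (FI h) \<in> H"
    by (rule closed_subspace_ae[OF closed_H h FI_adj(1)[OF FId(2)[OF hL]] ae_eq_sym[OF FI_adj(3)[OF hL]]])
  then show ?thesis using FId(2)[OF hL] by (simp add: Hhat_def)
qed

lemma Hhat_closed: "closed_subspace DY Hhat"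
  unfolding closed_subspace_def
proof (intro conjI ballI allI impI)
  show "Hhat \<subseteq> L2 DY" by (auto simp: Hhat_def)
  have "ae_eq GY (FI_adj (\<lambda>x. 0 * 0)) (\<lambda>x. 0 * FI_adj (\<lambda>x. 0) x)"
    by (rule bounded_opD(4)[OF FI_adj(4) L2_zero])
  then have "ae_eq GY (FI_adj (\<lambda>x. 0)) (\<lambda>x. 0)" by simp
  then have "ae_eq GY (\<lambda>x. 0) (FI_adj (\<lambda>x. 0))" by (rule ae_eq_sym)
  then have "FI_adj (\<lambda>x. 0) \<in> H" by (rule closed_subspace_ae[OF closed_H Hd(2) FI_adj(1)[OF L2_zero]])
  then show "(\<lambda>x. 0) \<in> Hhat" by (simp add: Hhat_def)
next
  fix f g assume "f \<in> Hhat" "g \<in> Hhat"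
  then have f: "f \<in> L2 DY" "FI_adj f \<in> H" and g: "g \<in> L2 DY" "FI_adj g \<in> H" by (auto simp: Hhat_def)
  have "FI_adj (\<lambda>x. f x + g x) \<in> H"
    by (rule closed_subspace_ae[OF closed_H Hd(3)[OF f(2) g(2)] FI_adj(1)[OF L2_add[OF f(1) g(1)]]
          ae_eq_sym[OF bounded_opD(3)[OF FI_adj(4) f(1) g(1)]]])
  then show "(\<lambda>x. f x + g x) \<in> Hhat" using L2_add[OF f(1) g(1)] by (simp add: Hhat_def)
next
  fix c f assume "f \<in> Hhat"
  then have f: "f \<in> L2 DY" "FI_adj f \<in> H" by (auto simp: Hhat_def)
  have "FI_adj (\<lambda>x. c * f x) \<in> H"
    by (rule closed_subspace_ae[OF closed_H Hd(4)[OF f(2)] FI_adj(1)[OF L2_scale[OF f(1)]]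
          ae_eq_sym[OF bounded_opD(4)[OF FI_adj(4) f(1)]]])
  then show "(\<lambda>x. c * f x) \<in> Hhat" using L2_scale[OF f(1)] by (simp add: Hhat_def)
next
  fix s f assume f: "f \<in> L2 DY" and s: "\<forall>n::nat. s n \<in> Hhat"
    and lim: "L2_lim DY s f"
  have sL: "s n \<in> L2 DY" "FI_adj (s n) \<in> H" for n using s by (auto simp: Hhat_def)
  have "FI_adj f \<in> H"
    by (rule closed_subspace_limit[OF closed_H FI_adj(1)[OF f] sL(2)
          bounded_op_tendsto[OF FI_adj(4) linear_subspace_L2 subset_refl sL(1) f lim]])
  then show "f \<in> Hhat" using f by (simp add: Hhat_def)
qed

lemmas Hhatd = linear_subspaceD[OF closed_subspace_linear[OF Hhat_closed]]

lemma FI_bounded_H: "bounded_op GY H DY Hhat FI"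
  by (rule bounded_op_restrict[OF FId(1)]) (auto intro: Hd(1) FI_in_Hhat)

lemma FI_adj_bounded_Hhat: "bounded_op DY Hhat GY H FI_adj"
  by (rule bounded_op_restrict[OF FI_adj(4)]) (auto simp: Hhat_def)

lemma PF_alt: "PF = (\<lambda>f. FI (proj_onto GY H (FI_adj f)))"
  by (auto simp: fourier_projection_def Let_def)

lemma PF_bounded: "bounded_op DY (L2 DY) DY Hhat PF"
  unfolding PF_alt
  by (rule bounded_op_comp[OF bounded_op_comp[OF FI_adj(4) proj_onto_bounded[OF closed_H] linear_subspace_L2 linear_subspace_L2]
        FI_bounded_H linear_subspace_L2 closed_subspace_linear[OF closed_H]])

lemma PF_in_Hhat: "f \<in> L2 DY \<Longrightarrow> PF f \<in> Hhat"
  by (rule bounded_opD(1)[OF PF_bounded])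

lemma PF_fixes_Hhat:
  assumes "f \<in> Hhat"
  shows "ae_eq DY (PF f) f"
proof -
  have f: "f \<in> L2 DY" "FI_adj f \<in> H" using assms by (auto simp: Hhat_def)
  have "ae_eq GY (proj_onto GY H (FI_adj f)) (FI_adj f)" by (rule proj_onto_id[OF closed_H f(2)])
  then have "ae_eq DY (PF f) (FI (FI_adj f))"
    unfolding PF_alt
    by (rule bounded_opD(2)[OF FId(1) Hd(1)[OF proj_onto_props(1)[OF closed_H FI_adj(1)[OF f(1)]]] FI_adj(1)[OF f(1)]])
  then show ?thesis by (rule ae_eq_trans[OF _ FI_adj(2)[OF f(1)]])
qed

lemma PF_fibre: "f \<in> L2 DY \<Longrightarrow> AE \<xi> in \<nu>'. ae_eq Y (\<lambda>v. PF f (\<xi>, v)) (Phat \<xi> (\<lambda>v. f (\<xi>, v)))"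
  using decomposition unfolding direct_integral_op_def by blast

text \<open>Membership means being fixed by \<open>PF\<close>, and \<open>PF\<close> acts on almost
  every fibre as \<open>Phat \<xi>\<close>.\<close>

lemma Hhat_iff_fibre:
  assumes u: "u \<in> L2 DY"
  shows "u \<in> Hhat \<longleftrightarrow> (AE \<xi> in \<nu>'. ae_eq Y (Phat \<xi> (\<lambda>v. u (\<xi>, v))) (\<lambda>v. u (\<xi>, v)))"
proof
  assume "u \<in> Hhat"
  then have "AE \<xi> in \<nu>'. ae_eq Y (\<lambda>v. PF u (\<xi>, v)) (\<lambda>v. u (\<xi>, v))"
    using PF_fixes_Hhat ae_eq_fibre[OF Hhatd(1)[OF PF_in_Hhat[OF u]] u] by blast
  with PF_fibre[OF u] show "AE \<xi> in \<nu>'. ae_eq Y (Phat \<xi> (\<lambda>v. u (\<xi>, v))) (\<lambda>v. u (\<xi>, v))"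
    by eventually_elim (blast intro: ae_eq_trans ae_eq_sym)
next
  assume "AE \<xi> in \<nu>'. ae_eq Y (Phat \<xi> (\<lambda>v. u (\<xi>, v))) (\<lambda>v. u (\<xi>, v))"
  with PF_fibre[OF u] have "AE \<xi> in \<nu>'. ae_eq Y (\<lambda>v. PF u (\<xi>, v)) (\<lambda>v. u (\<xi>, v))"
    by eventually_elim (blast intro: ae_eq_trans)
  then have "ae_eq DY (PF u) u" using ae_eq_fibre[OF Hhatd(1)[OF PF_in_Hhat[OF u]] u] by blast
  then show "u \<in> Hhat" by (rule closed_subspace_ae[OF Hhat_closed PF_in_Hhat[OF u] u])
qed

lemma Hhat_section:
  assumes "u \<in> Hhat"
  shows "AE \<xi> in \<nu>'. (\<lambda>v. u (\<xi>, v)) \<in> op_range Y (Phat \<xi>)"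
  using NY.L2_pair_section[OF Hhatd(1)[OF assms]] assms[unfolded Hhat_iff_fibre[OF Hhatd(1)[OF assms]]]
  by eventually_elim (rule op_rangeI)

lemma L2_fst_mult:
  assumes "u \<in> L2 DY" "m \<in> borel_measurable \<nu>'" "\<And>\<xi>. cmod (m \<xi>) \<le> C"
  shows "(\<lambda>z. m (fst z) * u z) \<in> L2 DY"
  by (rule L2_mult_bounded[OF assms(1), where C=C]) (use assms in auto)

text \<open>In each fibre the multiplication is by a scalar, and the range of
  \<open>Phat \<xi>\<close> is a linear subspace. Characters, truncations and the coefficients of
  the commutation argument are all multipliers of this kind.\<close>

lemma Hhat_mult:
  assumes u: "u \<in> Hhat" and m: "m \<in> borel_measurable \<nu>'" "\<And>\<xi>. cmod (m \<xi>) \<le> C"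
  shows "(\<lambda>z. m (fst z) * u z) \<in> Hhat"
proof -
  have L: "(\<lambda>z. m (fst z) * u z) \<in> L2 DY" by (rule L2_fst_mult[OF Hhatd(1)[OF u] m])
  show ?thesis
    unfolding Hhat_iff_fibre[OF L]
    using Hhat_section[OF u]
  proof eventually_elim
    case (elim \<xi>)
    from op_range_fixed[OF projections linear_subspaceD(4)[OF op_range_subspace[OF projections] elim, of "m \<xi>"]]
    show ?case by simp
  qed
qed

lemma char_mult_Hhat: "u \<in> Hhat \<Longrightarrow> char_mult a u \<in> Hhat"
  unfolding char_mult_def
  by (rule Hhat_mult[where C=1]) (auto simp: char_fun_props)

abbreviation "Vhat \<equiv> commutant_ops DY Hhat char_mult"

text \<open>Since \<open>H\<close> is invariant, compressed translations agree with translations on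
  \<open>H\<close>, and \<open>FI\<close> carries these to the characters. The equivalence is the
  one-sided transfer, used with \<open>FI\<close> and with its inverse.\<close>

lemma commutative_iff_Vhat:
  "commutative_ops GY H (invariant_ops \<nu> Y H) \<longleftrightarrow> commutative_ops DY Hhat Vhat"
proof -
  let ?\<Phi> = "compressed_translation \<nu> Y H"
  have V: "invariant_ops \<nu> Y H = commutant_ops GY H ?\<Phi>"
    unfolding invariant_ops_def commutant_ops_def ..
  have linH: "linear_subspace GY H" and linHhat: "linear_subspace DY Hhat"
    by (intro closed_subspace_linear closed_H Hhat_closed)+
  have \<Phi>eq: "ae_eq GY (?\<Phi> a f) (translation a f)" if "f \<in> H" for a f
    unfolding compressed_translation_def by (rule proj_onto_id[OF closed_H invariant_H[OF that]])
  have \<Phi>: "?\<Phi> a f \<in> H" if "f \<in> H" for a f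
    unfolding compressed_translation_def
    by (rule proj_onto_props(1)[OF closed_H Hd(1)[OF invariant_H[OF that]]])
  have \<Phi>cong: "ae_eq GY (?\<Phi> a f) (?\<Phi> a g)" if "f \<in> H" "g \<in> H" "ae_eq GY f g" for a f g
    using bounded_opD(2)[OF bounded_op_translation Hd(1)[OF that(1)] Hd(1)[OF that(2)] that(3)]
      \<Phi>eq[OF that(1)] \<Phi>eq[OF that(2)] by (blast intro: ae_eq_trans ae_eq_sym)
  have \<Psi>cong: "ae_eq DY (char_mult a k) (char_mult a l)" if "ae_eq DY k l" for a k l
    unfolding char_mult_def by (rule ae_eq_mult[OF that])
  have int: "ae_eq DY (FI (?\<Phi> a f)) (char_mult a (FI f))" if f: "f \<in> H" for a f
    by (rule ae_eq_trans[OF bounded_opD(2)[OF FI_bounded_H \<Phi>[OF f] invariant_H[OF f] \<Phi>eq[OF f]]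
          FI_translation[OF Hd(1)[OF f]]])
  have UW: "ae_eq DY (FI (FI_adj k)) k" if "k \<in> Hhat" for k by (rule FI_adj(2)[OF Hhatd(1)[OF that]])
  have WU: "ae_eq GY (FI_adj (FI f)) f" if "f \<in> H" for f by (rule FI_adj(3)[OF Hd(1)[OF that]])
  have int': "ae_eq GY (FI_adj (char_mult a k)) (?\<Phi> a (FI_adj k))" if k: "k \<in> Hhat" for a k
  proof -
    have W: "FI_adj k \<in> H" by (rule bounded_opD(1)[OF FI_adj_bounded_Hhat k])
    have "ae_eq DY (char_mult a k) (char_mult a (FI (FI_adj k)))" by (rule \<Psi>cong[OF ae_eq_sym[OF UW[OF k]]])
    also have "ae_eq DY \<dots> (FI (?\<Phi> a (FI_adj k)))" by (rule ae_eq_sym[OF int[OF W]])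
    finally have "ae_eq GY (FI_adj (char_mult a k)) (FI_adj (FI (?\<Phi> a (FI_adj k))))"
      by (rule bounded_opD(2)[OF FI_adj_bounded_Hhat char_mult_Hhat[OF k] FI_in_Hhat[OF \<Phi>[OF W]]])
    then show ?thesis by (rule ae_eq_trans[OF _ WU[OF \<Phi>[OF W]]])
  qed
  show ?thesis
    unfolding V
  proof
    assume comm: "commutative_ops GY H (commutant_ops GY H ?\<Phi>)"
    show "commutative_ops DY Hhat Vhat"
      by (rule commutative_commutant_transfer[where U=FI_adj and W=FI and \<Phi>=char_mult and \<Psi>="?\<Phi>",
            OF FI_adj_bounded_Hhat FI_bounded_H UW WU linHhat linH char_mult_Hhat \<Phi> \<Phi>cong int' comm])
  next
    assume comm: "commutative_ops DY Hhat Vhat"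
    show "commutative_ops GY H (commutant_ops GY H ?\<Phi>)"
      by (rule commutative_commutant_transfer[where U=FI and W=FI_adj and \<Phi>="?\<Phi>" and \<Psi>=char_mult,
            OF FI_bounded_H FI_adj_bounded_Hhat WU UW linH linHhat \<Phi> char_mult_Hhat \<Psi>cong int comm])
  qed
qed

end

section \<open>Fibres of dimension at most one imply commutativity\<close>

subsection \<open>Operators in the commutant are decomposable\<close>

context invariant_subspace
begin

abbreviation "sec u \<xi> \<equiv> (\<lambda>v. u (\<xi>, v))"

lemma fibre_inner_measurable:
  assumes "u \<in> L2 DY" "w \<in> L2 DY"
  shows "(\<lambda>\<xi>. L2_inner Y (sec u \<xi>) (sec w \<xi>)) \<in> borel_measurable \<nu>'"
  using NY.L2_inner_pair_integrable[OF assms] by (rule borel_measurable_integrable)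

lemma fibre_norm_measurable:
  assumes "u \<in> L2 DY"
  shows "(\<lambda>\<xi>. L2_norm Y (sec u \<xi>)) \<in> borel_measurable \<nu>'"
proof -
  have "(\<lambda>\<xi>. sqrt ((L2_norm Y (sec u \<xi>))\<^sup>2)) \<in> borel_measurable \<nu>'"
    using borel_measurable_integrable[OF NY.L2_norm_pair_integrable[OF assms]] by measurable
  then show ?thesis by simp
qed

lemma L2_norm_fibres:
  assumes "u \<in> L2 DY"
  shows "(L2_norm DY u)\<^sup>2 = (\<integral>\<xi>. (L2_norm Y (sec u \<xi>))\<^sup>2 \<partial>\<nu>')"
  unfolding L2_norm_square using NY.integral_fst'[OF L2_integrable_square[OF assms]] by simp

lemma L2_inner_fst_mult:
  assumes "u \<in> L2 DY" "w \<in> L2 DY" "m \<in> borel_measurable \<nu>'" "\<And>\<xi>. cmod (m \<xi>) \<le> C"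
  shows "L2_inner DY (\<lambda>z. m (fst z) * u z) w = (\<integral>\<xi>. m \<xi> * L2_inner Y (sec u \<xi>) (sec w \<xi>) \<partial>\<nu>')"
    and "integrable \<nu>' (\<lambda>\<xi>. m \<xi> * L2_inner Y (sec u \<xi>) (sec w \<xi>))"
proof -
  have mu: "(\<lambda>z. m (fst z) * u z) \<in> L2 DY" by (rule L2_fst_mult[OF assms(1,3,4)])
  show "L2_inner DY (\<lambda>z. m (fst z) * u z) w = (\<integral>\<xi>. m \<xi> * L2_inner Y (sec u \<xi>) (sec w \<xi>) \<partial>\<nu>')"
    unfolding NY.L2_inner_pair[OF mu assms(2)] fst_conv L2_inner_scale_left ..
  show "integrable \<nu>' (\<lambda>\<xi>. m \<xi> * L2_inner Y (sec u \<xi>) (sec w \<xi>))"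
    using NY.L2_inner_pair_integrable[OF mu assms(2)] unfolding fst_conv L2_inner_scale_left .
qed

text \<open>The fibre inner product of two square-integrable functions is in general merely
  integrable. A uniform bound on the fibre norms of one of them makes it square integrable, as
  Fourier uniqueness demands.\<close>

lemma fibre_inner_L2:
  assumes u: "u \<in> L2 DY" and z: "z \<in> L2 DY" and n: "\<And>\<xi>. L2_norm Y (sec u \<xi>) \<le> n"
  shows "(\<lambda>\<xi>. L2_inner Y (sec u \<xi>) (sec z \<xi>)) \<in> L2 \<nu>'"
proof -
  note m = fibre_inner_measurable[OF u z]
  have "integrable \<nu>' (\<lambda>\<xi>. (cmod (L2_inner Y (sec u \<xi>) (sec z \<xi>)))\<^sup>2)"
  proof (rule Bochner_Integration.integrable_bound)
    show "integrable \<nu>' (\<lambda>\<xi>. n\<^sup>2 * (L2_norm Y (sec z \<xi>))\<^sup>2)"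
      using NY.L2_norm_pair_integrable[OF z] by simp
    show "(\<lambda>\<xi>. (cmod (L2_inner Y (sec u \<xi>) (sec z \<xi>)))\<^sup>2) \<in> borel_measurable \<nu>'"
      using m by measurable
    show "AE \<xi> in \<nu>'. norm ((cmod (L2_inner Y (sec u \<xi>) (sec z \<xi>)))\<^sup>2) \<le> norm (n\<^sup>2 * (L2_norm Y (sec z \<xi>))\<^sup>2)"
      using NY.L2_pair_section[OF u] NY.L2_pair_section[OF z]
    proof eventually_elim
      case (elim \<xi>)
      have "cmod (L2_inner Y (sec u \<xi>) (sec z \<xi>)) \<le> L2_norm Y (sec u \<xi>) * L2_norm Y (sec z \<xi>)"
        by (rule L2_Cauchy_Schwarz[OF elim])
      also have "\<dots> \<le> n * L2_norm Y (sec z \<xi>)" by (rule mult_right_mono[OF n]) simp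
      finally have "(cmod (L2_inner Y (sec u \<xi>) (sec z \<xi>)))\<^sup>2 \<le> (n * L2_norm Y (sec z \<xi>))\<^sup>2"
        by (rule power_mono) simp
      then show ?case by (simp add: power_mult_distrib)
    qed
  qed
  then show ?thesis using m by (simp add: L2_def)
qed

text \<open>Truncation by the fibre norm and not by the values of \<open>u\<close>: the factor
  depends on \<open>\<xi>\<close> alone, so the result remains in \<open>Hhat\<close>.\<close>

definition "cutoff n u = (\<lambda>z. (if L2_norm Y (sec u (fst z)) \<le> real n then 1 else 0) * u z)"

lemma cutoff_indicator_measurable:
  assumes "u \<in> L2 DY"
  shows "(\<lambda>\<xi>. if L2_norm Y (sec u \<xi>) \<le> real n then 1 else 0 :: complex) \<in> borel_measurable \<nu>'"
  using fibre_norm_measurable[OF assms] by measurable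

lemma cutoff_Hhat:
  assumes "u \<in> Hhat"
  shows "cutoff n u \<in> Hhat"
  unfolding cutoff_def
  by (rule Hhat_mult[OF assms cutoff_indicator_measurable[OF Hhatd(1)[OF assms]], where C=1]) auto

text \<open>Valid for every \<open>\<xi>\<close>, including those whose fibre is not square
  integrable: there the norm is 0 by the convention for the integral, and scaling respects
  this.\<close>

lemma cutoff_fibre_norm: "L2_norm Y (sec (cutoff n u) \<xi>) \<le> real n"
  unfolding cutoff_def fst_conv L2_norm_scale by simp

lemma cutoff_tendsto:
  assumes u: "u \<in> Hhat"
  shows "L2_lim DY (\<lambda>n. cutoff n u) u"
proof -
  have uL: "u \<in> L2 DY" by (rule Hhatd(1)[OF u])
  have cL: "cutoff n u \<in> L2 DY" for n by (rule Hhatd(1)[OF cutoff_Hhat[OF u]])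
  have "(\<lambda>n. (\<integral>z. (cmod (cutoff n u z - u z))\<^sup>2 \<partial>DY)) \<longlonglongrightarrow> (\<integral>z. 0 \<partial>DY)"
  proof (rule integral_dominated_convergence)
    show "integrable DY (\<lambda>z. (cmod (u z))\<^sup>2)" by (rule L2_integrable_square[OF uL])
    show "(\<lambda>z. (cmod (cutoff n u z - u z))\<^sup>2) \<in> borel_measurable DY" for n
      using L2_measurable[OF L2_diff[OF cL uL]] by measurable
    show "AE z in DY. norm ((cmod (cutoff n u z - u z))\<^sup>2) \<le> (cmod (u z))\<^sup>2" for n
      by (intro AE_I2) (simp add: cutoff_def)
    show "AE z in DY. (\<lambda>n. (cmod (cutoff n u z - u z))\<^sup>2) \<longlonglongrightarrow> 0"
    proof (rule AE_I2)
      fix z :: "'g dual \<times> 'y"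
      obtain k :: nat where k: "L2_norm Y (sec u (fst z)) \<le> real k" using real_arch_simple by blast
      have "(cmod (cutoff n u z - u z))\<^sup>2 = 0" if "n \<ge> k" for n
      proof -
        have "real k \<le> real n" using that by simp
        with k have "L2_norm Y (sec u (fst z)) \<le> real n" by (rule order_trans)
        then show ?thesis by (simp add: cutoff_def)
      qed
      then show "(\<lambda>n. (cmod (cutoff n u z - u z))\<^sup>2) \<longlonglongrightarrow> 0"
        by (intro tendsto_eventually eventually_sequentiallyI[of k])
    qed
  qed simp
  then have "(\<lambda>n. sqrt (\<integral>z. (cmod (cutoff n u z - u z))\<^sup>2 \<partial>DY)) \<longlonglongrightarrow> sqrt (\<integral>z. 0 \<partial>DY)"
    by (rule tendsto_real_sqrt)
  then show ?thesis unfolding L2_norm_def by simp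
qed

lemma VhatD:
  assumes "A \<in> Vhat"
  shows "bounded_op DY Hhat DY Hhat A" "u \<in> Hhat \<Longrightarrow> ae_eq DY (char_mult a (A u)) (A (char_mult a u))"
  using assms by (auto simp: commutant_ops_def)

text \<open>
  With \<open>z = A\<^sup>* w\<close> the function \<open>\<xi> \<mapsto> \<langle>u\<^sub>\<xi>, z\<^sub>\<xi>\<rangle> - \<langle>(A u)\<^sub>\<xi>, w\<^sub>\<xi>\<rangle>\<close> has vanishing Fourier transform because \<open>A\<close> commutes
  with the multiplication by characters, hence it vanishes; the bounded fibres put it into \<open>L\<^sup>2\<close>.
\<close>

lemma Vhat_weak_commute:
  assumes A: "A \<in> Vhat" and u: "u \<in> Hhat" "\<And>\<xi>. L2_norm Y (sec u \<xi>) \<le> n"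
    and w: "w \<in> Hhat" "\<And>\<xi>. L2_norm Y (sec w \<xi>) \<le> k"
    and m: "m \<in> borel_measurable \<nu>'" "\<And>\<xi>. cmod (m \<xi>) \<le> C"
  shows "L2_inner DY (A (\<lambda>z. m (fst z) * u z)) w = L2_inner DY (\<lambda>z. m (fst z) * A u z) w"
proof -
  note Ad = bounded_opD[OF VhatD(1)[OF A]]
  have uL: "u \<in> L2 DY" and wL: "w \<in> L2 DY" and AuL: "A u \<in> L2 DY"
    by (intro Hhatd(1) u w Ad(1))+
  obtain z where z: "z \<in> Hhat" "\<And>x. x \<in> Hhat \<Longrightarrow> L2_inner DY (A x) w = L2_inner DY x z"
    using bounded_op_adjoint_vector[OF Hhat_closed VhatD(1)[OF A] _ wL] Hhatd(1) by blast
  have zL: "z \<in> L2 DY" by (rule Hhatd(1)[OF z(1)])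
  define \<phi> where "\<phi> \<xi> = L2_inner Y (sec u \<xi>) (sec z \<xi>) - L2_inner Y (sec (A u) \<xi>) (sec w \<xi>)" for \<xi>
  have "(\<lambda>\<xi>. cnj (L2_inner Y (sec w \<xi>) (sec (A u) \<xi>))) \<in> L2 \<nu>'"
    by (rule L2_cnj[OF fibre_inner_L2[OF wL AuL w(2)]])
  moreover have "cnj (L2_inner Y (sec w \<xi>) (sec (A u) \<xi>)) = L2_inner Y (sec (A u) \<xi>) (sec w \<xi>)" for \<xi>
    by (rule L2_inner_commute[symmetric])
  ultimately have "(\<lambda>\<xi>. L2_inner Y (sec (A u) \<xi>) (sec w \<xi>)) \<in> L2 \<nu>'" by simp
  from L2_diff[OF fibre_inner_L2[OF uL zL u(2)] this] have \<phi>L: "\<phi> \<in> L2 \<nu>'" unfolding \<phi>_def .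
  have \<phi>int: "integrable \<nu>' \<phi>"
    unfolding \<phi>_def by (intro Bochner_Integration.integrable_diff NY.L2_inner_pair_integrable uL zL AuL wL)
  \<comment> \<open>One formula for two kinds of multipliers: with characters it shows that
    \<open>\<phi>\<close> vanishes, with \<open>m\<close> it then gives the claim.\<close>
  have pair: "(\<integral>\<xi>. p \<xi> * \<phi> \<xi> \<partial>\<nu>') = L2_inner DY (\<lambda>x. p (fst x) * u x) z - L2_inner DY (\<lambda>x. p (fst x) * A u x) w"
    if p: "p \<in> borel_measurable \<nu>'" "\<And>\<xi>. cmod (p \<xi>) \<le> B" for p B
    unfolding L2_inner_fst_mult(1)[OF uL zL p] L2_inner_fst_mult(1)[OF AuL wL p] \<phi>_def right_diff_distrib
    by (rule Bochner_Integration.integral_diff[OF L2_inner_fst_mult(2)[OF uL zL p] L2_inner_fst_mult(2)[OF AuL wL p]])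
  have "(\<integral>\<xi>. cnj (char_fun \<xi> a) * \<phi> \<xi> \<partial>\<nu>') = 0" for a
  proof -
    have cm: "char_mult a u \<in> Hhat" by (rule char_mult_Hhat[OF u(1)])
    have pm: "(\<lambda>\<xi>. cnj (char_fun \<xi> a)) \<in> borel_measurable \<nu>'" by measurable
    have pb: "cmod (cnj (char_fun \<xi> a)) \<le> 1" for \<xi> by (simp add: char_fun_props)
    have "(\<integral>\<xi>. cnj (char_fun \<xi> a) * \<phi> \<xi> \<partial>\<nu>') = L2_inner DY (char_mult a u) z - L2_inner DY (char_mult a (A u)) w"
      unfolding char_mult_def by (rule pair[OF pm pb])
    also have "L2_inner DY (char_mult a u) z = L2_inner DY (A (char_mult a u)) w"
      using z(2)[OF cm] by simp
    also have "\<dots> = L2_inner DY (char_mult a (A u)) w"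
      by (rule L2_inner_cong_ae[OF Hhatd(1)[OF Ad(1)[OF cm]] wL Hhatd(1)[OF char_mult_Hhat[OF Ad(1)[OF u(1)]]] wL
            ae_eq_sym[OF VhatD(2)[OF A u(1)]] ae_eq_refl])
    finally show ?thesis by simp
  qed
  then have \<phi>0: "ae_eq \<nu>' \<phi> (\<lambda>_. 0)" by (rule fourier_inversion_unique[OF \<phi>L \<phi>int])
  have "(\<integral>\<xi>. m \<xi> * \<phi> \<xi> \<partial>\<nu>') = (\<integral>\<xi>. 0 \<partial>\<nu>')"
  proof (rule integral_cong_AE)
    show "(\<lambda>\<xi>. m \<xi> * \<phi> \<xi>) \<in> borel_measurable \<nu>'" using m(1) L2_measurable[OF \<phi>L] by measurable
    show "AE \<xi> in \<nu>'. m \<xi> * \<phi> \<xi> = 0" using \<phi>0 unfolding ae_eq_def by eventually_elim simp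
  qed simp
  then have "L2_inner DY (\<lambda>x. m (fst x) * u x) z = L2_inner DY (\<lambda>x. m (fst x) * A u x) w"
    using pair[OF m] by simp
  then show ?thesis using z(2)[OF Hhat_mult[OF u(1) m]] by simp
qed

text \<open>The weak form is available for vectors with bounded fibres. Their density removes the
  bound on \<open>u\<close>; the bound on the test vector is removed by testing the defect
  \<open>D\<close> against its own cutoffs.\<close>

lemma Vhat_commutes_with_mult:
  assumes A: "A \<in> Vhat" and u: "u \<in> Hhat" and m: "m \<in> borel_measurable \<nu>'" "\<And>\<xi>. cmod (m \<xi>) \<le> C"
  shows "ae_eq DY (A (\<lambda>z. m (fst z) * u z)) (\<lambda>z. m (fst z) * A u z)"
proof -
  note Ab = VhatD(1)[OF A]
  note Ad = bounded_opD[OF Ab]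
  let ?M = "\<lambda>u z. m (fst z) * u z"
  \<comment> \<open>The bound on \<open>m\<close> at an arbitrary character yields the sign of
    \<open>C\<close>.\<close>
  have C: "0 \<le> C" using m(2)[of undefined] norm_ge_zero order_trans by blast
  have linHhat: "linear_subspace DY Hhat" by (rule closed_subspace_linear[OF Hhat_closed])
  have "bounded_op DY (L2 DY) DY (L2 DY) ?M"
    by (rule bounded_op_mult[where C=C]) (use m C in auto)
  then have Mb: "bounded_op DY Hhat DY Hhat ?M"
    by (rule bounded_op_restrict) (auto intro: Hhatd(1) Hhat_mult[OF _ m])
  show ?thesis
  proof (rule bounded_op_agree[OF bounded_op_comp[OF Mb Ab linHhat linHhat] bounded_op_comp[OF Ab Mb linHhat linHhat] linHhat])
    let ?K = "{u \<in> Hhat. \<exists>n. \<forall>\<xi>. L2_norm Y (sec u \<xi>) \<le> n}"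
    show "Hhat \<subseteq> L2 DY" using Hhatd(1) by blast
    show "?K \<subseteq> Hhat" by blast
    show "\<exists>s. (\<forall>n. s n \<in> ?K) \<and> L2_lim DY s f" if f: "f \<in> Hhat" for f
    proof (intro exI conjI allI)
      show "cutoff n f \<in> ?K" for n
        by (intro CollectI conjI cutoff_Hhat[OF f] exI[of _ "real n"] allI cutoff_fibre_norm)
    qed (rule cutoff_tendsto[OF f])
    fix k assume "k \<in> ?K"
    then obtain n where k: "k \<in> Hhat" "\<And>\<xi>. L2_norm Y (sec k \<xi>) \<le> n" by blast
    define D where "D = (\<lambda>z. A (?M k) z - ?M (A k) z)"
    have mem: "A (?M k) \<in> Hhat" "?M (A k) \<in> Hhat"
      by (intro Ad(1) Hhat_mult[OF _ m] k(1))+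
    have D: "D \<in> Hhat" unfolding D_def by (rule Hhatd(5)[OF mem])
    have zero: "L2_inner DY (cutoff j D) D = 0" for j
    proof -
      have "L2_inner DY D (cutoff j D) = L2_inner DY (A (?M k)) (cutoff j D) - L2_inner DY (?M (A k)) (cutoff j D)"
        unfolding D_def
        by (rule L2_inner_diff_left[OF Hhatd(1)[OF mem(1)] Hhatd(1)[OF mem(2)] Hhatd(1)[OF cutoff_Hhat[OF Hhatd(5)[OF mem]]]])
      also have "\<dots> = 0"
        using Vhat_weak_commute[OF A k cutoff_Hhat[OF D] cutoff_fibre_norm m] by simp
      finally show ?thesis unfolding L2_inner_commute[of DY "cutoff j D" D] by simp
    qed
    have "(\<lambda>j. L2_inner DY (cutoff j D) D) \<longlonglongrightarrow> L2_inner DY D D"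
      by (rule L2_inner_tendsto_left[OF Hhatd(1)[OF cutoff_Hhat[OF D]] Hhatd(1)[OF D] Hhatd(1)[OF D] cutoff_tendsto[OF D]])
    then have "L2_inner DY D D = 0" by (simp add: zero LIMSEQ_const_iff)
    then show "ae_eq DY (A (?M k)) (?M (A k))"
      using ae_eq_iff_L2_norm[OF Hhatd(1)[OF mem(1)] Hhatd(1)[OF mem(2)]] by (simp add: L2_inner_self D_def)
  qed (rule u)
qed

text \<open>The condition on the dimension in the form supplied by
  \<open>hilbert_dim_le_one_iff\<close>; both directions work with it and not with bases.\<close>

definition fibre_le_one :: "'g dual \<Rightarrow> bool" where
  "fibre_le_one \<xi> \<longleftrightarrow> (\<forall>x\<in>op_range Y (Phat \<xi>). \<forall>y\<in>op_range Y (Phat \<xi>).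
     L2_inner Y x x = 1 \<longrightarrow> L2_inner Y y y = 1 \<longrightarrow> L2_inner Y x y \<noteq> 0)"

text \<open>Collinearity in almost every fibre, glued to an identity on the product. With cleared
  denominators it also covers the fibres where \<open>u\<close> vanishes.\<close>

lemma fibre_le_one_collinear:
  assumes "AE \<xi> in \<nu>'. fibre_le_one \<xi>" and u: "u \<in> Hhat" and w: "w \<in> Hhat"
  shows "ae_eq DY (\<lambda>z. L2_inner Y (sec u (fst z)) (sec u (fst z)) * w z)
    (\<lambda>z. L2_inner Y (sec w (fst z)) (sec u (fst z)) * u z)"
proof -
  have uL: "u \<in> L2 DY" and wL: "w \<in> L2 DY" by (intro Hhatd(1) u w)+
  note [measurable] = fibre_inner_measurable[OF uL uL] fibre_inner_measurable[OF wL uL]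
    L2_measurable[OF uL] L2_measurable[OF wL]
  have "AE \<xi> in \<nu>'. ae_eq Y (\<lambda>v. L2_inner Y (sec u \<xi>) (sec u \<xi>) * w (\<xi>, v))
      (\<lambda>v. L2_inner Y (sec w \<xi>) (sec u \<xi>) * u (\<xi>, v))"
    using assms(1) Hhat_section[OF u] Hhat_section[OF w]
  proof eventually_elim
    case (elim \<xi>)
    show ?case
      by (rule no_orthonormal_pair_collinear[OF op_range_subspace[OF projections] _ elim(2,3)])
         (use elim(1) in \<open>auto simp: fibre_le_one_def\<close>)
  qed
  then show ?thesis
    by (subst NY.ae_eq_pair_iff) auto
qed

text \<open>
  On one-dimensional fibres \<open>|u|\<^sup>2 T u = \<langle>T u, u\<rangle> u\<close>. Hence \<open>|u|\<^sup>4 S T u = \<langle>S u, u\<rangle> \<langle>T u, u\<rangle> u\<close> is symmetric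
  in \<open>S\<close> and \<open>T\<close>, up to a factor \<open>\<kappa>\<close> which makes the coefficients bounded.
\<close>

lemma Vhat_commutative_if_fibres_le_one:
  assumes fibre_le_one: "AE \<xi> in \<nu>'. fibre_le_one \<xi>"
  shows "commutative_ops DY Hhat Vhat"
  unfolding commutative_ops_def
proof (intro ballI)
  fix S T u assume S: "S \<in> Vhat" and T: "T \<in> Vhat" and u: "u \<in> Hhat"
  have Sb: "R \<in> Vhat \<Longrightarrow> x \<in> Hhat \<Longrightarrow> R x \<in> Hhat" for R x by (rule bounded_opD(1)[OF VhatD(1)])
  define n where "n \<xi> = L2_inner Y (sec u \<xi>) (sec u \<xi>)" for \<xi>
  define c where "c R \<xi> = L2_inner Y (sec (R u) \<xi>) (sec u \<xi>)" for R \<xi>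
  define \<kappa> where "\<kappa> \<xi> = complex_of_real (1 / (1 + cmod (n \<xi>) + cmod (c S \<xi>) + cmod (c T \<xi>)))" for \<xi>
  have uL: "u \<in> L2 DY" by (rule Hhatd(1)[OF u])
  have [measurable]: "n \<in> borel_measurable \<nu>'"
    unfolding n_def by (rule fibre_inner_measurable[OF uL uL])
  have cm: "c R \<in> borel_measurable \<nu>'" if "R \<in> Vhat" for R
    unfolding c_def by (rule fibre_inner_measurable[OF Hhatd(1)[OF Sb[OF that u]] uL])
  note [measurable] = cm[OF S] cm[OF T]
  have [measurable]: "\<kappa> \<in> borel_measurable \<nu>'" unfolding \<kappa>_def by measurable
  have pos: "1 + cmod (n \<xi>) + cmod (c S \<xi>) + cmod (c T \<xi>) > 0" for \<xi> by (simp add: add_pos_nonneg)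
  have \<kappa>b: "cmod (\<kappa> \<xi> * b) \<le> 1" if "cmod b \<le> 1 + cmod (n \<xi>) + cmod (c S \<xi>) + cmod (c T \<xi>)" for \<xi> b
  proof -
    have "cmod (\<kappa> \<xi> * b) = cmod b / (1 + cmod (n \<xi>) + cmod (c S \<xi>) + cmod (c T \<xi>))"
      using pos[of \<xi>] unfolding \<kappa>_def norm_mult norm_of_real by simp
    then show ?thesis using that pos[of \<xi>] by simp
  qed
  have col: "ae_eq DY (\<lambda>z. n (fst z) * R u z) (\<lambda>z. c R (fst z) * u z)" if "R \<in> Vhat" for R
    unfolding n_def c_def by (rule fibre_le_one_collinear[OF fibre_le_one u Sb[OF that u]])
  have key: "ae_eq DY (\<lambda>z. \<kappa> (fst z) * n (fst z) * n (fst z) * R (R' u) z)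
      (\<lambda>z. \<kappa> (fst z) * c R (fst z) * c R' (fst z) * u z)"
    if R: "R \<in> Vhat" and R': "R' \<in> Vhat" and RR': "R' \<in> {S, T}" for R R'
  proof -
    note [measurable] = cm[OF R']
    have mn: "(\<lambda>\<xi>. \<kappa> \<xi> * n \<xi>) \<in> borel_measurable \<nu>'" "(\<lambda>\<xi>. \<kappa> \<xi> * c R' \<xi>) \<in> borel_measurable \<nu>'"
      by measurable
    \<comment> \<open>The multipliers that pass through \<open>R\<close> are
      \<open>\<kappa> * n\<close> and \<open>\<kappa> * c R'\<close>, and these are bounded; the
      second factor \<open>n\<close> and the factor \<open>c R\<close> enter afterwards, outside the
      operator.\<close>
    have bd: "cmod (\<kappa> \<xi> * n \<xi>) \<le> 1" "cmod (\<kappa> \<xi> * c R' \<xi>) \<le> 1" for \<xi>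
      using RR' by (auto intro!: \<kappa>b)
    let ?x = "\<lambda>z. \<kappa> (fst z) * n (fst z) * R' u z" and ?y = "\<lambda>z. \<kappa> (fst z) * c R' (fst z) * u z"
    have x: "?x \<in> Hhat" by (rule Hhat_mult[OF Sb[OF R' u] mn(1) bd(1)])
    have y: "?y \<in> Hhat" by (rule Hhat_mult[OF u mn(2) bd(2)])
    have "ae_eq DY ?x ?y" using ae_eq_mult[OF col[OF R'], of "\<lambda>z. \<kappa> (fst z)"] by (simp add: mult.assoc)
    then have "ae_eq DY (R ?x) (R ?y)" by (rule bounded_opD(2)[OF VhatD(1)[OF R] x y])
    with Vhat_commutes_with_mult[OF R Sb[OF R' u] mn(1) bd(1)] Vhat_commutes_with_mult[OF R u mn(2) bd(2)] col[OF R]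
    show ?thesis unfolding ae_eq_def
    proof eventually_elim
      case (elim z)
      have "\<kappa> (fst z) * n (fst z) * n (fst z) * R (R' u) z = n (fst z) * (\<kappa> (fst z) * n (fst z) * R (R' u) z)"
        by (simp only: mult_ac)
      also have "\<kappa> (fst z) * n (fst z) * R (R' u) z = \<kappa> (fst z) * c R' (fst z) * R u z"
        using elim(1,2,4) by (simp only:)
      also have "n (fst z) * (\<kappa> (fst z) * c R' (fst z) * R u z) = \<kappa> (fst z) * c R' (fst z) * (n (fst z) * R u z)"
        by (simp only: mult_ac)
      also have "\<dots> = \<kappa> (fst z) * c R (fst z) * c R' (fst z) * u z"
        unfolding elim(3) by (simp only: mult_ac)
      finally show ?case .
    qed
  qed
  from key[OF S T insertI2[OF singletonI]] key[OF T S insertI1]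
  have off_zeros: "AE z in DY. n (fst z) \<noteq> 0 \<longrightarrow> S (T u) z = T (S u) z"
    unfolding ae_eq_def
  proof eventually_elim
    case (elim z)
    have "\<kappa> (fst z) * c S (fst z) * c T (fst z) * u z = \<kappa> (fst z) * c T (fst z) * c S (fst z) * u z"
      by (simp only: mult_ac)
    then have "\<kappa> (fst z) * n (fst z) * n (fst z) * S (T u) z = \<kappa> (fst z) * n (fst z) * n (fst z) * T (S u) z"
      by (rule trans[OF elim(1) trans[OF _ elim(2)[symmetric]]])
    moreover have "\<kappa> (fst z) \<noteq> 0" using pos[of "fst z"] unfolding \<kappa>_def of_real_eq_0_iff by simp
    ultimately show ?case by (simp only: mult_cancel_left mult_eq_0_iff) blast
  qed
  \<comment> \<open>Where \<open>n\<close> vanishes the cancellation says nothing, but there the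
    fibre of \<open>u\<close> is null, and operators that commute with multiplication by
    \<open>\<zeta>\<close> keep it null.\<close>
  define \<zeta> where "\<zeta> \<xi> = (if n \<xi> = 0 then 1 else 0 :: complex)" for \<xi>
  have \<zeta>m: "\<zeta> \<in> borel_measurable \<nu>'" unfolding \<zeta>_def by measurable
  have \<zeta>b: "cmod (\<zeta> \<xi>) \<le> 1" for \<xi> by (simp add: \<zeta>_def)
  have zero: "(\<lambda>z. 0) \<in> Hhat" by (rule Hhatd(2))
  have \<zeta>u: "ae_eq DY (\<lambda>z. \<zeta> (fst z) * u z) (\<lambda>z. 0)"
    unfolding ae_eq_fibre[OF L2_fst_mult[OF uL \<zeta>m \<zeta>b] L2_zero]
    using NY.L2_pair_section[OF uL]
  proof eventually_elim
    case (elim \<xi>)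
    show ?case
    proof (cases "n \<xi> = 0")
      case True
      then have "L2_norm Y (sec u \<xi>) = 0" by (simp add: n_def L2_inner_self)
      then show ?thesis using L2_norm_eq_0_iff[OF elim] by (auto simp: ae_eq_def)
    qed (simp add: \<zeta>_def)
  qed
  have kill: "ae_eq DY (\<lambda>z. \<zeta> (fst z) * R x z) (\<lambda>z. 0)"
    if R: "R \<in> Vhat" and x: "x \<in> Hhat" and 0: "ae_eq DY (\<lambda>z. \<zeta> (fst z) * x z) (\<lambda>z. 0)" for R x
  proof -
    have \<zeta>x: "(\<lambda>z. \<zeta> (fst z) * x z) \<in> Hhat" by (rule Hhat_mult[OF x \<zeta>m \<zeta>b])
    have "ae_eq DY (R (\<lambda>z. 0 * x z)) (\<lambda>z. 0 * R x z)" by (rule bounded_opD(4)[OF VhatD(1)[OF R] x])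
    then have R0: "ae_eq DY (R (\<lambda>z. 0)) (\<lambda>z. 0)" by simp
    have "ae_eq DY (\<lambda>z. \<zeta> (fst z) * R x z) (R (\<lambda>z. \<zeta> (fst z) * x z))"
      by (rule ae_eq_sym[OF Vhat_commutes_with_mult[OF R x \<zeta>m \<zeta>b]])
    also have "ae_eq DY \<dots> (R (\<lambda>z. 0))" by (rule bounded_opD(2)[OF VhatD(1)[OF R] \<zeta>x zero 0])
    finally show ?thesis using R0 by (rule ae_eq_trans)
  qed
  have "ae_eq DY (\<lambda>z. \<zeta> (fst z) * S (T u) z) (\<lambda>z. 0)" "ae_eq DY (\<lambda>z. \<zeta> (fst z) * T (S u) z) (\<lambda>z. 0)"
    by (rule kill[OF S Sb[OF T u] kill[OF T u \<zeta>u]] kill[OF T Sb[OF S u] kill[OF S u \<zeta>u]])+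
  with off_zeros show "ae_eq DY (S (T u)) (T (S u))"
    unfolding ae_eq_def by eventually_elim (auto simp: \<zeta>_def split: if_splits)
qed

section \<open>Commutativity forces fibres of dimension at most one\<close>

subsection \<open>Rank one operators in the commutant\<close>

definition "rank_one c d u = (\<lambda>(\<xi>, v). L2_inner Y (sec u \<xi>) c * d v)"

text \<open>The image is the tensor of the partial inner product with \<open>d\<close>, so its norm
  factorises, and Cauchy-Schwarz in the fibres bounds the first factor.\<close>

lemma rank_one_bounded:
  assumes c: "c \<in> L2 Y" and d: "d \<in> L2 Y"
  shows "bounded_op DY (L2 DY) DY (L2 DY) (rank_one c d)"
  unfolding bounded_op_def
proof (intro conjI ballI allI impI)
  have L: "rank_one c d f \<in> L2 DY" if "f \<in> L2 DY" for f
    unfolding rank_one_def by (rule NY.L2_tensor[OF NY.L2_inner_section_L2[OF c that] d])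
  fix f assume f: "f \<in> L2 DY"
  show "rank_one c d f \<in> L2 DY" by (rule L[OF f])
  show "ae_eq DY (rank_one c d f) (rank_one c d g)" if g: "g \<in> L2 DY" and fg: "ae_eq DY f g" for g
    unfolding ae_eq_fibre[OF L[OF f] L[OF g]]
    using NY.L2_pair_section[OF f] NY.L2_pair_section[OF g] fg[unfolded ae_eq_fibre[OF f g]]
  proof eventually_elim
    case (elim \<xi>)
    then show ?case
      using L2_inner_cong_ae[OF elim(1) c elim(2) c elim(3) ae_eq_refl] by (simp add: rank_one_def)
  qed
  show "ae_eq DY (rank_one c d (\<lambda>x. f x + g x)) (\<lambda>y. rank_one c d f y + rank_one c d g y)" if g: "g \<in> L2 DY" for g
    unfolding ae_eq_fibre[OF L[OF L2_add[OF f g]] L2_add[OF L[OF f] L[OF g]]]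
    using NY.L2_pair_section[OF f] NY.L2_pair_section[OF g]
  proof eventually_elim
    case (elim \<xi>)
    then show ?case
      using L2_inner_add_left[OF elim(1) elim(2) c] by (simp add: rank_one_def distrib_right)
  qed
  show "ae_eq DY (rank_one c d (\<lambda>x. a * f x)) (\<lambda>y. a * rank_one c d f y)" for a
    by (simp add: rank_one_def L2_inner_scale_left split_def mult.assoc)
next
  have "L2_norm DY (rank_one c d f) \<le> (L2_norm Y c * L2_norm Y d) * L2_norm DY f" if f: "f \<in> L2 DY" for f
  proof (rule power2_le_imp_le)
    let ?g = "\<lambda>\<xi>. L2_inner Y (sec f \<xi>) c"
    have g: "?g \<in> L2 \<nu>'" by (rule NY.L2_inner_section_L2[OF c f])
    have "of_real ((L2_norm DY (rank_one c d f))\<^sup>2) = (of_real ((L2_norm \<nu>' ?g)\<^sup>2) * of_real ((L2_norm Y d)\<^sup>2) :: complex)"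
      unfolding L2_inner_self[symmetric] rank_one_def by (rule NY.L2_inner_tensor_tensor[OF g d g d])
    then have eq: "(L2_norm DY (rank_one c d f))\<^sup>2 = (L2_norm \<nu>' ?g)\<^sup>2 * (L2_norm Y d)\<^sup>2"
      unfolding of_real_mult[symmetric] of_real_eq_iff .
    have "(L2_norm \<nu>' ?g)\<^sup>2 \<le> (\<integral>\<xi>. (L2_norm Y (sec f \<xi>))\<^sup>2 * (L2_norm Y c)\<^sup>2 \<partial>\<nu>')"
      unfolding L2_norm_square[of \<nu>']
    proof (rule integral_mono_AE)
      show "integrable \<nu>' (\<lambda>\<xi>. (cmod (?g \<xi>))\<^sup>2)" by (rule L2_integrable_square[OF g])
      show "integrable \<nu>' (\<lambda>\<xi>. (L2_norm Y (sec f \<xi>))\<^sup>2 * (L2_norm Y c)\<^sup>2)"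
        using NY.L2_norm_pair_integrable[OF f] by simp
      show "AE \<xi> in \<nu>'. (cmod (?g \<xi>))\<^sup>2 \<le> (L2_norm Y (sec f \<xi>))\<^sup>2 * (L2_norm Y c)\<^sup>2"
        using NY.L2_pair_section[OF f]
      proof eventually_elim
        case (elim \<xi>)
        show ?case
          unfolding power_mult_distrib[symmetric] by (rule power_mono[OF L2_Cauchy_Schwarz[OF elim c]]) simp
      qed
    qed
    also have "\<dots> = (L2_norm DY f)\<^sup>2 * (L2_norm Y c)\<^sup>2" by (simp add: L2_norm_fibres[OF f])
    finally have "(L2_norm DY (rank_one c d f))\<^sup>2 \<le> ((L2_norm DY f)\<^sup>2 * (L2_norm Y c)\<^sup>2) * (L2_norm Y d)\<^sup>2"
      unfolding eq by (rule mult_right_mono) simp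
    then show "(L2_norm DY (rank_one c d f))\<^sup>2 \<le> ((L2_norm Y c * L2_norm Y d) * L2_norm DY f)\<^sup>2"
      by (simp add: power_mult_distrib mult_ac)
  qed simp
  then show "\<exists>C. \<forall>f\<in>L2 DY. L2_norm DY (rank_one c d f) \<le> C * L2_norm DY f" by blast
qed

text \<open>In the fibre over \<open>\<xi>\<close> the multiplication is by one scalar, with which
  \<open>Phat \<xi>\<close> commutes.\<close>

lemma PF_char_mult:
  assumes f: "f \<in> L2 DY"
  shows "ae_eq DY (PF (char_mult a f)) (char_mult a (PF f))"
proof -
  have cf: "char_mult a f \<in> L2 DY" by (rule bounded_opD(1)[OF char_mult_bounded f])
  have cP: "char_mult a (PF f) \<in> L2 DY"
    by (rule bounded_opD(1)[OF char_mult_bounded Hhatd(1)[OF PF_in_Hhat[OF f]]])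
  show ?thesis
    unfolding ae_eq_fibre[OF Hhatd(1)[OF PF_in_Hhat[OF cf]] cP]
    using PF_fibre[OF f] PF_fibre[OF cf] NY.L2_pair_section[OF f]
  proof eventually_elim
    case (elim \<xi>)
    have "ae_eq Y (\<lambda>v. PF (char_mult a f) (\<xi>, v)) (Phat \<xi> (\<lambda>v. cnj (char_fun \<xi> a) * f (\<xi>, v)))"
      using elim(2) by (simp add: char_mult_def)
    also have "ae_eq Y \<dots> (\<lambda>v. cnj (char_fun \<xi> a) * Phat \<xi> (sec f \<xi>) v)"
      by (rule bounded_opD(4)[OF orth_projectionD(1)[OF projections] elim(3)])
    also have "ae_eq Y \<dots> (\<lambda>v. cnj (char_fun \<xi> a) * PF f (\<xi>, v))"
      by (rule ae_eq_mult[OF ae_eq_sym[OF elim(1)]])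
    finally show ?case by (simp add: char_mult_def)
  qed
qed

text \<open>Because \<open>c\<close> and \<open>d\<close> do not vary with \<open>\<xi>\<close>, the
  coefficient \<open>\<langle>u\<^sub>\<xi>, c\<rangle>\<close> is linear over functions of
  \<open>\<xi>\<close>, so the uncompressed field commutes with the characters exactly. Composing
  with \<open>PF\<close> brings the values into \<open>Hhat\<close>.\<close>

lemma compressed_rank_one_in_Vhat:
  assumes c: "c \<in> L2 Y" and d: "d \<in> L2 Y"
  shows "(\<lambda>u. PF (rank_one c d u)) \<in> Vhat"
proof -
  have linHhat: "linear_subspace DY Hhat" by (rule closed_subspace_linear[OF Hhat_closed])
  note rb = rank_one_bounded[OF c d]
  have "bounded_op DY Hhat DY (L2 DY) (rank_one c d)"
    by (rule bounded_op_restrict[OF rb]) (auto intro: Hhatd(1) bounded_opD(1)[OF rb])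
  then have "bounded_op DY Hhat DY Hhat (\<lambda>u. PF (rank_one c d u))"
    by (rule bounded_op_comp[OF _ PF_bounded linHhat linear_subspace_L2])
  moreover have "ae_eq DY (char_mult a (PF (rank_one c d u))) (PF (rank_one c d (char_mult a u)))" if u: "u \<in> Hhat" for a u
  proof -
    have "rank_one c d (char_mult a u) = char_mult a (rank_one c d u)"
      by (auto simp: rank_one_def char_mult_def L2_inner_scale_left mult.assoc)
    then show ?thesis
      using ae_eq_sym[OF PF_char_mult[OF bounded_opD(1)[OF rb Hhatd(1)[OF u]], of a]] by simp
  qed
  ultimately show ?thesis by (simp add: commutant_ops_def)
qed

lemma compressed_rank_one_fibre:
  assumes c: "c \<in> L2 Y" and d: "d \<in> L2 Y" and u: "u \<in> L2 DY"
  shows "AE \<xi> in \<nu>'. ae_eq Y (sec (PF (rank_one c d u)) \<xi>) (\<lambda>v. L2_inner Y (sec u \<xi>) c * Phat \<xi> d v)"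
  using PF_fibre[OF bounded_opD(1)[OF rank_one_bounded[OF c d] u]]
proof eventually_elim
  case (elim \<xi>)
  have "ae_eq Y (sec (PF (rank_one c d u)) \<xi>) (Phat \<xi> (\<lambda>v. L2_inner Y (sec u \<xi>) c * d v))"
    using elim by (simp add: rank_one_def)
  then show ?case
    by (rule ae_eq_trans[OF _ bounded_opD(4)[OF orth_projectionD(1)[OF projections] d]])
qed

lemma commuting_rank_ones_identity:
  assumes comm: "commutative_ops DY Hhat Vhat"
    and c: "c \<in> L2 Y" and d: "d \<in> L2 Y" and K: "K \<in> sets \<nu>'" "emeasure \<nu>' K < \<infinity>"
  shows "AE \<xi> in \<nu>'. \<xi> \<in> K \<longrightarrow>
    L2_inner Y (Phat \<xi> d) d * L2_inner Y (Phat \<xi> c) c * L2_inner Y (Phat \<xi> d) d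
    = L2_inner Y (Phat \<xi> d) c * L2_inner Y (Phat \<xi> d) d * L2_inner Y (Phat \<xi> c) d"
proof -
  \<comment> \<open>The constant field \<open>d\<close> need not be square integrable, hence the
    indicator of a set of finite measure. On \<open>K\<close> the fibre of \<open>PF e\<close> is
    \<open>Phat \<xi> d\<close>.\<close>
  define e where "e = (\<lambda>(\<xi>, v). indicator K \<xi> * d v :: complex)"
  have e: "e \<in> L2 DY" unfolding e_def by (rule NY.L2_tensor[OF L2_indicator[OF K] d])
  define u where "u = PF e"
  have u: "u \<in> Hhat" unfolding u_def by (rule PF_in_Hhat[OF e])
  have uL: "u \<in> L2 DY" by (rule Hhatd(1)[OF u])
  let ?R = "\<lambda>c d u. PF (rank_one c d u)"
  have RV: "?R c d \<in> Vhat" "?R d c \<in> Vhat" by (intro compressed_rank_one_in_Vhat c d)+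
  have RH: "?R c d x \<in> Hhat" "?R d c x \<in> Hhat" if "x \<in> Hhat" for x
    using bounded_opD(1)[OF VhatD(1)[OF RV(1)] that] bounded_opD(1)[OF VhatD(1)[OF RV(2)] that] .
  have RL: "?R c d x \<in> L2 DY" "?R d c x \<in> L2 DY" if "x \<in> Hhat" for x
    using RH[OF that] Hhatd(1) by blast+
  have "ae_eq DY (?R c d (?R d c u)) (?R d c (?R c d u))"
    using comm[unfolded commutative_ops_def, rule_format, OF RV u] .
  then have eq: "AE \<xi> in \<nu>'. ae_eq Y (sec (?R c d (?R d c u)) \<xi>) (sec (?R d c (?R c d u)) \<xi>)"
    unfolding ae_eq_fibre[OF RL(1)[OF RH(2)[OF u]] RL(2)[OF RH(1)[OF u]]] .
  show ?thesis
    using eq PF_fibre[OF e] NY.L2_pair_section[OF uL]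
      compressed_rank_one_fibre[OF c d uL] compressed_rank_one_fibre[OF d c uL]
      compressed_rank_one_fibre[OF c d RL(2)[OF u]] compressed_rank_one_fibre[OF d c RL(1)[OF u]]
      NY.L2_pair_section[OF RL(1)[OF u]] NY.L2_pair_section[OF RL(2)[OF u]]
  proof eventually_elim
    case (elim \<xi>)
    let ?P = "Phat \<xi>"
    have Pd: "?P d \<in> L2 Y" and Pc: "?P c \<in> L2 Y" by (intro orth_projectionD(4)[OF projections] c d)+
    show ?case
    proof
      assume \<xi>: "\<xi> \<in> K"
      have ud: "ae_eq Y (sec u \<xi>) (?P d)"
        using elim(2) \<xi> by (simp add: u_def e_def)
      have iu: "L2_inner Y (sec u \<xi>) x = L2_inner Y (?P d) x" if "x \<in> L2 Y" for x
        by (rule L2_inner_cong_ae[OF elim(3) that Pd that ud ae_eq_refl])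
      have "L2_inner Y (sec (?R d c u) \<xi>) c = L2_inner Y (\<lambda>v. L2_inner Y (sec u \<xi>) d * ?P c v) c"
        by (rule L2_inner_cong_ae[OF elim(9) c L2_scale[OF Pc] c elim(5) ae_eq_refl])
      then have 1: "L2_inner Y (sec (?R d c u) \<xi>) c = L2_inner Y (?P d) d * L2_inner Y (?P c) c"
        unfolding L2_inner_scale_left iu[OF d] .
      have "L2_inner Y (sec (?R c d u) \<xi>) d = L2_inner Y (\<lambda>v. L2_inner Y (sec u \<xi>) c * ?P d v) d"
        by (rule L2_inner_cong_ae[OF elim(8) d L2_scale[OF Pd] d elim(4) ae_eq_refl])
      then have 2: "L2_inner Y (sec (?R c d u) \<xi>) d = L2_inner Y (?P d) c * L2_inner Y (?P d) d"
        unfolding L2_inner_scale_left iu[OF c] .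
      have "ae_eq Y (\<lambda>v. (L2_inner Y (?P d) d * L2_inner Y (?P c) c) * ?P d v)
          (\<lambda>v. (L2_inner Y (?P d) c * L2_inner Y (?P d) d) * ?P c v)"
        using ae_eq_trans[OF ae_eq_trans[OF ae_eq_sym[OF elim(6)] elim(1)] elim(7)] unfolding 1 2 .
      then have "L2_inner Y (\<lambda>v. (L2_inner Y (?P d) d * L2_inner Y (?P c) c) * ?P d v) d
          = L2_inner Y (\<lambda>v. (L2_inner Y (?P d) c * L2_inner Y (?P d) d) * ?P c v) d"
        by (rule L2_inner_cong_ae[OF L2_scale[OF Pd] d L2_scale[OF Pc] d _ ae_eq_refl])
      then show "L2_inner Y (?P d) d * L2_inner Y (?P c) c * L2_inner Y (?P d) d
          = L2_inner Y (?P d) c * L2_inner Y (?P d) d * L2_inner Y (?P c) d"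
        unfolding L2_inner_scale_left .
    qed
  qed
qed

text \<open>Separability makes the pairs of test vectors countable, and \<sigma>-finiteness the sets
  \<open>K i\<close>. One null set serves them all, and off it the identity excludes an orthonormal
  pair.\<close>

lemma fibres_le_one_if_Vhat_commutative:
  assumes comm: "commutative_ops DY Hhat Vhat"
  shows "AE \<xi> in \<nu>'. fibre_le_one \<xi>"
proof -
  obtain D where D: "countable D" "D \<subseteq> L2 Y"
    and dense: "\<And>f. f \<in> L2 Y \<Longrightarrow> \<exists>s. (\<forall>n::nat. s n \<in> D) \<and> L2_lim Y s f"
    by (rule separable_total_sequence[OF separable_Y]) blast
  obtain K :: "nat \<Rightarrow> 'g dual set" where K: "range K \<subseteq> sets \<nu>'" "(\<Union>i. K i) = space \<nu>'" "\<And>i. emeasure \<nu>' (K i) \<noteq> \<infinity>"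
    by (rule \<nu>'.sigma_finite) blast
  have "AE \<xi> in \<nu>'. \<forall>c\<in>D. \<forall>d\<in>D. \<forall>i. \<xi> \<in> K i \<longrightarrow>
    L2_inner Y (Phat \<xi> d) d * L2_inner Y (Phat \<xi> c) c * L2_inner Y (Phat \<xi> d) d
    = L2_inner Y (Phat \<xi> d) c * L2_inner Y (Phat \<xi> d) d * L2_inner Y (Phat \<xi> c) d"
    unfolding AE_ball_countable[OF D(1)] AE_all_countable
    using K D(2) by (intro ballI allI commuting_rank_ones_identity[OF comm]) (auto simp: less_top[symmetric])
  then show ?thesis
  proof eventually_elim
    case (elim \<xi>)
    obtain i where i: "\<xi> \<in> K i" using K(2) by auto
    show "fibre_le_one \<xi>"
      unfolding fibre_le_one_def
    proof (intro ballI impI)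
      fix x y assume "x \<in> op_range Y (Phat \<xi>)" "y \<in> op_range Y (Phat \<xi>)" "L2_inner Y x x = 1" "L2_inner Y y y = 1"
      then show "L2_inner Y x y \<noteq> 0"
        using rank_one_identity_excludes_pair[OF projections D(2) dense elim[rule_format, OF _ _ i], of x y]
        by blast
    qed
  qed
qed

theorem commutative_iff_fibre_dim_le_one:
  "commutative_ops GY H (invariant_ops \<nu> Y H) \<longleftrightarrow>
    (AE \<xi> in \<nu>'. 0 < hilbert_dim Y (op_range Y (Phat \<xi>)) \<longrightarrow> hilbert_dim Y (op_range Y (Phat \<xi>)) = 1)"
  unfolding commutative_iff_Vhat hilbert_dim_le_one_iff[OF op_range_subspace[OF projections]] fibre_le_one_def[symmetric]
  using Vhat_commutative_if_fibres_le_one fibres_le_one_if_Vhat_commutative by blast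

end

theorem proposition5p6:
  fixes \<nu> :: "'g::{topological_ab_group_add, t2_space} measure"
    and \<nu>' :: "'g dual measure"
    and Y :: "'y measure"
    and H :: "('g \<times> 'y \<Rightarrow> complex) set"
    and Phat :: "'g dual \<Rightarrow> ('y \<Rightarrow> complex) \<Rightarrow> ('y \<Rightarrow> complex)"
    and d :: "'g dual \<Rightarrow> enat"
    and \<Omega> :: "'g dual set"
  assumes locally_compact_G: "locally_compact_space (euclidean :: 'g topology)"
    and sigma_compact_G: "\<exists>K :: nat \<Rightarrow> 'g set. (\<forall>n. compact (K n)) \<and> (\<Union>n. K n) = UNIV"
    and metrizable_G: "metrizable_space (euclidean :: 'g topology)"
    and haar: "haar_measure \<nu>"
    and dual_haar: "dual_haar_measure \<nu> \<nu>'"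
    and sigma_finite_Y: "sigma_finite_measure Y"
    and separable_G: "separable_L2 \<nu>"
    and separable_Y: "separable_L2 Y"
    and closed_H: "closed_subspace (\<nu> \<Otimes>\<^sub>M Y) H"
    and invariant_H: "\<And>a f. f \<in> H \<Longrightarrow> translation a f \<in> H"
    and projections: "\<And>\<xi>. orth_projection Y (Phat \<xi>)"
    and decomposition: "direct_integral_op \<nu>' Y (fourier_projection \<nu> \<nu>' Y H) Phat"
    and d_def: "\<And>\<xi>. d \<xi> = hilbert_dim Y (op_range Y (Phat \<xi>))"
    and Omega_def: "\<Omega> = {\<xi>. d \<xi> > 0}"
  shows "commutative_ops (\<nu> \<Otimes>\<^sub>M Y) H (invariant_ops \<nu> Y H) \<longleftrightarrow>
         (AE \<xi> in \<nu>'. \<xi> \<in> \<Omega> \<longrightarrow> d \<xi> = 1)"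
proof -
  interpret invariant_subspace \<nu> \<nu>' Y H Phat
    by (intro invariant_subspace.intro fourier_pair.intro invariant_subspace_axioms.intro) (fact assms)+
  show ?thesis
    using commutative_iff_fibre_dim_le_one by (simp add: Omega_def d_def)
qed


end
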